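(* Lose-in-1 Checkers is in NP. Its input is a generalized checkers configuration on an $n\times n$ board. The question is whether the player to move has a legal move after which the opponent is forced to win on the opponent's next move, meaning that every legal move available to the opponent captures all of the first player's remaining pieces.
   Context: Generalized checkers (American checkers / English draughts) is played on an $n\times n$ checkerboard with an arbitrary initial arrangement of pieces. Each piece belongs to Black or Red and is either an ordinary piece or a king, and all pieces lie on dark squares. Black is the player to move. A non-king piece moves diagonally forward, toward the opponent's side, to an adjacent empty dark square. A king may move diagonally in any direction to an adjacent empty dark square. A jump (capture) is possible when a player's piece, a diagonally adjacent opponent piece, and an empty square lie consecutively along a diagonal, in a direction the piece is allowed to move. The piece then lands on the empty square and the opponent's piece is removed. If any jump is available, the player must jump. Jumps must be chained, so a turn continues while the jumping piece has another jump available. A non-king piece that reaches the far row becomes a king. A player wins by capturing all of the opponent's pieces. *)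

theory Defs
  imports Main "HOL-Computational_Algebra.Polynomial"
begin

section \<open>Deterministic multi-tape Turing machines and the class NP\<close>

text \<open>Symbol 0 is the blank; symbols 1 and 2 represent the bits 0 and 1.\<close>

datatype dir = MoveLeft | Stay | MoveRight

record machine =
  num_tapes :: nat
  states :: "nat set"
  symbols :: "nat set"
  start_state :: nat
  accept_state :: nat
  reject_state :: nat
  delta :: "nat \<Rightarrow> nat list \<Rightarrow> nat \<times> (nat \<times> dir) list"

definition wf_machine :: "machine \<Rightarrow> bool" where
  "wf_machine M \<longleftrightarrow>
     2 \<le> num_tapes M \<and> finite (states M) \<and> finite (symbols M) \<and> {0, 1, 2} \<subseteq> symbols M \<and>
     {start_state M, accept_state M, reject_state M} \<subseteq> states M \<and>
     accept_state M \<noteq> reject_state M \<and>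
     (\<forall>q \<in> states M. \<forall>xs. length xs = num_tapes M \<and> set xs \<subseteq> symbols M \<longrightarrow>
        (case delta M q xs of (q', acts) \<Rightarrow>
           q' \<in> states M \<and> length acts = num_tapes M \<and> fst ` set acts \<subseteq> symbols M))"

text \<open>A tape is infinite in both directions and comes with its head position.\<close>

type_synonym tape = "(int \<Rightarrow> nat) \<times> int"
type_synonym tm_config = "nat \<times> tape list"

fun read_tape :: "tape \<Rightarrow> nat" where
  "read_tape (t, h) = t h"

fun dir_offset :: "dir \<Rightarrow> int" where
  "dir_offset MoveLeft = -1"
| "dir_offset Stay = 0"
| "dir_offset MoveRight = 1"

fun act_tape :: "nat \<times> dir \<Rightarrow> tape \<Rightarrow> tape" where
  "act_tape (a, d) (t, h) = (t(h := a), h + dir_offset d)"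

definition halted :: "machine \<Rightarrow> tm_config \<Rightarrow> bool" where
  "halted M c \<longleftrightarrow> fst c \<in> {accept_state M, reject_state M}"

definition tm_step :: "machine \<Rightarrow> tm_config \<Rightarrow> tm_config" where
  "tm_step M c = (if halted M c then c else
     (case delta M (fst c) (map read_tape (snd c)) of
       (q', acts) \<Rightarrow> (q', map2 act_tape acts (snd c))))"

definition input_tape :: "bool list \<Rightarrow> tape" where
  "input_tape w =
     (\<lambda>i. if 0 \<le> i \<and> i < int (length w) then (if w ! nat i then 2 else 1) else 0, 0)"

text \<open>A verifier receives the input on its first tape and the certificate on its second tape.\<close>

definition init_config :: "machine \<Rightarrow> bool list \<Rightarrow> bool list \<Rightarrow> tm_config" where
  "init_config M x u =
     (start_state M, [input_tape x, input_tape u] @ replicate (num_tapes M - 2) (input_tape []))"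

definition run :: "machine \<Rightarrow> bool list \<Rightarrow> bool list \<Rightarrow> nat \<Rightarrow> tm_config" where
  "run M x u t = (tm_step M ^^ t) (init_config M x u)"

definition accepts :: "machine \<Rightarrow> bool list \<Rightarrow> bool list \<Rightarrow> bool" where
  "accepts M x u \<longleftrightarrow> (\<exists>t. fst (run M x u t) = accept_state M)"

definition polytime :: "machine \<Rightarrow> bool" where
  "polytime M \<longleftrightarrow>
     (\<exists>p :: nat poly. \<forall>x u. halted M (run M x u (poly p (length x + length u))))"

definition NP :: "bool list set set" where
  "NP = {L. \<exists>M (q :: nat poly). wf_machine M \<and> polytime M \<and>
     (\<forall>x. x \<in> L \<longleftrightarrow> (\<exists>u. length u \<le> poly q (length x) \<and> accepts M x u))}"


section \<open>Generalized checkers\<close>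

datatype player = Black | Red
datatype rank = Man | King

type_synonym piece = "player \<times> rank"
type_synonym square = "int \<times> int"
type_synonym board = "square \<Rightarrow> piece option"

fun opponent :: "player \<Rightarrow> player" where
  "opponent Black = Red"
| "opponent Red = Black"

text \<open>Squares are (row, column) pairs. Row 0 is Black's home row, and the corner (0, 0) at Black's
  left hand is dark, as on the standard board.\<close>

fun on_board :: "nat \<Rightarrow> square \<Rightarrow> bool" where
  "on_board n (r, c) \<longleftrightarrow> 0 \<le> r \<and> r < int n \<and> 0 \<le> c \<and> c < int n"

fun dark :: "square \<Rightarrow> bool" where
  "dark (r, c) \<longleftrightarrow> even (r + c)"

definition valid_board :: "nat \<Rightarrow> board \<Rightarrow> bool" where
  "valid_board n b \<longleftrightarrow> (\<forall>s. b s \<noteq> None \<longrightarrow> on_board n s \<and> dark s)"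

definition has_piece :: "player \<Rightarrow> board \<Rightarrow> bool" where
  "has_piece p b \<longleftrightarrow> (\<exists>s k. b s = Some (p, k))"

fun forward :: "player \<Rightarrow> int" where
  "forward Black = 1"
| "forward Red = -1"

fun far_row :: "nat \<Rightarrow> player \<Rightarrow> int" where
  "far_row n Black = int n - 1"
| "far_row n Red = 0"

fun directions :: "piece \<Rightarrow> (int \<times> int) set" where
  "directions (p, Man) = {forward p} \<times> {-1, 1}"
| "directions (p, King) = {-1, 1} \<times> {-1, 1}"

fun shift :: "square \<Rightarrow> int \<Rightarrow> int \<times> int \<Rightarrow> square" where
  "shift (r, c) m (dr, dc) = (r + m * dr, c + m * dc)"

fun crown :: "nat \<Rightarrow> square \<Rightarrow> piece \<Rightarrow> piece" where
  "crown n (r, c) (p, k) = (p, if r = far_row n p then King else k)"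

definition simple_move :: "nat \<Rightarrow> player \<Rightarrow> board \<Rightarrow> board \<Rightarrow> bool" where
  "simple_move n p b b' \<longleftrightarrow> (\<exists>s k d. b s = Some (p, k) \<and> d \<in> directions (p, k) \<and>
     on_board n (shift s 1 d) \<and> b (shift s 1 d) = None \<and>
     b' = b(s := None, shift s 1 d \<mapsto> crown n (shift s 1 d) (p, k)))"

text \<open>A jump is a relation between a board with the location of the jumping piece and the same
  data after the jump. The captured piece is removed at once.\<close>

definition jump :: "nat \<Rightarrow> player \<Rightarrow> board \<times> square \<Rightarrow> board \<times> square \<Rightarrow> bool" where
  "jump n p = (\<lambda>(b, s) (b', s'). \<exists>k d k'. b s = Some (p, k) \<and> d \<in> directions (p, k) \<and>
     b (shift s 1 d) = Some (opponent p, k') \<and>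
     s' = shift s 2 d \<and> on_board n s' \<and> b s' = None \<and>
     b' = b(s := None, shift s 1 d := None, s' \<mapsto> (p, k)))"

text \<open>A jumping turn is a maximal nonempty chain of jumps by one piece. Promotion takes effect at
  the end of the turn: a man that jumps to the far row has no forward jump left, so its turn ends
  there and it is crowned, as in American checkers.\<close>

definition jump_turn :: "nat \<Rightarrow> player \<Rightarrow> board \<Rightarrow> board \<Rightarrow> bool" where
  "jump_turn n p b b' \<longleftrightarrow> (\<exists>s b1 s1. (jump n p)\<^sup>+\<^sup>+ (b, s) (b1, s1) \<and>
     (\<nexists>x. jump n p (b1, s1) x) \<and>
     b' = b1(s1 := map_option (crown n s1) (b1 s1)))"

definition can_jump :: "nat \<Rightarrow> player \<Rightarrow> board \<Rightarrow> bool" where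
  "can_jump n p b \<longleftrightarrow> (\<exists>s x. jump n p (b, s) x)"

definition legal_move :: "nat \<Rightarrow> player \<Rightarrow> board \<Rightarrow> board \<Rightarrow> bool" where
  "legal_move n p b b' \<longleftrightarrow>
     (if can_jump n p b then jump_turn n p b b' else simple_move n p b b')"

text \<open>A player is forced to win on this move if there is a legal move and every legal move
  captures all remaining enemy pieces. A player who cannot move does not win.\<close>

definition forced_to_win :: "nat \<Rightarrow> player \<Rightarrow> board \<Rightarrow> bool" where
  "forced_to_win n p b \<longleftrightarrow>
     (\<exists>b'. legal_move n p b b') \<and>
     (\<forall>b'. legal_move n p b b' \<longrightarrow> \<not> has_piece (opponent p) b')"

definition lose_in_1 :: "nat \<Rightarrow> board \<Rightarrow> bool" where
  "lose_in_1 n b \<longleftrightarrow> (\<exists>b'. legal_move n Black b b' \<and> forced_to_win n Red b')"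


section \<open>Lose-in-1 Checkers as a language\<close>

text \<open>A configuration is encoded by n in unary, followed by three bits for each of the n * n squares
  in row-major order.\<close>

fun encode_cell :: "piece option \<Rightarrow> bool list" where
  "encode_cell None = [False, False, False]"
| "encode_cell (Some (p, k)) = [True, p = Red, k = King]"

definition encode :: "nat \<Rightarrow> board \<Rightarrow> bool list" where
  "encode n b = replicate n True @ [False] @
     concat [encode_cell (b (int r, int c)). r \<leftarrow> [0..<n], c \<leftarrow> [0..<n]]"

definition Lose_in_1_Checkers :: "bool list set" where
  "Lose_in_1_Checkers = {encode n b | n b. valid_board n b \<and> lose_in_1 n b}"

end

theory Submission
  imports Defs
begin

text \<open>A jumping piece moves along a trail in a graph: vertices are the squares on which it can land,
  edges are the capturable pieces. Red is forced to win iff Red can jump and, from each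
  possible start, all maximal trails use all edges and all black pieces are edges. For a king at \<open>s\<close> this
  holds iff some \<open>t\<close> is such that the vertices of odd degree are exactly \<open>s\<close> and \<open>t\<close> (none if \<open>s = t\<close>)
  and deleting \<open>t\<close> leaves a forest: by parity a trail can only get stuck at \<open>t\<close>, what it leaves is an
  even graph avoiding \<open>t\<close>, and conversely any closed trail avoiding \<open>t\<close> can be left out. For a man the graph is
  directed with one edge per row, so there is essentially one trail.

  Hence a certificate with the board after each of Black's jumps and an order witnessing the
  forest condition makes the problem expressible by an arithmetic formula with bounded
  quantifiers over the input and the certificate. Such formulas are evaluated in polynomial time by a Turing machine
  that stores each number as the head position on a tape of its own.\<close>

section \<open>Structured programs on counters\<close>

text \<open>The obstacle is the quantifier over Red's replies: read literally, the question asks for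
  a move of Black after which all of possibly exponentially many jump sequences win. The condition
  with \<open>t\<close> removes this alternation. It is Ore's description of the graphs that are
  Eulerian however they are traversed, extended from closed trails to trails from \<open>s\<close>
  to \<open>t\<close>: every cycle must pass through the end. Connectivity is never tested, because
  edges missed by a stuck trail would contain a cycle off \<open>t\<close>. Acyclicity speaks about
  sets of vertices, which number quantifiers do not reach, so an elimination order is guessed
  instead. Black's own turn is simply recorded: each jump captures a piece, so at most
  \<open>n * n\<close> jumps occur. Head positions are unary counters; this is affordable because
  terms are polynomials and every quantifier is bounded by a term. Finally, Red can win only by
  jumping, since the piece that Black has just moved is still on the board.\<close>

datatype com =
    Act "nat list" "nat list"
  | Seq com com
  | Cond nat nat com com
  | While nat nat com

text \<open>Register \<open>i\<close> of a program is the head position on tape \<open>i\<close>. A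
  work tape holds 1 in cell 0 and blanks elsewhere, so scanning a 1 there is the test for zero;
  tapes 0 and 1 show one bit of the input or of the certificate.\<close>

fun content :: "bool list \<Rightarrow> bool list \<Rightarrow> nat \<Rightarrow> int \<Rightarrow> nat" where
  "content x u i = (if i = 0 then fst (input_tape x) else if i = 1 then fst (input_tape u)
     else (\<lambda>p. if p = 0 then 1 else 0))"

declare content.simps [simp del]

definition sym :: "bool list \<Rightarrow> bool list \<Rightarrow> (nat \<Rightarrow> nat) \<Rightarrow> nat \<Rightarrow> nat" where
  "sym x u \<sigma> i = content x u i (int (\<sigma> i))"

text \<open>The number counts machine steps exactly. The guard on decrements keeps every head at a
  natural position although the tapes are two-way infinite. A loop runs until the symbol
  \<open>a\<close> is scanned.\<close>

inductive exec :: "bool list \<Rightarrow> bool list \<Rightarrow> com \<Rightarrow> (nat \<Rightarrow> nat) \<Rightarrow> nat \<Rightarrow> (nat \<Rightarrow> nat) \<Rightarrow> bool"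
  for x u where
  exec_Act: "(\<And>i. i \<in> set D \<Longrightarrow> 0 < \<sigma> i) \<Longrightarrow> exec x u (Act A D) \<sigma> 1
     (\<lambda>i. if i \<in> set A then Suc (\<sigma> i) else if i \<in> set D then \<sigma> i - 1 else \<sigma> i)"
| exec_Seq: "exec x u a \<sigma> s \<sigma>' \<Longrightarrow> exec x u b \<sigma>' t \<sigma>'' \<Longrightarrow> exec x u (Seq a b) \<sigma> (s + t) \<sigma>''"
| exec_If: "exec x u (if sym x u \<sigma> i = a then c\<^sub>1 else c\<^sub>2) \<sigma> t \<sigma>' \<Longrightarrow>
     exec x u (Cond i a c\<^sub>1 c\<^sub>2) \<sigma> (Suc t) \<sigma>'"
| exec_WhileF: "sym x u \<sigma> i = a \<Longrightarrow> exec x u (While i a c) \<sigma> 1 \<sigma>"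
| exec_WhileT: "sym x u \<sigma> i \<noteq> a \<Longrightarrow> exec x u c \<sigma> s \<sigma>' \<Longrightarrow> exec x u (While i a c) \<sigma>' t \<sigma>'' \<Longrightarrow>
     exec x u (While i a c) \<sigma> (Suc (s + t)) \<sigma>''"

text \<open>Only tested registers count: a move of a register that has no tape is invisible in
  \<open>conf\<close>, which shows the first \<open>K\<close> registers.\<close>

fun reg_bound :: "com \<Rightarrow> nat" where
  "reg_bound (Act A D) = 0"
| "reg_bound (Seq a b) = max (reg_bound a) (reg_bound b)"
| "reg_bound (Cond i a c\<^sub>1 c\<^sub>2) = max (Suc i) (max (reg_bound c\<^sub>1) (reg_bound c\<^sub>2))"
| "reg_bound (While i a c) = max (Suc i) (reg_bound c)"


section \<open>Compilation to Turing machines\<close>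

datatype instr = Move "nat list" "nat list" nat | Branch nat nat nat nat

fun targets :: "instr \<Rightarrow> nat set" where
  "targets (Move A D q) = {q}"
| "targets (Branch i a q q') = {q, q'}"

fun com_size :: "com \<Rightarrow> nat" where
  "com_size (Act A D) = 1"
| "com_size (Seq a b) = com_size a + com_size b"
| "com_size (Cond i a c\<^sub>1 c\<^sub>2) = Suc (com_size c\<^sub>1 + com_size c\<^sub>2)"
| "com_size (While i a c) = Suc (com_size c)"

text \<open>\<open>code c p e\<close> is placed at address \<open>p\<close> and leaves to address \<open>e\<close>.\<close>

fun code :: "com \<Rightarrow> nat \<Rightarrow> nat \<Rightarrow> instr list" where
  "code (Act A D) p e = [Move A D e]"
| "code (Seq a b) p e = code a p (p + com_size a) @ code b (p + com_size a) e"
| "code (Cond i a c\<^sub>1 c\<^sub>2) p e = Branch i a (Suc p) (Suc p + com_size c\<^sub>1) #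
     code c\<^sub>1 (Suc p) e @ code c\<^sub>2 (Suc p + com_size c\<^sub>1) e"
| "code (While i a c) p e = Branch i a e (Suc p) # code c (Suc p) p"

lemma length_code [simp]: "length (code c p e) = com_size c"
  by (induction c arbitrary: p e) auto

lemma com_size_pos: "0 < com_size c"
  by (induction c) auto

lemma targets_code: "ins \<in> set (code c p e) \<Longrightarrow> targets ins \<subseteq> insert e {..< p + com_size c}"
proof (induction c arbitrary: p e)
  case (Seq c1 c2)
  then consider "ins \<in> set (code c1 p (p + com_size c1))" | "ins \<in> set (code c2 (p + com_size c1) e)"
    by auto
  then show ?case
  proof cases
    case 1
    from Seq.IH(1)[OF this] com_size_pos[of c2] show ?thesis by auto
  next
    case 2
    from Seq.IH(2)[OF this] show ?thesis by auto
  qed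
next
  case (Cond i a c1 c2)
  then consider "ins = Branch i a (Suc p) (Suc p + com_size c1)" | "ins \<in> set (code c1 (Suc p) e)"
    | "ins \<in> set (code c2 (Suc p + com_size c1) e)"
    by auto
  then show ?case
  proof cases
    case 1
    then show ?thesis using com_size_pos[of c1] com_size_pos[of c2] by auto
  next
    case 2
    from Cond.IH(1)[OF this] show ?thesis by auto
  next
    case 3
    from Cond.IH(2)[OF this] show ?thesis by auto
  qed
next
  case (While i a c)
  then consider "ins = Branch i a e (Suc p)" | "ins \<in> set (code c (Suc p) p)" by auto
  then show ?case
  proof cases
    case 1
    then show ?thesis using com_size_pos[of c] by auto
  next
    case 2
    from While.IH[OF this] show ?thesis by auto
  qed
qed auto

definition head_dir :: "nat list \<Rightarrow> nat list \<Rightarrow> nat \<Rightarrow> dir" where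
  "head_dir A D j = (if j \<in> set A then MoveRight else if j \<in> set D then MoveLeft else Stay)"

text \<open>The start state marks cell 0 of every work tape; afterwards no tape ever changes, so that the
  head positions are the whole memory.\<close>

definition tm_of :: "nat \<Rightarrow> instr list \<Rightarrow> machine" where
  "tm_of K P = \<lparr>num_tapes = K, states = {..length P + 2}, symbols = {0, 1, 2},
     start_state = length P, accept_state = length P + 1, reject_state = length P + 2,
     delta = (\<lambda>q xs. if q < length P then
         (case P ! q of
           Move A D q' \<Rightarrow> (q', map (\<lambda>j. (xs ! j, head_dir A D j)) [0..<K])
         | Branch i a q\<^sub>1 q\<^sub>2 \<Rightarrow> (if xs ! i = a then q\<^sub>1 else q\<^sub>2, map (\<lambda>j. (xs ! j, Stay)) [0..<K]))
       else (0, map (\<lambda>j. (if j < 2 then xs ! j else 1, Stay)) [0..<K]))\<rparr>"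

lemma wf_tm_of:
  assumes "2 \<le> K" and "\<And>ins. ins \<in> set P \<Longrightarrow> targets ins \<subseteq> {..length P + 2}"
  shows "wf_machine (tm_of K P)"
proof -
  have "q' \<le> length P + 2 \<and> length acts = K \<and> fst ` set acts \<subseteq> {0, 1, 2}"
    if len: "length xs = K" and xs: "set xs \<subseteq> {0, 1, 2}"
      and d: "delta (tm_of K P) q xs = (q', acts)" for q xs q' acts
  proof -
    have nth: "xs ! j = 2" if "j < K" "0 < xs ! j" "xs ! j \<noteq> Suc 0" for j
    proof -
      have "xs ! j \<in> {0, 1, 2}" using xs len that(1) nth_mem by blast
      with that show ?thesis by auto
    qed
    show ?thesis
    proof (cases "q < length P")
      case True
      then have "targets (P ! q) \<subseteq> {..length P + 2}" using assms(2) by simp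
      then show ?thesis
        using d True nth by (cases "P ! q") (auto simp: tm_of_def split: if_splits)
    next
      case False
      then show ?thesis using d nth by (auto simp: tm_of_def split: if_splits)
    qed
  qed
  then have "\<forall>q xs. length xs = K \<and> set xs \<subseteq> {0, 1, 2} \<longrightarrow>
      (case delta (tm_of K P) q xs of (q', acts) \<Rightarrow>
        q' \<in> {..length P + 2} \<and> length acts = K \<and> fst ` set acts \<subseteq> {0, 1, 2})"
    unfolding case_prod_beta atMost_iff by (metis prod.collapse)
  then show ?thesis
    using assms(1) unfolding wf_machine_def by (simp add: tm_of_def)
qed

definition conf :: "bool list \<Rightarrow> bool list \<Rightarrow> nat \<Rightarrow> nat \<Rightarrow> (nat \<Rightarrow> nat) \<Rightarrow> tm_config" where
  "conf x u K q \<sigma> = (q, map (\<lambda>i. (content x u i, int (\<sigma> i))) [0..<K])"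

lemma fst_conf [simp]: "fst (conf x u K q \<sigma>) = q"
  by (simp add: conf_def)

lemma map2_map_map': "map2 f (map g xs) (map h xs) = map (\<lambda>j. f (g j) (h j)) xs"
  by (induction xs) auto

lemma tm_step_Move:
  assumes "q < length P" "P ! q = Move A D q'" "\<And>i. i \<in> set D \<Longrightarrow> 0 < \<sigma> i"
  shows "tm_step (tm_of K P) (conf x u K q \<sigma>) = conf x u K q'
    (\<lambda>i. if i \<in> set A then Suc (\<sigma> i) else if i \<in> set D then \<sigma> i - 1 else \<sigma> i)"
proof -
  have pos: "int (\<sigma> i - Suc 0) = int (\<sigma> i) - 1" if "i \<in> set D" for i
    using assms(3)[OF that] by simp
  show ?thesis
    using assms(1,2)
    by (simp add: tm_step_def halted_def tm_of_def conf_def map2_map_map' head_dir_def pos)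
qed

lemma tm_step_Branch:
  assumes "q < length P" "P ! q = Branch i a q\<^sub>1 q\<^sub>2" "i < K"
  shows "tm_step (tm_of K P) (conf x u K q \<sigma>) =
    conf x u K (if sym x u \<sigma> i = a then q\<^sub>1 else q\<^sub>2) \<sigma>"
  using assms by (simp add: tm_step_def halted_def tm_of_def conf_def map2_map_map' sym_def)

definition code_at :: "instr list \<Rightarrow> nat \<Rightarrow> instr list \<Rightarrow> bool" where
  "code_at P p l \<longleftrightarrow> (\<exists>l\<^sub>1 l\<^sub>2. P = l\<^sub>1 @ l @ l\<^sub>2 \<and> length l\<^sub>1 = p)"

lemma code_at_append:
  "code_at P p (l @ l') \<Longrightarrow> code_at P p l \<and> code_at P (p + length l) l'"
proof -
  assume "code_at P p (l @ l')"
  then obtain l1 l2 where P: "P = l1 @ l @ l' @ l2" "length l1 = p"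
    by (auto simp: code_at_def)
  have "P = (l1 @ l) @ l' @ l2" "length (l1 @ l) = p + length l" using P by auto
  with P show ?thesis unfolding code_at_def by blast
qed

lemma code_at_Cons: "code_at P p (ins # l) \<Longrightarrow> p < length P \<and> P ! p = ins \<and> code_at P (Suc p) l"
proof -
  assume *: "code_at P p (ins # l)"
  then have "code_at P (Suc p) l" using code_at_append[of P p "[ins]" l] by simp
  moreover from * obtain l1 l2 where "P = l1 @ ins # l @ l2" "length l1 = p"
    by (auto simp: code_at_def)
  ultimately show ?thesis by auto
qed

text \<open>The step count carries over without loss because \<open>code\<close> hands the exit
  address down to the subprograms; sequencing and the return to a loop head cost no instruction of
  their own.\<close>

lemma exec_tm:
  assumes "exec x u c \<sigma> t \<sigma>'"
  shows "code_at P p (code c p e) \<Longrightarrow> reg_bound c \<le> K \<Longrightarrow>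
    (tm_step (tm_of K P) ^^ t) (conf x u K p \<sigma>) = conf x u K e \<sigma>'"
  using assms
proof (induction c \<sigma> t \<sigma>' arbitrary: p e rule: exec.induct)
  case (exec_Act D \<sigma> A)
  then show ?case using tm_step_Move[of p P A D e \<sigma> K x u] by (auto dest!: code_at_Cons)
next
  case (exec_Seq a \<sigma> s \<sigma>' b t \<sigma>'')
  from exec_Seq.prems have "code_at P p (code a p (p + com_size a))"
    and "code_at P (p + com_size a) (code b (p + com_size a) e)"
    by (auto dest: code_at_append)
  then show ?case using exec_Seq by (simp add: add.commute[of s] funpow_add)
next
  case (exec_If \<sigma> i a c1 c2 t \<sigma>')
  let ?q = "if sym x u \<sigma> i = a then Suc p else Suc p + com_size c1"
  from exec_If.prems have *: "p < length P" "P ! p = Branch i a (Suc p) (Suc p + com_size c1)"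
    "code_at P (Suc p) (code c1 (Suc p) e)"
    "code_at P (Suc p + com_size c1) (code c2 (Suc p + com_size c1) e)" "i < K"
    by (auto dest!: code_at_Cons dest: code_at_append)
  have "tm_step (tm_of K P) (conf x u K p \<sigma>) = conf x u K ?q \<sigma>"
    using tm_step_Branch[OF *(1,2,5)] .
  then show ?case using exec_If.IH[of ?q e] exec_If.prems *(3,4)
    by (cases "sym x u \<sigma> i = a") (simp_all add: funpow_Suc_right del: funpow.simps)
next
  case (exec_WhileF \<sigma> i a c)
  then have *: "p < length P" "P ! p = Branch i a e (Suc p)" "i < K"
    by (auto dest!: code_at_Cons)
  show ?case using tm_step_Branch[OF *] exec_WhileF.hyps by simp
next
  case (exec_WhileT \<sigma> i a c s \<sigma>' t \<sigma>'')
  then have *: "p < length P" "P ! p = Branch i a e (Suc p)" "i < K"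
    "code_at P (Suc p) (code c (Suc p) p)"
    by (auto dest!: code_at_Cons)
  have "(tm_step (tm_of K P) ^^ Suc (s + t)) (conf x u K p \<sigma>) =
    (tm_step (tm_of K P) ^^ t) ((tm_step (tm_of K P) ^^ s)
      (tm_step (tm_of K P) (conf x u K p \<sigma>)))"
    by (simp add: add.commute[of s] funpow_add funpow_Suc_right del: funpow.simps)
  also have "\<dots> = (tm_step (tm_of K P) ^^ t) (conf x u K p \<sigma>')"
    using tm_step_Branch[OF *(1,2,3)] exec_WhileT.IH(1)[OF *(4)] exec_WhileT.prems exec_WhileT.hyps(1)
    by simp
  also have "\<dots> = conf x u K e \<sigma>''"
    using exec_WhileT.IH(2) exec_WhileT.prems by simp
  finally show ?case .
qed

text \<open>The final branch has address \<open>m\<close>, so the program has length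
  \<open>m + 1\<close>, and \<open>m + 2\<close> and \<open>m + 3\<close> are the accepting and the
  rejecting state of \<open>tm_of\<close>. The value \<open>k + 3\<close> provides a tape for
  register \<open>k\<close> and the two input tapes.\<close>

definition machine_of :: "com \<Rightarrow> nat \<Rightarrow> machine" where
  "machine_of c k = (let m = com_size c in
     tm_of (max (reg_bound c) (k + 3)) (code c 0 m @ [Branch k 1 (m + 3) (m + 2)]))"

lemma wf_machine_of: "wf_machine (machine_of c k)"
  unfolding machine_of_def Let_def
proof (rule wf_tm_of)
  fix ins assume "ins \<in> set (code c 0 (com_size c) @ [Branch k 1 (com_size c + 3) (com_size c + 2)])"
  then show "targets ins \<subseteq>
      {..length (code c 0 (com_size c) @ [Branch k 1 (com_size c + 3) (com_size c + 2)]) + 2}"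
    using targets_code[of ins c 0 "com_size c"] by fastforce
qed simp

lemma halted_funpow: "halted M c \<Longrightarrow> (tm_step M ^^ n) c = c"
  by (induction n) (auto simp: tm_step_def)

text \<open>The two extra steps are the first one, which marks the work tapes, and the final branch.
  A halted configuration is frozen, so every later time \<open>n\<close> shows the same
  verdict.\<close>

lemma machine_of_run:
  assumes "exec x u c (\<lambda>_. 0) t \<sigma>'" and "2 \<le> k" and "t + 2 \<le> n"
  shows "fst (run (machine_of c k) x u n) =
    (if \<sigma>' k = 0 then reject_state (machine_of c k) else accept_state (machine_of c k))"
    and "halted (machine_of c k) (run (machine_of c k) x u n)"
proof -
  let ?m = "com_size c"
  define P where "P = code c 0 ?m @ [Branch k 1 (?m + 3) (?m + 2)]"
  define K where "K = max (reg_bound c) (k + 3)"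
  define M where "M = tm_of K P"
  let ?c = "conf x u K (if \<sigma>' k = 0 then ?m + 3 else ?m + 2) \<sigma>'"
  have M: "machine_of c k = M" by (simp add: machine_of_def P_def K_def M_def Let_def)
  have len: "length P = Suc ?m" by (simp add: P_def)
  have init: "init_config M x u =
    (length P, map (\<lambda>i. (if i < 2 then content x u i else (\<lambda>_. 0), 0)) [0..<K])"
  proof -
    define K' where "K' = K - 2"
    have K': "K = Suc (Suc K')" unfolding K_def K'_def by linarith
    have "replicate K' (input_tape []) = map (\<lambda>i. (\<lambda>_. 0, 0)) [0..<K']"
      by (auto simp: input_tape_def map_replicate_const)
    then have "[input_tape x, input_tape u] @ replicate (K - 2) (input_tape []) =
      map (\<lambda>i. (if i < 2 then content x u i else (\<lambda>_. 0), 0)) [0..<K]"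
      by (simp add: K' map_upt_Suc content.simps input_tape_def del: upt_Suc)
    then show ?thesis by (simp add: init_config_def M_def tm_of_def)
  qed
  have "tm_step M (init_config M x u) = conf x u K 0 (\<lambda>_. 0)"
  proof -
    have "act_tape (if j < 2 then content x u j 0 else 1, Stay)
        (if j < 2 then content x u j else (\<lambda>_. 0), 0) = (content x u j, 0)" for j
      by (auto simp: content.simps)
    then show ?thesis
      unfolding init
      by (auto simp: M_def tm_step_def halted_def tm_of_def conf_def map2_map_map' content.simps
        fun_upd_def)
  qed
  moreover have "(tm_step M ^^ t) (conf x u K 0 (\<lambda>_. 0)) = conf x u K ?m \<sigma>'"
    unfolding M_def
  proof (rule exec_tm[OF assms(1)])
    show "code_at P 0 (code c 0 ?m)"
      by (auto simp: code_at_def P_def)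
  qed (simp add: K_def)
  moreover have "tm_step M (conf x u K ?m \<sigma>') = ?c"
  proof -
    have "P ! ?m = Branch k 1 (?m + 3) (?m + 2)" by (simp add: P_def nth_append)
    from tm_step_Branch[of ?m P k 1 "?m + 3" "?m + 2" K, OF _ this] show ?thesis
      using \<open>2 \<le> k\<close> unfolding M_def by (auto simp: len K_def sym_def content.simps)
  qed
  ultimately have t: "(tm_step M ^^ (t + 2)) (init_config M x u) = ?c"
    by (simp add: funpow_swap1)
  have h: "halted M ?c" by (auto simp: halted_def M_def tm_of_def len)
  have "run M x u n = ?c"
  proof -
    have "run M x u n = (tm_step M ^^ (n - (t + 2))) ((tm_step M ^^ (t + 2)) (init_config M x u))"
      unfolding run_def using \<open>t + 2 \<le> n\<close>
      by (metis comp_apply funpow_add le_add_diff_inverse2)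
    also have "\<dots> = ?c" unfolding t using halted_funpow[OF h] .
    finally show ?thesis .
  qed
  then show "fst (run (machine_of c k) x u n) =
      (if \<sigma>' k = 0 then reject_state (machine_of c k) else accept_state (machine_of c k))"
    and "halted (machine_of c k) (run (machine_of c k) x u n)"
    using h by (auto simp: M M_def tm_of_def len)
qed


section \<open>Evaluating bounded arithmetic formulas\<close>

datatype trm = Var nat | Num nat | InputLen | Plus trm trm | Times trm trm

text \<open>Variables are de Bruijn indices, \<open>Exists t \<phi>\<close> stands for \<open>\<exists>v < t. \<phi>\<close>, and \<open>CertBit\<close> refers to an
  arbitrary predicate on the natural numbers.\<close>

datatype fm = InputBit trm | CertBit trm | Less trm trm | Neg fm | And fm fm | Exists trm fm

fun trm_val :: "nat \<Rightarrow> (nat \<Rightarrow> nat) \<Rightarrow> trm \<Rightarrow> nat" where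
  "trm_val l e (Var i) = e i"
| "trm_val l e (Num c) = c"
| "trm_val l e InputLen = l"
| "trm_val l e (Plus s t) = trm_val l e s + trm_val l e t"
| "trm_val l e (Times s t) = trm_val l e s * trm_val l e t"

fun sat :: "bool list \<Rightarrow> (nat \<Rightarrow> bool) \<Rightarrow> (nat \<Rightarrow> nat) \<Rightarrow> fm \<Rightarrow> bool" where
  "sat x U e (InputBit t) \<longleftrightarrow> trm_val (length x) e t < length x \<and> x ! trm_val (length x) e t"
| "sat x U e (CertBit t) \<longleftrightarrow> U (trm_val (length x) e t)"
| "sat x U e (Less s t) \<longleftrightarrow> trm_val (length x) e s < trm_val (length x) e t"
| "sat x U e (Neg \<phi>) \<longleftrightarrow> \<not> sat x U e \<phi>"
| "sat x U e (And \<phi> \<psi>) \<longleftrightarrow> sat x U e \<phi> \<and> sat x U e \<psi>"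
| "sat x U e (Exists t \<phi>) \<longleftrightarrow> (\<exists>v < trm_val (length x) e t. sat x U (case_nat v e) \<phi>)"

text \<open>Values, running times and accessed certificate positions are bounded by polynomials in a bound
  on the input length and on all variables.\<close>

fun trm_bound :: "trm \<Rightarrow> nat poly" where
  "trm_bound (Var i) = [:0, 1:]"
| "trm_bound (Num c) = [:c:]"
| "trm_bound InputLen = [:0, 1:]"
| "trm_bound (Plus s t) = trm_bound s + trm_bound t"
| "trm_bound (Times s t) = trm_bound s * trm_bound t"

lemma trm_val_le:
  assumes "l \<le> B" "\<And>i. e i \<le> B"
  shows "trm_val l e t \<le> poly (trm_bound t) B"
  using assms by (induction t) (auto intro: add_mono mult_mono)

fun cert_bound :: "fm \<Rightarrow> nat poly" where
  "cert_bound (CertBit t) = trm_bound t"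
| "cert_bound (Neg \<phi>) = cert_bound \<phi>"
| "cert_bound (And \<phi> \<psi>) = cert_bound \<phi> + cert_bound \<psi>"
| "cert_bound (Exists t \<phi>) = cert_bound \<phi> \<circ>\<^sub>p ([:0, 1:] + trm_bound t)"
| "cert_bound _ = 0"

text \<open>This is what bounds the length of certificates: only a polynomial prefix of
  \<open>U\<close> is ever inspected. Below a quantifier the bound \<open>B\<close> grows by the
  bound of its range, whence the composition in \<open>cert_bound\<close>.\<close>

lemma sat_cong_cert:
  assumes "length x \<le> B" "\<And>i. e i \<le> B" "\<And>i. i \<le> poly (cert_bound \<phi>) B \<Longrightarrow> U i = U' i"
  shows "sat x U e \<phi> \<longleftrightarrow> sat x U' e \<phi>"
  using assms
proof (induction \<phi> arbitrary: e B)
  case (CertBit t)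
  have "trm_val (length x) e t \<le> poly (trm_bound t) B"
    using CertBit.prems by (intro trm_val_le) auto
  then show ?case using CertBit.prems by simp
next
  case (And \<phi> \<psi>)
  have "sat x U e \<phi> = sat x U' e \<phi>" by (rule And.IH(1)[of B]) (use And.prems in auto)
  moreover have "sat x U e \<psi> = sat x U' e \<psi>" by (rule And.IH(2)[of B]) (use And.prems in auto)
  ultimately show ?case by simp
next
  case (Exists t \<phi>)
  have le: "trm_val (length x) e t \<le> poly (trm_bound t) B"
    using Exists.prems by (intro trm_val_le) auto
  have "sat x U (case_nat v e) \<phi> = sat x U' (case_nat v e) \<phi>" if "v < trm_val (length x) e t" for v
  proof (rule Exists.IH[of "B + poly (trm_bound t) B"])
    show "case_nat v e i \<le> B + poly (trm_bound t) B" for i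
      using that le Exists.prems(2) by (cases i) (auto intro: trans_le_add1)
  qed (use Exists.prems in \<open>auto simp: poly_pcompose\<close>)
  then show ?case by auto
qed auto


section \<open>Time bounds for counter programs\<close>

definition runs :: "bool list \<Rightarrow> bool list \<Rightarrow> com \<Rightarrow> (nat \<Rightarrow> nat) \<Rightarrow> nat \<Rightarrow> (nat \<Rightarrow> nat) \<Rightarrow> bool" where
  "runs x u c \<sigma> T \<sigma>' \<longleftrightarrow> (\<exists>t\<le>T. exec x u c \<sigma> t \<sigma>')"

lemma runs_Act:
  assumes "\<And>i. i \<in> set D \<Longrightarrow> 0 < \<sigma> i"
    and "\<And>i. \<sigma>' i = (if i \<in> set A then Suc (\<sigma> i) else if i \<in> set D then \<sigma> i - 1 else \<sigma> i)"
    and "1 \<le> T"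
  shows "runs x u (Act A D) \<sigma> T \<sigma>'"
proof -
  have "\<sigma>' = (\<lambda>i. if i \<in> set A then Suc (\<sigma> i) else if i \<in> set D then \<sigma> i - 1 else \<sigma> i)"
    using assms(2) by auto
  then show ?thesis using exec_Act[of D \<sigma> x u A] assms(1,3) unfolding runs_def by (intro exI[of _ 1]) auto
qed

lemma runs_Seq:
  assumes "runs x u a \<sigma> s \<sigma>'" "runs x u b \<sigma>' t \<sigma>''"
  shows "runs x u (Seq a b) \<sigma> (s + t) \<sigma>''"
  using assms unfolding runs_def by (meson add_mono exec_Seq)

lemma runs_If:
  assumes "runs x u (if sym x u \<sigma> i = a then c\<^sub>1 else c\<^sub>2) \<sigma> t \<sigma>'"
  shows "runs x u (Cond i a c\<^sub>1 c\<^sub>2) \<sigma> (Suc t) \<sigma>'"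
  using assms unfolding runs_def by (meson Suc_le_mono exec_If)

lemma runs_mono: "runs x u c \<sigma> s \<sigma>' \<Longrightarrow> s \<le> t \<Longrightarrow> runs x u c \<sigma> t \<sigma>'"
  unfolding runs_def by (meson le_trans)

text \<open>The states at the loop head are given explicitly as a sequence \<open>S\<close>, which
  replaces an invariant and a termination measure. A round costs one test and at most
  \<open>T\<close> further steps.\<close>

lemma runs_While:
  assumes "\<And>j. j < n \<Longrightarrow> sym x u (S j) i \<noteq> a" "sym x u (S n) i = a"
    and "\<And>j. j < n \<Longrightarrow> runs x u c (S j) T (S (Suc j))"
  shows "runs x u (While i a c) (S 0) (n * Suc T + 1) (S n)"
  using assms
proof (induction n arbitrary: S)
  case 0
  then show ?case using exec_WhileF[of x u "S 0" i a c] unfolding runs_def by fastforce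
next
  case (Suc n)
  have "runs x u (While i a c) (S (Suc 0)) (n * Suc T + 1) (S (Suc n))"
    using Suc.IH[of "\<lambda>j. S (Suc j)"] Suc.prems by simp
  then obtain t where t: "t \<le> n * Suc T + 1" "exec x u (While i a c) (S (Suc 0)) t (S (Suc n))"
    unfolding runs_def by blast
  from Suc.prems(3)[of 0] obtain s where s: "s \<le> T" "exec x u c (S 0) s (S (Suc 0))"
    unfolding runs_def by auto
  have "exec x u (While i a c) (S 0) (Suc (s + t)) (S (Suc n))"
    using exec_WhileT[OF _ s(2) t(2)] Suc.prems(1) by simp
  then show ?case unfolding runs_def using s t by (intro exI[of _ "Suc (s + t)"]) auto
qed

lemma sym_work: "2 \<le> i \<Longrightarrow> sym x u \<sigma> i = (if \<sigma> i = 0 then 1 else 0)"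
  by (simp add: sym_def content.simps)

lemma sym_0: "sym x u \<sigma> 0 = (if \<sigma> 0 < length x then if x ! \<sigma> 0 then 2 else 1 else 0)"
  by (simp add: sym_def content.simps input_tape_def)

lemma sym_1: "sym x u \<sigma> 1 = (if \<sigma> 1 < length u then if u ! \<sigma> 1 then 2 else 1 else 0)"
  by (simp add: sym_def content.simps input_tape_def)

abbreviation Skip :: com where "Skip \<equiv> Act [] []"

lemma runs_Skip: "runs x u Skip \<sigma> 1 \<sigma>"
  by (rule runs_Act) auto

text \<open>Reading a counter destroys it. A value is therefore copied by a transfer into two
  registers, followed by a transfer back from the scratch one: four steps per unit, as in
  \<open>trm_time\<close>.\<close>

lemma runs_transfer:
  assumes "2 \<le> r" "r \<notin> set A" "\<And>i. \<sigma>' i = (if i \<in> set A then \<sigma> i + \<sigma> r else if i = r then 0 else \<sigma> i)"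
  shows "runs x u (While r 1 (Act A [r])) \<sigma> (\<sigma> r * 2 + 1) \<sigma>'"
proof -
  define S where "S j = (\<lambda>i. if i \<in> set A then \<sigma> i + j else if i = r then \<sigma> r - j else \<sigma> i)" for j
  have "runs x u (While r 1 (Act A [r])) (S 0) (\<sigma> r * Suc 1 + 1) (S (\<sigma> r))"
  proof (rule runs_While)
    fix j assume "j < \<sigma> r"
    then show "runs x u (Act A [r]) (S j) 1 (S (Suc j))"
      using assms(2) by (intro runs_Act) (auto simp: S_def)
  qed (use assms in \<open>auto simp: S_def sym_work\<close>)
  moreover have "S 0 = \<sigma>" "S (\<sigma> r) = \<sigma>'"
    using assms by (auto simp: S_def fun_eq_iff)
  ultimately show ?thesis by (simp add: mult_2_right)
qed

lemma runs_decrease: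
  assumes "2 \<le> r" "r \<in> set D" "\<And>i. i \<in> set D \<Longrightarrow> \<sigma> r \<le> \<sigma> i"
    and "\<And>i. \<sigma>' i = (if i \<in> set D then \<sigma> i - \<sigma> r else \<sigma> i)"
  shows "runs x u (While r 1 (Act [] D)) \<sigma> (\<sigma> r * 2 + 1) \<sigma>'"
proof -
  define S where "S j = (\<lambda>i. if i \<in> set D then \<sigma> i - j else \<sigma> i)" for j
  have "runs x u (While r 1 (Act [] D)) (S 0) (\<sigma> r * Suc 1 + 1) (S (\<sigma> r))"
  proof (rule runs_While)
    fix j assume "j < \<sigma> r"
    then show "runs x u (Act [] D) (S j) 1 (S (Suc j))"
      using assms(3) by (intro runs_Act) (auto simp: S_def dest: less_le_trans)
  qed (use assms in \<open>auto simp: S_def sym_work\<close>)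
  moreover have "S 0 = \<sigma>" "S (\<sigma> r) = \<sigma>'"
    using assms by (auto simp: S_def fun_eq_iff)
  ultimately show ?thesis by (simp add: mult_2_right)
qed

text \<open>Adds the value of a term to register \<open>k\<close>; registers from \<open>m\<close> on are scratch space, and the list
  \<open>vs\<close> tells in which registers the variables live.\<close>

fun eval_trm :: "nat list \<Rightarrow> nat \<Rightarrow> nat \<Rightarrow> trm \<Rightarrow> com" where
  "eval_trm vs k m (Var i) = (if i < length vs
     then Seq (While (vs ! i) 1 (Act [k, m] [vs ! i])) (While m 1 (Act [vs ! i] [m])) else Skip)"
| "eval_trm vs k m (Num c) = ((Seq (Act [k] [])) ^^ c) Skip"
| "eval_trm vs k m InputLen =
     Seq (While 0 0 (Act [0, k, m] [])) (While m 1 (Act [] [m, 0]))"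
| "eval_trm vs k m (Plus s t) = Seq (eval_trm vs k m s) (eval_trm vs k m t)"
| "eval_trm vs k m (Times s t) =
     Seq (eval_trm vs m (Suc m) s) (While m 1 (Seq (Act [] [m]) (eval_trm vs k (Suc m) t)))"

fun trm_time :: "trm \<Rightarrow> nat poly" where
  "trm_time (Var i) = [:2, 4:]"
| "trm_time (Num c) = [:Suc c:]"
| "trm_time InputLen = [:2, 4:]"
| "trm_time (Plus s t) = trm_time s + trm_time t"
| "trm_time (Times s t) = trm_time s + (trm_bound s * (trm_time t + [:2:]) + [:1:])"

text \<open>The value 0 outside the list makes the empty list denote the environment in which the
  closed formula is evaluated at the start.\<close>

definition env :: "nat list \<Rightarrow> (nat \<Rightarrow> nat) \<Rightarrow> nat \<Rightarrow> nat" where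
  "env vs \<sigma> i = (if i < length vs then \<sigma> (vs ! i) else 0)"

lemma env_cong: "(\<And>i. i \<in> set vs \<Longrightarrow> \<sigma> i = \<sigma>' i) \<Longrightarrow> env vs \<sigma> = env vs \<sigma>'"
  by (auto simp: env_def)

lemma env_Cons: "env (v # vs) \<sigma> = case_nat (\<sigma> v) (env vs \<sigma>)"
  by (auto simp: env_def fun_eq_iff split: nat.split)

lemma runs_eval_trm:
  assumes "\<sigma> 0 = 0" "\<And>j. m \<le> j \<Longrightarrow> \<sigma> j = 0" "2 \<le> k" "k < m" "set vs \<subseteq> {2..<m} - {k}"
    and "length x \<le> B" "\<And>i. env vs \<sigma> i \<le> B"
  shows "runs x u (eval_trm vs k m t) \<sigma> (poly (trm_time t) B)
    (\<sigma>(k := \<sigma> k + trm_val (length x) (env vs \<sigma>) t))"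
  using assms
proof (induction t arbitrary: k m \<sigma>)
  case (Var i)
  show ?case
  proof (cases "i < length vs")
    case True
    define r where "r = vs ! i"
    have "r \<in> {2..<m} - {k}" unfolding r_def using Var.prems(5) True nth_mem by blast
    then have r: "2 \<le> r" "r < m" "r \<noteq> k" by auto
    have le: "\<sigma> r \<le> B" using Var.prems(7)[of i] True by (simp add: env_def r_def)
    let ?\<sigma> = "\<sigma>(r := 0, k := \<sigma> k + \<sigma> r, m := \<sigma> r)"
    have "runs x u (While r 1 (Act [k, m] [r])) \<sigma> (\<sigma> r * 2 + 1) ?\<sigma>"
      by (rule runs_transfer) (use r Var.prems(2)[of m] Var.prems(4) in auto)
    moreover have "runs x u (While m 1 (Act [r] [m])) ?\<sigma> (?\<sigma> m * 2 + 1) (\<sigma>(k := \<sigma> k + \<sigma> r))"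
      by (rule runs_transfer) (use r Var.prems(2)[of m] Var.prems(3,4) in auto)
    ultimately have "runs x u (Seq (While r 1 (Act [k, m] [r])) (While m 1 (Act [r] [m]))) \<sigma>
      (\<sigma> r * 2 + 1 + (?\<sigma> m * 2 + 1)) (\<sigma>(k := \<sigma> k + \<sigma> r))"
      by (rule runs_Seq)
    then have "runs x u (Seq (While r 1 (Act [k, m] [r])) (While m 1 (Act [r] [m]))) \<sigma>
      (2 + 4 * B) (\<sigma>(k := \<sigma> k + \<sigma> r))"
      by (rule runs_mono) (use le in simp)
    then show ?thesis using True by (simp add: env_def r_def mult.commute del: fun_upd_apply)
  next
    case False
    then show ?thesis using runs_mono[OF runs_Skip] by (simp add: env_def del: fun_upd_apply)
  qed
next
  case (Num c)
  have "runs x u (((Seq (Act [k] [])) ^^ c) Skip) \<sigma> (Suc c) (\<sigma>(k := \<sigma> k + c))" for \<sigma>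
  proof (induction c arbitrary: \<sigma>)
    case 0
    then show ?case using runs_Skip by simp
  next
    case (Suc c)
    have "runs x u (Act [k] []) \<sigma> 1 (\<sigma>(k := Suc (\<sigma> k)))" by (rule runs_Act) auto
    from runs_Seq[OF this Suc.IH] show ?case by (simp add: fun_upd_same del: fun_upd_apply)
  qed
  then show ?case by (simp del: fun_upd_apply)
next
  case InputLen
  \<comment> \<open>The input head walks to the first blank while \<open>k\<close> and
    \<open>m\<close> count its steps; afterwards \<open>m\<close> brings the head back to cell
    0.\<close>
  define S where "S j = \<sigma>(0 := j, k := \<sigma> k + j, m := j)" for j
  have k: "k \<noteq> 0" "k \<noteq> m" "m \<noteq> 0" using InputLen.prems(3,4) by auto
  have 1: "runs x u (While 0 0 (Act [0, k, m] [])) (S 0) (length x * Suc 1 + 1) (S (length x))"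
  proof (rule runs_While)
    fix j assume "j < length x"
    show "runs x u (Act [0, k, m] []) (S j) 1 (S (Suc j))"
      by (rule runs_Act) (use k in \<open>auto simp: S_def\<close>)
  qed (use k in \<open>auto simp: S_def sym_0\<close>)
  have S0: "S 0 = \<sigma>" using InputLen.prems(1,2) by (auto simp: S_def)
  define S' where "S' j = \<sigma>(0 := length x - j, k := \<sigma> k + length x, m := length x - j)" for j
  have 2: "runs x u (While m 1 (Act [] [m, 0])) (S' 0) (length x * Suc 1 + 1) (S' (length x))"
  proof (rule runs_While)
    fix j assume "j < length x"
    then show "runs x u (Act [] [m, 0]) (S' j) 1 (S' (Suc j))"
      by (intro runs_Act) (use k in \<open>auto simp: S'_def\<close>)
  qed (use k InputLen.prems(3,4) in \<open>auto simp: S'_def sym_work\<close>)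
  have S'0: "S' 0 = S (length x)" by (auto simp: S'_def S_def)
  have S'l: "S' (length x) = \<sigma>(k := \<sigma> k + length x)"
    using InputLen.prems(1) InputLen.prems(2)[of m] k by (auto simp: S'_def)
  have "runs x u (eval_trm vs k m InputLen) \<sigma>
    (length x * Suc 1 + 1 + (length x * Suc 1 + 1)) (\<sigma>(k := \<sigma> k + length x))"
    using runs_Seq[OF 1 2[unfolded S'0]] unfolding S0 S'l by simp
  then have "runs x u (eval_trm vs k m InputLen) \<sigma> (2 + 4 * B) (\<sigma>(k := \<sigma> k + length x))"
    by (rule runs_mono) (use InputLen.prems(6) in simp)
  then show ?case by (simp add: mult.commute del: fun_upd_apply)
next
  case (Plus s t)
  let ?\<sigma> = "\<sigma>(k := \<sigma> k + trm_val (length x) (env vs \<sigma>) s)"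
  have env: "env vs ?\<sigma> = env vs \<sigma>" by (rule env_cong) (use Plus.prems(5) in auto)
  have "runs x u (eval_trm vs k m s) \<sigma> (poly (trm_time s) B) ?\<sigma>"
    by (rule Plus.IH(1)) (use Plus.prems in auto)
  moreover have "runs x u (eval_trm vs k m t) ?\<sigma> (poly (trm_time t) B)
      (?\<sigma>(k := ?\<sigma> k + trm_val (length x) (env vs ?\<sigma>) t))"
  proof (rule Plus.IH(2))
    show "env vs ?\<sigma> i \<le> B" for i unfolding env by (rule Plus.prems(7))
  qed (use Plus.prems in auto)
  ultimately have "runs x u (eval_trm vs k m (Plus s t)) \<sigma> (poly (trm_time s) B + poly (trm_time t) B)
      (?\<sigma>(k := ?\<sigma> k + trm_val (length x) (env vs ?\<sigma>) t))"
    by (auto intro: runs_Seq)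
  then show ?case unfolding env by (simp add: add.assoc fun_upd_same del: fun_upd_apply)
next
  case (Times s t)
  let ?a = "trm_val (length x) (env vs \<sigma>) s" and ?b = "trm_val (length x) (env vs \<sigma>) t"
  have a: "?a \<le> poly (trm_bound s) B" using Times.prems by (intro trm_val_le) auto
  have 1: "runs x u (eval_trm vs m (Suc m) s) \<sigma> (poly (trm_time s) B) (\<sigma>(m := \<sigma> m + ?a))"
    by (rule Times.IH(1)) (use Times.prems in \<open>auto simp: less_Suc_eq subset_iff\<close>)
  \<comment> \<open>Multiplication is repeated addition: \<open>m\<close> holds the remaining
    rounds, and each round adds the second factor to \<open>k\<close>.\<close>
  define S where "S j = \<sigma>(m := ?a - j, k := \<sigma> k + j * ?b)" for j
  let ?T = "Suc (poly (trm_time t) B)"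
  have 2: "runs x u (While m 1 (Seq (Act [] [m]) (eval_trm vs k (Suc m) t))) (S 0)
    (?a * Suc ?T + 1) (S ?a)"
  proof (rule runs_While)
    fix j assume j: "j < ?a"
    let ?\<sigma> = "(S j)(m := ?a - Suc j)"
    have env: "env vs ?\<sigma> = env vs \<sigma>" by (rule env_cong) (use Times.prems(4,5) in \<open>auto simp: S_def\<close>)
    have "runs x u (Act [] [m]) (S j) 1 ?\<sigma>"
      using j Times.prems(4) by (intro runs_Act) (auto simp: S_def)
    moreover have "runs x u (eval_trm vs k (Suc m) t) ?\<sigma> (poly (trm_time t) B)
      (?\<sigma>(k := ?\<sigma> k + trm_val (length x) (env vs ?\<sigma>) t))"
    proof (rule Times.IH(2))
      show "env vs ?\<sigma> i \<le> B" for i unfolding env by (rule Times.prems(7))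
    qed (use Times.prems in \<open>auto simp: S_def less_Suc_eq subset_iff\<close>)
    ultimately have "runs x u (Seq (Act [] [m]) (eval_trm vs k (Suc m) t)) (S j)
      (1 + poly (trm_time t) B) (?\<sigma>(k := ?\<sigma> k + trm_val (length x) (env vs ?\<sigma>) t))"
      by (rule runs_Seq)
    moreover have "?\<sigma>(k := ?\<sigma> k + trm_val (length x) (env vs ?\<sigma>) t) = S (Suc j)"
      unfolding env using Times.prems(4) by (auto simp: S_def)
    ultimately show "runs x u (Seq (Act [] [m]) (eval_trm vs k (Suc m) t)) (S j) ?T (S (Suc j))"
      by simp
  qed (use Times.prems(3,4) in \<open>auto simp: S_def sym_work\<close>)
  have S: "\<sigma>(m := \<sigma> m + ?a) = S 0" "S ?a = \<sigma>(k := \<sigma> k + ?a * ?b)"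
    using Times.prems(2)[of m] Times.prems(4) by (auto simp: S_def)
  have "runs x u (eval_trm vs k m (Times s t)) \<sigma>
    (poly (trm_time s) B + (?a * Suc ?T + 1)) (\<sigma>(k := \<sigma> k + ?a * ?b))"
    using runs_Seq[OF 1[unfolded S(1)] 2] unfolding S(2) eval_trm.simps .
  moreover have "poly (trm_time s) B + (?a * Suc ?T + 1) \<le> poly (trm_time (Times s t)) B"
    using mult_right_mono[OF a, of "Suc ?T"] by simp
  ultimately show ?case unfolding trm_val.simps by (rule runs_mono)
qed

text \<open>Sets register \<open>k\<close> to the truth value of a formula; registers from \<open>k\<close> on are zero before.\<close>

fun eval_fm :: "nat list \<Rightarrow> nat \<Rightarrow> fm \<Rightarrow> com" where
  "eval_fm vs k (InputBit t) = Seq (eval_trm vs (k + 1) (k + 2) t)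
     (Seq (While (k + 1) 1 (Act [0, k + 2] [k + 1]))
     (Seq (Cond 0 2 (Act [k] []) Skip) (While (k + 2) 1 (Act [] [k + 2, 0]))))"
| "eval_fm vs k (CertBit t) = Seq (eval_trm vs (k + 1) (k + 2) t)
     (Seq (While (k + 1) 1 (Act [1, k + 2] [k + 1]))
     (Seq (Cond 1 2 (Act [k] []) Skip) (While (k + 2) 1 (Act [] [k + 2, 1]))))"
| "eval_fm vs k (Less s t) = Seq (eval_trm vs (k + 1) (k + 3) s)
     (Seq (eval_trm vs (k + 2) (k + 3) t)
     (Seq (While (k + 1) 1 (Cond (k + 2) 1 (Act [] [k + 1]) (Act [] [k + 1, k + 2])))
     (Seq (Cond (k + 2) 1 Skip (Act [k] [])) (While (k + 2) 1 (Act [] [k + 2])))))"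
| "eval_fm vs k (Neg \<phi>) = Seq (eval_fm vs k \<phi>) (Cond k 1 (Act [k] []) (Act [] [k]))"
| "eval_fm vs k (And \<phi> \<psi>) = Seq (eval_fm vs k \<phi>) (Cond k 1 Skip (Seq (Act [] [k]) (eval_fm vs k \<psi>)))"
| "eval_fm vs k (Exists t \<phi>) = Seq (eval_trm vs (k + 2) (k + 3) t)
     (Seq (While (k + 2) 1 (Seq (eval_fm ((k + 1) # vs) (k + 3) \<phi>)
       (Seq (Cond (k + 3) 1 Skip (Seq (Act [] [k + 3]) (Cond k 1 (Act [k] []) Skip)))
       (Act [k + 1] [k + 2]))))
     (While (k + 1) 1 (Act [] [k + 1])))"

fun fm_time :: "fm \<Rightarrow> nat poly" where
  "fm_time (InputBit t) = trm_time t + [:4:] * trm_bound t + [:4:]"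
| "fm_time (CertBit t) = trm_time t + [:4:] * trm_bound t + [:4:]"
| "fm_time (Less s t) = trm_time s + trm_time t + [:3:] * trm_bound s + [:2:] * trm_bound t + [:4:]"
| "fm_time (Neg \<phi>) = fm_time \<phi> + [:2:]"
| "fm_time (And \<phi> \<psi>) = fm_time \<phi> + fm_time \<psi> + [:2:]"
| "fm_time (Exists t \<phi>) = trm_time t + trm_bound t *
     (fm_time \<phi> \<circ>\<^sub>p ([:0, 1:] + trm_bound t) + [:8:]) + [:2:]"

text \<open>Common core of both bit tests. Head \<open>c\<close> is sent to cell \<open>v\<close>,
  the scanned symbol is compared with 2, the code of the bit \<open>True\<close>, and the copy of
  \<open>v\<close> in register \<open>k + 2\<close> brings the head home.\<close>

lemma runs_probe:
  assumes "c < 2" "2 \<le> k" "\<sigma> c = 0" "\<And>j. k \<le> j \<Longrightarrow> j \<noteq> k + 1 \<Longrightarrow> \<sigma> j = 0" "\<sigma> (k + 1) = v"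
    and "\<And>\<tau>. \<tau> c = v \<Longrightarrow> sym x u \<tau> c = 2 \<longleftrightarrow> b"
  shows "runs x u (Seq (While (k + 1) 1 (Act [c, k + 2] [k + 1]))
     (Seq (Cond c 2 (Act [k] []) Skip) (While (k + 2) 1 (Act [] [k + 2, c])))) \<sigma>
     (v * 4 + 4) (\<sigma>(k + 1 := 0, k := of_bool b))"
proof -
  have c: "c \<noteq> k" "c \<noteq> Suc k" "c \<noteq> Suc (Suc k)" using assms(1,2) by auto
  have z: "\<sigma> k = 0" "\<sigma> (Suc (Suc k)) = 0" using assms(4)[of k] assms(4)[of "Suc (Suc k)"] by auto
  let ?\<sigma>1 = "\<sigma>(k + 1 := 0, c := v, k + 2 := v)" and ?\<sigma>2 = "\<sigma>(k + 1 := 0, c := v, k + 2 := v, k := of_bool b)"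
  have 1: "runs x u (While (k + 1) 1 (Act [c, k + 2] [k + 1])) \<sigma> (\<sigma> (k + 1) * 2 + 1) ?\<sigma>1"
    by (rule runs_transfer) (use c z assms(2,3,5) in auto)
  have "sym x u ?\<sigma>1 c = 2 \<longleftrightarrow> b" by (rule assms(6)) (use c in auto)
  then have "runs x u (if sym x u ?\<sigma>1 c = 2 then Act [k] [] else Skip) ?\<sigma>1 1 ?\<sigma>2"
    by (cases b) (auto intro!: runs_Act simp: c c[symmetric] z)
  then have 2: "runs x u (Cond c 2 (Act [k] []) Skip) ?\<sigma>1 (Suc 1) ?\<sigma>2"
    by (rule runs_If)
  have 3: "runs x u (While (k + 2) 1 (Act [] [k + 2, c])) ?\<sigma>2 (?\<sigma>2 (k + 2) * 2 + 1)
    (\<sigma>(k + 1 := 0, k := of_bool b))"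
    by (rule runs_decrease) (use c z assms(2,3,5) in auto)
  show ?thesis
    by (rule runs_mono[OF runs_Seq[OF 1 runs_Seq[OF 2 3]]]) (simp add: assms(5)[simplified])
qed

abbreviation bits :: "bool list \<Rightarrow> nat \<Rightarrow> bool" where
  "bits u \<equiv> \<lambda>i. i < length u \<and> u ! i"

lemma runs_eval_fm:
  assumes "\<sigma> 0 = 0" "\<sigma> 1 = 0" "\<And>j. k \<le> j \<Longrightarrow> \<sigma> j = 0" "2 \<le> k" "set vs \<subseteq> {2..<k}"
    and "length x \<le> B" "\<And>i. env vs \<sigma> i \<le> B"
  shows "runs x u (eval_fm vs k \<phi>) \<sigma> (poly (fm_time \<phi>) B)
    (\<sigma>(k := of_bool (sat x (bits u) (env vs \<sigma>) \<phi>)))"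
  using assms
proof (induction \<phi> arbitrary: vs k \<sigma> B)
  case (InputBit t)
  let ?v = "trm_val (length x) (env vs \<sigma>) t"
  have v: "?v \<le> poly (trm_bound t) B" using InputBit.prems by (intro trm_val_le) auto
  have 1: "runs x u (eval_trm vs (k + 1) (k + 2) t) \<sigma> (poly (trm_time t) B)
      (\<sigma>(k + 1 := \<sigma> (k + 1) + ?v))"
    by (rule runs_eval_trm) (use InputBit.prems in \<open>auto simp: subset_iff\<close>)
  let ?\<sigma> = "\<sigma>(k + 1 := \<sigma> (k + 1) + ?v)"
  have 2: "runs x u (Seq (While (k + 1) 1 (Act [0, k + 2] [k + 1]))
     (Seq (Cond 0 2 (Act [k] []) Skip) (While (k + 2) 1 (Act [] [k + 2, 0])))) ?\<sigma>
     (?v * 4 + 4) (?\<sigma>(k + 1 := 0, k := of_bool (?v < length x \<and> x ! ?v)))"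
    by (rule runs_probe) (use InputBit.prems in \<open>auto simp: sym_0\<close>)
  have eq: "?\<sigma>(k + 1 := 0, k := of_bool (?v < length x \<and> x ! ?v)) =
    \<sigma>(k := of_bool (sat x (bits u) (env vs \<sigma>) (InputBit t)))"
    using InputBit.prems(3)[of "k + 1"] by (auto simp: fun_eq_iff)
  have "runs x u (eval_fm vs k (InputBit t)) \<sigma> (poly (trm_time t) B + (?v * 4 + 4))
      (\<sigma>(k := of_bool (sat x (bits u) (env vs \<sigma>) (InputBit t))))"
    using runs_Seq[OF 1 2] unfolding eq eval_fm.simps .
  then show ?case by (rule runs_mono) (use v in simp)
next
  case (CertBit t)
  let ?v = "trm_val (length x) (env vs \<sigma>) t"
  have v: "?v \<le> poly (trm_bound t) B" using CertBit.prems by (intro trm_val_le) auto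
  have 1: "runs x u (eval_trm vs (k + 1) (k + 2) t) \<sigma> (poly (trm_time t) B)
      (\<sigma>(k + 1 := \<sigma> (k + 1) + ?v))"
    by (rule runs_eval_trm) (use CertBit.prems in \<open>auto simp: subset_iff\<close>)
  let ?\<sigma> = "\<sigma>(k + 1 := \<sigma> (k + 1) + ?v)"
  have 2: "runs x u (Seq (While (k + 1) 1 (Act [1, k + 2] [k + 1]))
     (Seq (Cond 1 2 (Act [k] []) Skip) (While (k + 2) 1 (Act [] [k + 2, 1])))) ?\<sigma>
     (?v * 4 + 4) (?\<sigma>(k + 1 := 0, k := of_bool (?v < length u \<and> u ! ?v)))"
    by (rule runs_probe) (use CertBit.prems in \<open>auto simp: sym_1[simplified]\<close>)
  have eq: "?\<sigma>(k + 1 := 0, k := of_bool (?v < length u \<and> u ! ?v)) =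
    \<sigma>(k := of_bool (sat x (bits u) (env vs \<sigma>) (CertBit t)))"
    using CertBit.prems(3)[of "k + 1"] by (auto simp: fun_eq_iff)
  have "runs x u (eval_fm vs k (CertBit t)) \<sigma> (poly (trm_time t) B + (?v * 4 + 4))
      (\<sigma>(k := of_bool (sat x (bits u) (env vs \<sigma>) (CertBit t))))"
    using runs_Seq[OF 1 2] unfolding eq eval_fm.simps .
  then show ?case by (rule runs_mono) (use v in simp)
next
  case (Less s t)
  let ?a = "trm_val (length x) (env vs \<sigma>) s" and ?b = "trm_val (length x) (env vs \<sigma>) t"
  have ab: "?a \<le> poly (trm_bound s) B" "?b \<le> poly (trm_bound t) B"
    using Less.prems by (auto intro!: trm_val_le)
  have z: "\<sigma> k = 0" "\<sigma> (k + 1) = 0" "\<sigma> (k + 2) = 0" using Less.prems(3) by auto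
  let ?\<sigma>1 = "\<sigma>(k + 1 := \<sigma> (k + 1) + ?a)"
  have 1: "runs x u (eval_trm vs (k + 1) (k + 3) s) \<sigma> (poly (trm_time s) B) ?\<sigma>1"
    by (rule runs_eval_trm) (use Less.prems in \<open>auto simp: subset_iff\<close>)
  have env: "env vs ?\<sigma>1 = env vs \<sigma>" by (rule env_cong) (use Less.prems(5) in auto)
  have 2: "runs x u (eval_trm vs (k + 2) (k + 3) t) ?\<sigma>1 (poly (trm_time t) B)
      (?\<sigma>1(k + 2 := ?\<sigma>1 (k + 2) + trm_val (length x) (env vs ?\<sigma>1) t))"
  proof (rule runs_eval_trm)
    show "env vs ?\<sigma>1 i \<le> B" for i unfolding env by (rule Less.prems(7))
  qed (use Less.prems in \<open>auto simp: subset_iff\<close>)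
  \<comment> \<open>Truncated subtraction: after \<open>?a\<close> rounds register
    \<open>k + 2\<close> holds \<open>?b - ?a\<close>, which is positive iff \<open>?a < ?b\<close>.
    What is left is cleared afterwards.\<close>
  define S where "S j = \<sigma>(k + 1 := ?a - j, k + 2 := ?b - j)" for j
  have S0: "?\<sigma>1(k + 2 := ?\<sigma>1 (k + 2) + trm_val (length x) (env vs ?\<sigma>1) t) = S 0"
    unfolding env by (auto simp: S_def z[simplified])
  have 3: "runs x u (While (k + 1) 1 (Cond (k + 2) 1 (Act [] [k + 1]) (Act [] [k + 1, k + 2])))
    (S 0) (?a * Suc 2 + 1) (S ?a)"
  proof (rule runs_While)
    fix j assume "j < ?a"
    then have "runs x u (if sym x u (S j) (k + 2) = 1 then Act [] [k + 1] else Act [] [k + 1, k + 2])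
      (S j) 1 (S (Suc j))"
      using Less.prems(4) by (auto simp: S_def sym_work intro!: runs_Act)
    from runs_If[OF this]
    show "runs x u (Cond (k + 2) 1 (Act [] [k + 1]) (Act [] [k + 1, k + 2])) (S j) 2 (S (Suc j))"
      by (simp add: numeral_2_eq_2)
  qed (use Less.prems(4) in \<open>auto simp: S_def sym_work\<close>)
  let ?\<sigma>4 = "(S ?a)(k := of_bool (?a < ?b))"
  have "runs x u (if sym x u (S ?a) (k + 2) = 1 then Skip else Act [k] []) (S ?a) 1 ?\<sigma>4"
    using Less.prems(4) z by (auto simp: S_def sym_work intro!: runs_Act)
  then have 4: "runs x u (Cond (k + 2) 1 Skip (Act [k] [])) (S ?a) (Suc 1) ?\<sigma>4"
    by (rule runs_If)
  have 5: "runs x u (While (k + 2) 1 (Act [] [k + 2])) ?\<sigma>4 (?\<sigma>4 (k + 2) * 2 + 1)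
    (\<sigma>(k := of_bool (?a < ?b)))"
    by (rule runs_decrease) (use Less.prems(4) z in \<open>auto simp: S_def\<close>)
  have "?\<sigma>4 (k + 2) \<le> ?b" by (auto simp: S_def)
  then have "poly (trm_time s) B + (poly (trm_time t) B + (?a * Suc 2 + 1 + (Suc 1 + (?\<sigma>4 (k + 2) * 2 + 1))))
    \<le> poly (fm_time (Less s t)) B"
    using ab by simp
  with runs_Seq[OF 1 runs_Seq[OF 2[unfolded S0] runs_Seq[OF 3 runs_Seq[OF 4 5]]]]
  have "runs x u (eval_fm vs k (Less s t)) \<sigma> (poly (fm_time (Less s t)) B) (\<sigma>(k := of_bool (?a < ?b)))"
    unfolding eval_fm.simps by (rule runs_mono)
  then show ?case by (simp del: fun_upd_apply)
next
  case (Neg \<phi>)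
  let ?b = "sat x (bits u) (env vs \<sigma>) \<phi>"
  have 1: "runs x u (eval_fm vs k \<phi>) \<sigma> (poly (fm_time \<phi>) B) (\<sigma>(k := of_bool ?b))"
    by (rule Neg.IH) (use Neg.prems in auto)
  have "runs x u (if sym x u (\<sigma>(k := of_bool ?b)) k = 1 then Act [k] [] else Act [] [k])
    (\<sigma>(k := of_bool ?b)) 1 (\<sigma>(k := of_bool (\<not> ?b)))"
    using Neg.prems(4) by (auto simp: sym_work intro!: runs_Act)
  then have 2: "runs x u (Cond k 1 (Act [k] []) (Act [] [k])) (\<sigma>(k := of_bool ?b)) (Suc 1)
    (\<sigma>(k := of_bool (\<not> ?b)))"
    by (rule runs_If)
  from runs_Seq[OF 1 2] show ?case by (simp del: fun_upd_apply)
next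
  case (And \<phi> \<psi>)
  let ?a = "sat x (bits u) (env vs \<sigma>) \<phi>"
  let ?b = "sat x (bits u) (env vs \<sigma>) \<psi>"
  let ?\<sigma> = "\<sigma>(k := of_bool ?a)"
  have 1: "runs x u (eval_fm vs k \<phi>) \<sigma> (poly (fm_time \<phi>) B) ?\<sigma>"
    by (rule And.IH(1)) (use And.prems in auto)
  have b: "runs x u (eval_fm vs k \<psi>) \<sigma> (poly (fm_time \<psi>) B) (\<sigma>(k := of_bool ?b))"
    by (rule And.IH(2)) (use And.prems in auto)
  have "runs x u (if sym x u ?\<sigma> k = 1 then Skip else Seq (Act [] [k]) (eval_fm vs k \<psi>)) ?\<sigma>
    (1 + poly (fm_time \<psi>) B) (\<sigma>(k := of_bool (?a \<and> ?b)))"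
  proof (cases ?a)
    case True
    then have "runs x u (Act [] [k]) ?\<sigma> 1 \<sigma>"
      using And.prems(3)[of k] by (auto intro!: runs_Act)
    from runs_Seq[OF this b] have
      "runs x u (Seq (Act [] [k]) (eval_fm vs k \<psi>)) ?\<sigma> (1 + poly (fm_time \<psi>) B) (\<sigma>(k := of_bool ?b))" .
    moreover have "sym x u ?\<sigma> k \<noteq> 1" using True And.prems(4) by (simp add: sym_work)
    ultimately show ?thesis using True by (simp del: fun_upd_apply)
  next
    case False
    then have "sym x u ?\<sigma> k = 1" using And.prems(4) by (simp add: sym_work)
    then show ?thesis using False runs_mono[OF runs_Skip] by (simp del: fun_upd_apply)
  qed
  then have 2: "runs x u (Cond k 1 Skip (Seq (Act [] [k]) (eval_fm vs k \<psi>))) ?\<sigma>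
    (Suc (1 + poly (fm_time \<psi>) B)) (\<sigma>(k := of_bool (?a \<and> ?b)))"
    by (rule runs_If)
  from runs_Seq[OF 1 2] show ?case by (simp del: fun_upd_apply)
next
  case (Exists t \<phi>)
  let ?n = "trm_val (length x) (env vs \<sigma>) t"
  let ?P = "\<lambda>v. sat x (bits u) (case_nat v (env vs \<sigma>)) \<phi>"
  let ?B = "B + poly (trm_bound t) B"
  let ?T = "poly (fm_time \<phi>) ?B"
  have n: "?n \<le> poly (trm_bound t) B" using Exists.prems by (intro trm_val_le) auto
  have z: "\<sigma> k = 0" "\<sigma> (k + 1) = 0" "\<sigma> (k + 2) = 0" "\<sigma> (k + 3) = 0" using Exists.prems(3) by auto
  have 1: "runs x u (eval_trm vs (k + 2) (k + 3) t) \<sigma> (poly (trm_time t) B)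
      (\<sigma>(k + 2 := \<sigma> (k + 2) + ?n))"
    by (rule runs_eval_trm) (use Exists.prems in \<open>auto simp: subset_iff\<close>)
  \<comment> \<open>At the loop head \<open>k + 1\<close> is the current value of the bound
    variable, \<open>k + 2\<close> the number of values still to try, and \<open>k\<close> records
    whether a witness has been seen.\<close>
  define S where "S j = \<sigma>(k := of_bool (\<exists>v<j. ?P v), k + 1 := j, k + 2 := ?n - j)" for j
  have S0: "\<sigma>(k + 2 := \<sigma> (k + 2) + ?n) = S 0" using z by (auto simp: S_def fun_eq_iff)
  let ?body = "Seq (eval_fm ((k + 1) # vs) (k + 3) \<phi>)
       (Seq (Cond (k + 3) 1 Skip (Seq (Act [] [k + 3]) (Cond k 1 (Act [k] []) Skip)))
       (Act [k + 1] [k + 2]))"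
  have 2: "runs x u (While (k + 2) 1 ?body) (S 0) (?n * Suc (?T + 5) + 1) (S ?n)"
  proof (rule runs_While)
    fix j assume j: "j < ?n"
    have env: "env ((k + 1) # vs) (S j) = case_nat j (env vs \<sigma>)"
    proof -
      have "env vs (S j) = env vs \<sigma>" by (rule env_cong) (use Exists.prems(5) in \<open>auto simp: S_def\<close>)
      then show ?thesis by (simp add: env_Cons S_def)
    qed
    let ?\<sigma>1 = "(S j)(k + 3 := of_bool (?P j))" and ?\<sigma>2 = "(S j)(k := of_bool (\<exists>v<Suc j. ?P v))"
    have "runs x u (eval_fm ((k + 1) # vs) (k + 3) \<phi>) (S j) ?T
      ((S j)(k + 3 := of_bool (sat x (bits u) (env ((k + 1) # vs) (S j)) \<phi>)))"
    proof (rule Exists.IH)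
      show "env ((k + 1) # vs) (S j) i \<le> ?B" for i
        using Exists.prems(7) j n unfolding env by (cases i) (auto intro: trans_le_add1)
    qed (use Exists.prems in \<open>auto simp: S_def subset_iff\<close>)
    then have 3: "runs x u (eval_fm ((k + 1) # vs) (k + 3) \<phi>) (S j) ?T ?\<sigma>1"
      unfolding env .
    have 4: "runs x u (Cond (k + 3) 1 Skip (Seq (Act [] [k + 3]) (Cond k 1 (Act [k] []) Skip))) ?\<sigma>1 4 ?\<sigma>2"
    proof (cases "?P j")
      case True
      have a: "runs x u (Act [] [k + 3]) ?\<sigma>1 1 (S j)"
        using True z by (auto intro!: runs_Act simp: S_def)
      have "runs x u (if sym x u (S j) k = 1 then Act [k] [] else Skip) (S j) 1 ?\<sigma>2"
        using True Exists.prems(4) by (auto intro!: runs_Act simp: S_def sym_work less_Suc_eq)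
      then have b: "runs x u (Cond k 1 (Act [k] []) Skip) (S j) (Suc 1) ?\<sigma>2"
        by (rule runs_If)
      have "sym x u ?\<sigma>1 (k + 3) \<noteq> 1" using True by (simp add: sym_work)
      then have "runs x u (Cond (k + 3) 1 Skip (Seq (Act [] [k + 3]) (Cond k 1 (Act [k] []) Skip))) ?\<sigma>1
        (Suc (1 + Suc 1)) ?\<sigma>2"
        using runs_Seq[OF a b] by (intro runs_If) simp
      then show ?thesis by (simp add: eval_nat_numeral)
    next
      case False
      have eq: "?\<sigma>1 = ?\<sigma>2" using False z by (auto simp: S_def fun_eq_iff less_Suc_eq)
      have sym: "sym x u ?\<sigma>1 (k + 3) = 1" using False by (simp add: sym_work)
      have "runs x u Skip ?\<sigma>1 3 ?\<sigma>2" unfolding eq by (rule runs_mono[OF runs_Skip]) simp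
      then have "runs x u (if sym x u ?\<sigma>1 (k + 3) = 1 then Skip
          else Seq (Act [] [k + 3]) (Cond k 1 (Act [k] []) Skip)) ?\<sigma>1 3 ?\<sigma>2"
        unfolding if_P[OF sym] .
      from runs_If[OF this] show ?thesis by (simp add: eval_nat_numeral)
    qed
    have 5: "runs x u (Act [k + 1] [k + 2]) ?\<sigma>2 1 (S (Suc j))"
      using j by (auto intro!: runs_Act simp: S_def)
    from runs_Seq[OF 3 runs_Seq[OF 4 5]] show "runs x u ?body (S j) (?T + 5) (S (Suc j))"
      by simp
  qed (use Exists.prems(4) in \<open>auto simp: S_def sym_work\<close>)
  have 3: "runs x u (While (k + 1) 1 (Act [] [k + 1])) (S ?n) (S ?n (k + 1) * 2 + 1)
    (\<sigma>(k := of_bool (\<exists>v<?n. ?P v)))"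
    by (rule runs_decrease) (use Exists.prems(4) z in \<open>auto simp: S_def\<close>)
  \<comment> \<open>The 8 in \<open>fm_time\<close> is the overhead per value: 6 steps in its round
    of the loop and 2 for resetting the bound variable at the end.\<close>
  have "?n * (?T + 8) \<le> poly (trm_bound t) B * (?T + 8)"
    using n by (rule mult_right_mono) simp
  then have "poly (trm_time t) B + (?n * Suc (?T + 5) + 1 + (S ?n (k + 1) * 2 + 1))
    \<le> poly (fm_time (Exists t \<phi>)) B"
    by (simp add: S_def poly_pcompose algebra_simps)
  with runs_Seq[OF 1[unfolded S0] runs_Seq[OF 2 3]]
  have "runs x u (eval_fm vs k (Exists t \<phi>)) \<sigma> (poly (fm_time (Exists t \<phi>)) B)
    (\<sigma>(k := of_bool (\<exists>v<?n. ?P v)))"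
    unfolding eval_fm.simps by (rule runs_mono)
  then show ?case by (simp del: fun_upd_apply)
qed

text \<open>The certificate may be thought of as an infinite table: \<open>sat_cong_cert\<close>
  cuts it down to a polynomial prefix, and conversely every accepted word becomes such a table
  through \<open>bits\<close>.\<close>

theorem NP_I:
  assumes "\<And>x. x \<in> L \<longleftrightarrow> (\<exists>U. sat x U (\<lambda>_. 0) \<phi>)"
  shows "L \<in> NP"
proof -
  define M where "M = machine_of (eval_fm [] 2 \<phi>) 2"
  have run: "halted M (run M x u n)"
    "fst (run M x u n) = accept_state M \<longleftrightarrow> sat x (bits u) (\<lambda>_. 0) \<phi>"
    if n: "poly (fm_time \<phi>) (length x + length u) + 2 \<le> n" for x u n
  proof -
    have env: "env [] (\<lambda>_. 0) = (\<lambda>_. 0)" by (simp add: env_def fun_eq_iff)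
    have "runs x u (eval_fm [] 2 \<phi>) (\<lambda>_. 0) (poly (fm_time \<phi>) (length x + length u))
      ((\<lambda>_. 0)(2 := of_bool (sat x (bits u) (env [] (\<lambda>_. 0)) \<phi>)))"
      by (rule runs_eval_fm) (auto simp: env_def)
    then obtain t where t: "t \<le> poly (fm_time \<phi>) (length x + length u)"
      "exec x u (eval_fm [] 2 \<phi>) (\<lambda>_. 0) t
        ((\<lambda>_. 0)(2 := of_bool (sat x (bits u) (\<lambda>_. 0) \<phi>)))"
      unfolding runs_def env by blast
    have "accept_state M \<noteq> reject_state M" using wf_machine_of unfolding M_def wf_machine_def by blast
    with machine_of_run[OF t(2), of 2 n] t(1) n
    show "halted M (run M x u n)"
      "fst (run M x u n) = accept_state M \<longleftrightarrow> sat x (bits u) (\<lambda>_. 0) \<phi>"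
      unfolding M_def by (auto split: if_splits)
  qed
  have "polytime M"
    unfolding polytime_def by (rule exI[of _ "fm_time \<phi> + [:2:]"]) (use run(1) in simp)
  moreover have accepts: "accepts M x u \<longleftrightarrow> sat x (bits u) (\<lambda>_. 0) \<phi>" for x u
  proof
    let ?n = "poly (fm_time \<phi>) (length x + length u) + 2"
    assume "accepts M x u"
    then obtain t where t: "fst (run M x u t) = accept_state M" by (auto simp: accepts_def)
    then have "halted M (run M x u t)" by (simp add: halted_def)
    from halted_funpow[OF this, of ?n] have "run M x u (?n + t) = run M x u t"
      by (simp add: run_def funpow_add)
    with t run(2)[of x u "?n + t"] show "sat x (bits u) (\<lambda>_. 0) \<phi>" by simp
  qed (use run(2) in \<open>auto simp: accepts_def\<close>)
  moreover have "x \<in> L \<longleftrightarrow> (\<exists>u. length u \<le> poly (cert_bound \<phi> + [:1:]) (length x) \<and> accepts M x u)" for x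
  proof
    assume "x \<in> L"
    then obtain U where U: "sat x U (\<lambda>_. 0) \<phi>" using assms by blast
    \<comment> \<open>The bound itself is an admissible position, hence the additional bit.\<close>
    let ?u = "map U [0..<poly (cert_bound \<phi>) (length x) + 1]"
    have "sat x (bits ?u) (\<lambda>_. 0) \<phi> = sat x U (\<lambda>_. 0) \<phi>"
      by (rule sat_cong_cert[OF order_refl]) (auto simp del: upt_Suc)
    with U have "accepts M x ?u" unfolding accepts by blast
    moreover have "length ?u \<le> poly (cert_bound \<phi> + [:1:]) (length x)" by simp
    ultimately show "\<exists>u. length u \<le> poly (cert_bound \<phi> + [:1:]) (length x) \<and> accepts M x u" by blast
  next
    assume "\<exists>u. length u \<le> poly (cert_bound \<phi> + [:1:]) (length x) \<and> accepts M x u"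
    then show "x \<in> L" using assms accepts by blast
  qed
  ultimately show ?thesis
    using wf_machine_of[of "eval_fm [] 2 \<phi>" 2] unfolding NP_def M_def by blast
qed


section \<open>Jump sequences as trails in a graph\<close>

text \<open>The graph of a jumping piece has as vertices the squares on which it can land and as edges the
  enemy pieces it can capture: the piece on \<open>shift v 1 d\<close> joins \<open>v\<close> and \<open>shift v 2 d\<close>.
  Since all landing squares are congruent, an enemy piece is at most one edge, and a
  jump sequence is a trail.\<close>

definition trail_step ::
  "(int \<times> int) set \<Rightarrow> square set \<Rightarrow> square set \<times> square \<Rightarrow> square set \<times> square \<Rightarrow> bool" where
  "trail_step D F = (\<lambda>(E, v) (E', v'). \<exists>d\<in>D. shift v 1 d \<in> E \<and> shift v 2 d \<in> F \<and>
     E' = E - {shift v 1 d} \<and> v' = shift v 2 d)"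

definition full :: "(int \<times> int) set \<Rightarrow> square set \<Rightarrow> square set \<Rightarrow> square \<Rightarrow> bool" where
  "full D F E v \<longleftrightarrow> (\<forall>E' v'. (trail_step D F)\<^sup>*\<^sup>* (E, v) (E', v') \<longrightarrow>
     (\<nexists>y. trail_step D F (E', v') y) \<longrightarrow> E' = {})"

text \<open>A jump keeps the parity of the row and changes the sum of the coordinates by 0, 4 or -4.
  Working modulo 4 separates the two diagonals through a piece, so that only one of them joins
  squares of the class.\<close>

definition congruent_squares :: "square \<Rightarrow> square set" where
  "congruent_squares s = {v. even (fst v - fst s) \<and> 4 dvd fst v + snd v - (fst s + snd s)}"

abbreviation diagonals :: "(int \<times> int) set" where
  "diagonals \<equiv> {-1, 1} \<times> {-1, 1}"

definition edge :: "square set \<Rightarrow> square set \<Rightarrow> square \<Rightarrow> int \<times> int \<Rightarrow> bool" where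
  "edge F E v d \<longleftrightarrow> shift v 1 d \<in> E \<and> shift v 2 d \<in> F"

definition odd_deg :: "square set \<Rightarrow> square set \<Rightarrow> square \<Rightarrow> bool" where
  "odd_deg F E v \<longleftrightarrow> odd (card {d \<in> diagonals. edge F E v d})"

text \<open>The parity half of Euler's criterion for a trail from \<open>v\<close> to
  \<open>t\<close>. The exclusive or covers \<open>v = t\<close>, where all degrees have to be
  even.\<close>

definition eulerian :: "square set \<Rightarrow> square set \<Rightarrow> square \<Rightarrow> square \<Rightarrow> bool" where
  "eulerian F E v t \<longleftrightarrow> (\<forall>w\<in>F. odd_deg F E w \<longleftrightarrow> (w = v) \<noteq> (w = t))"

text \<open>Of the four diagonal neighbours of a square, those on one diagonal differ from those on
  the other by 2 modulo 4 in the sum of the coordinates. So \<open>v\<close> and \<open>w\<close>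
  lie on the same diagonal, and they are equal or opposite.\<close>

lemma same_edge:
  assumes "v \<in> congruent_squares s" "w \<in> congruent_squares s" "d \<in> diagonals" "e \<in> diagonals"
    and "shift v 1 d = shift w 1 e"
  shows "v = w \<and> d = e \<or> v = shift w 2 e \<and> w = shift v 2 d \<and> d = (- fst e, - snd e)"
proof -
  obtain a b a' b' where v: "v = (a, b)" "w = (a', b')" by (cases v, cases w)
  have a: "even (a - a')" using assms(1,2) unfolding congruent_squares_def v by simp
  have "4 dvd a + b - (fst s + snd s)" "4 dvd a' + b' - (fst s + snd s)"
    using assms(1,2) by (simp_all add: congruent_squares_def v)
  then have "4 dvd (a + b - (fst s + snd s)) - (a' + b' - (fst s + snd s))"
    by (rule dvd_diff)
  then have b: "4 dvd (a + b) - (a' + b')" by (simp add: algebra_simps)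
  show ?thesis using assms(3-5) a b unfolding v by auto
qed

lemma shift_2_ne: "d \<in> diagonals \<Longrightarrow> shift v 2 d \<noteq> v"
  by (cases v) auto

lemma shift_back: "shift (shift v 2 d) 1 (- fst d, - snd d) = shift v 1 d"
  "shift (shift v 2 d) 2 (- fst d, - snd d) = v"
  by (cases v; cases d; simp)+

lemma congruent_refl: "s \<in> congruent_squares s"
  by (simp add: congruent_squares_def)

lemma congruent_shift:
  "v \<in> congruent_squares s \<Longrightarrow> d \<in> diagonals \<Longrightarrow> shift v 2 d \<in> congruent_squares s"
  unfolding congruent_squares_def by (cases v) (auto; presburger)

lemma not_congruent_shift:
  "v \<in> congruent_squares s \<Longrightarrow> d \<in> diagonals \<Longrightarrow> odd (fst (shift v 1 d) - fst s)"
  unfolding congruent_squares_def by (cases v) auto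

text \<open>By \<open>same_edge\<close> the removed piece is an edge at no third vertex, and it
  accounts for exactly one direction at each of its two ends.\<close>

lemma odd_deg_remove:
  assumes F: "F \<subseteq> congruent_squares s" and "v \<in> F" "w \<in> F" "d \<in> diagonals" "edge F E v d"
  shows "odd_deg F (E - {shift v 1 d}) w \<longleftrightarrow> odd_deg F E w \<noteq> (w = v \<or> w = shift v 2 d)"
proof -
  let ?D = "{e \<in> diagonals. edge F E w e}"
  have fin: "finite ?D" by (rule finite_subset[of _ diagonals]) auto
  have eq: "shift w 1 e = shift v 1 d \<longleftrightarrow> w = v \<and> e = d \<or> w = shift v 2 d \<and> e = (- fst d, - snd d)"
    if "e \<in> diagonals" for e
  proof
    assume "shift w 1 e = shift v 1 d"
    then show "w = v \<and> e = d \<or> w = shift v 2 d \<and> e = (- fst d, - snd d)"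
      using same_edge[of w s v e d] that assms(1-4) by blast
  qed (use shift_back(1)[of v d] in metis)
  have sub: "{e \<in> diagonals. edge F (E - {shift v 1 d}) w e} =
    ?D - {e. w = v \<and> e = d \<or> w = shift v 2 d \<and> e = (- fst d, - snd d)}"
    using eq by (auto simp: edge_def)
  have d': "(- fst d, - snd d) \<in> diagonals" using assms(4) by auto
  have card: "odd (card (?D - {e})) \<longleftrightarrow> \<not> odd (card ?D)" if "e \<in> ?D" for e
  proof -
    from card_Suc_Diff1[OF fin that] have "card ?D = Suc (card (?D - {e}))" by simp
    then show ?thesis by simp
  qed
  consider "w = v" | "w = shift v 2 d" | "w \<noteq> v" "w \<noteq> shift v 2 d" by blast
  then show ?thesis
  proof cases
    case 1
    have "?D - {e. w = v \<and> e = d \<or> w = shift v 2 d \<and> e = (- fst d, - snd d)} = ?D - {d}"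
      using shift_2_ne[OF assms(4), of v] 1 by auto
    moreover have "d \<in> ?D" using assms 1 by auto
    ultimately show ?thesis unfolding odd_deg_def sub using card[of d] 1 by simp
  next
    case 2
    have "?D - {e. w = v \<and> e = d \<or> w = shift v 2 d \<and> e = (- fst d, - snd d)} =
      ?D - {(- fst d, - snd d)}"
      using shift_2_ne[OF assms(4), of v] 2 by auto
    moreover have "(- fst d, - snd d) \<in> ?D"
      using assms d' unfolding 2 by (simp add: edge_def shift_back)
    ultimately show ?thesis unfolding odd_deg_def sub using card[of "(- fst d, - snd d)"] 2 by simp
  next
    case 3
    then show ?thesis unfolding odd_deg_def sub by simp
  qed
qed

text \<open>The step flips the parities of \<open>v\<close> and \<open>v'\<close>, which is
  precisely the change required when the start of the remaining trail moves from \<open>v\<close> to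
  \<open>v'\<close>.\<close>

lemma eulerian_step:
  assumes "F \<subseteq> congruent_squares s" "v \<in> F" "D \<subseteq> diagonals" "trail_step D F (E, v) (E', v')"
  shows "v' \<in> F" "E' \<subset> E" "eulerian F E v t \<longleftrightarrow> eulerian F E' v' t"
proof -
  from assms(4) obtain d where "d \<in> D" and
    d: "shift v 1 d \<in> E" "v' \<in> F" "E' = E - {shift v 1 d}" "v' = shift v 2 d"
    unfolding trail_step_def prod.case by blast
  then have d: "d \<in> diagonals" "shift v 1 d \<in> E" "v' \<in> F" "E' = E - {shift v 1 d}" "v' = shift v 2 d"
    using assms(3) by blast+
  then show "v' \<in> F" "E' \<subset> E" by auto
  have "odd_deg F E' w \<longleftrightarrow> odd_deg F E w \<noteq> (w = v \<or> w = v')" if "w \<in> F" for w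
    using odd_deg_remove[OF assms(1,2) that d(1)] d by (simp add: edge_def)
  moreover have "v \<noteq> v'" using shift_2_ne[OF d(1)] d(5) by metis
  ultimately show "eulerian F E v t \<longleftrightarrow> eulerian F E' v' t"
    unfolding eulerian_def by auto
qed

lemma eulerian_steps:
  assumes "(trail_step D F)\<^sup>*\<^sup>* (E, v) (E', v')" "F \<subseteq> congruent_squares s" "v \<in> F" "D \<subseteq> diagonals"
  shows "v' \<in> F \<and> E' \<subseteq> E \<and> (eulerian F E v t \<longleftrightarrow> eulerian F E' v' t)"
  using assms(1)
proof (induction rule: rtranclp_induct2)
  case (step E1 v1 E2 v2)
  then have v1: "v1 \<in> F" by blast
  show ?case using eulerian_step[OF assms(2) v1 assms(4) step.hyps(2)] step.IH by blast
qed (use assms in auto)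

lemma maximal_trail_exists:
  assumes "finite E"
  shows "\<exists>E' v'. (trail_step D F)\<^sup>*\<^sup>* (E, v) (E', v') \<and> (\<nexists>y. trail_step D F (E', v') y)"
  using assms
proof (induction E arbitrary: v rule: finite_psubset_induct)
  case (psubset E)
  show ?case
  proof (cases "\<exists>y. trail_step D F (E, v) y")
    case True
    then obtain E1 v1 where 1: "trail_step D F (E, v) (E1, v1)" by auto
    then have "E1 \<subset> E" by (auto simp: trail_step_def)
    from psubset.IH[OF this, of v1] 1 show ?thesis by (meson converse_rtranclp_into_rtranclp)
  qed blast
qed

lemma full_trail:
  assumes "full D F E v" "finite E"
  shows "\<exists>t. (trail_step D F)\<^sup>*\<^sup>* (E, v) ({}, t)"
  using maximal_trail_exists[OF assms(2), of D F v] assms(1) unfolding full_def by blast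

lemma stuck_not_odd_deg:
  assumes "\<nexists>y. trail_step diagonals F (E, v) y"
  shows "\<not> edge F E v d \<or> d \<notin> diagonals" "\<not> odd_deg F E v"
proof -
  have no: "\<not> edge F E v d" if "d \<in> diagonals" for d
    using assms that unfolding trail_step_def edge_def by blast
  then show "\<not> edge F E v d \<or> d \<notin> diagonals" by blast
  have "{d \<in> diagonals. edge F E v d} = {}" using no by blast
  then show "\<not> odd_deg F E v" unfolding odd_deg_def by (metis card.empty even_zero)
qed

text \<open>A stuck vertex has degree 0, which is even, while the start \<open>v\<close> of a trail
  to \<open>t\<close> has odd degree unless \<open>v = t\<close>.\<close>

lemma stuck_at_end:
  assumes "\<nexists>y. trail_step diagonals F (E, v) y" "eulerian F E v t" "v \<in> F"
  shows "v = t"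
  using stuck_not_odd_deg(2)[OF assms(1)] assms(2,3) unfolding eulerian_def by blast


subsection \<open>Kings\<close>

definition on_edge :: "(int \<times> int) set \<Rightarrow> square set \<Rightarrow> square \<Rightarrow> bool" where
  "on_edge D F m \<longleftrightarrow> (\<exists>v\<in>F. \<exists>d\<in>D. m = shift v 1 d \<and> shift v 2 d \<in> F)"

text \<open>Stripping off leaves shows that a graph is a forest; the order \<open>R\<close> records when the vertices
  other than \<open>t\<close> are removed.\<close>

definition forest_order ::
  "square set \<Rightarrow> square set \<Rightarrow> square \<Rightarrow> (square \<Rightarrow> square \<Rightarrow> bool) \<Rightarrow> bool" where
  "forest_order F E t R \<longleftrightarrow> (\<forall>v\<in>F. v \<noteq> t \<longrightarrow> (\<forall>d\<in>diagonals. \<forall>e\<in>diagonals. d \<noteq> e \<longrightarrow>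
     edge F E v d \<longrightarrow> edge F E v e \<longrightarrow> shift v 2 d \<noteq> t \<longrightarrow> shift v 2 e \<noteq> t \<longrightarrow>
     R (shift v 2 d) v \<or> R (shift v 2 e) v))"

text \<open>The elimination order is a strict partial order instead of a numbering, because a
  relation can be stored in the certificate as a table of bits.\<close>

definition king_condition ::
  "square set \<Rightarrow> square set \<Rightarrow> square \<Rightarrow> (square \<Rightarrow> square \<Rightarrow> bool) \<Rightarrow> bool" where
  "king_condition F E s R \<longleftrightarrow> (\<forall>m\<in>E. on_edge diagonals F m) \<and>
     (\<exists>t\<in>F. eulerian F E s t \<and> forest_order F E t R) \<and>
     (\<forall>v\<in>F. \<not> R v v) \<and> (\<forall>v\<in>F. \<forall>w\<in>F. \<forall>z\<in>F. R v w \<longrightarrow> R w z \<longrightarrow> R v z)"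

lemma minimal_element:
  assumes "finite W" "W \<noteq> {}" "\<forall>v\<in>W. \<not> R v v" "\<forall>v\<in>W. \<forall>w\<in>W. \<forall>z\<in>W. R v w \<longrightarrow> R w z \<longrightarrow> R v z"
  shows "\<exists>w\<in>W. \<forall>v\<in>W. \<not> R v w"
  using assms
proof (induction W rule: finite_ne_induct)
  case (insert a W)
  have "\<exists>w\<in>W. \<forall>v\<in>W. \<not> R v w" by (rule insert.IH) (use insert.prems in blast)+
  then obtain w where w: "w \<in> W" "\<forall>v\<in>W. \<not> R v w" by blast
  show ?case
  proof (cases "R a w")
    case True
    have "\<not> R v a" if "v \<in> insert a W" for v
      using that True w insert.prems by blast
    then show ?thesis by blast
  next
    case False
    then show ?thesis using w by blast
  qed
next
  case (singleton a)
  then show ?case by blast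
qed

lemma even_card_other:
  assumes "even (card A)" "d \<in> A"
  shows "\<exists>e\<in>A. e \<noteq> d"
proof (rule ccontr)
  assume "\<not> (\<exists>e\<in>A. e \<noteq> d)"
  then have "A \<subseteq> {d}" by blast
  moreover have "{d} \<subseteq> A" using assms(2) by simp
  ultimately have "A = {d}" by (rule subset_antisym)
  then show False using assms(1) by simp
qed

text \<open>If a stuck trail leaves edges, let \<open>W\<close> be the vertices on them and
  \<open>w\<close> an \<open>R\<close>-minimal one. Its degree in the rest is even and positive, so
  it has two edges, both leading into \<open>W\<close> and hence not to \<open>t\<close>; then
  \<open>forest_order\<close> puts one of the two neighbours before \<open>w\<close>.\<close>

lemma king_condition_sound:
  assumes "king_condition F E s R" "F \<subseteq> congruent_squares s" "finite F" "s \<in> F"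
  shows "full diagonals F E s"
  unfolding full_def
proof (intro allI impI, rule ccontr)
  fix E' v
  assume tr: "(trail_step diagonals F)\<^sup>*\<^sup>* (E, s) (E', v)"
    and stuck: "\<nexists>y. trail_step diagonals F (E', v) y" and ne: "E' \<noteq> {}"
  obtain t where t: "eulerian F E s t" "forest_order F E t R"
    using assms(1) unfolding king_condition_def by blast
  have E': "v \<in> F" "E' \<subseteq> E" "eulerian F E' v t"
    using eulerian_steps[OF tr assms(2,4), of t] t(1) by auto
  have v: "v = t" by (rule stuck_at_end[OF stuck E'(3,1)])
  then have even: "\<not> odd_deg F E' w" if "w \<in> F" for w
    using E'(3) that unfolding eulerian_def by auto
  define W where "W = {w \<in> F. \<exists>d\<in>diagonals. edge F E' w d}"
  have "W \<noteq> {}"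
  proof -
    obtain m where m: "m \<in> E'" using ne by auto
    then have "on_edge diagonals F m" using assms(1) E'(2) unfolding king_condition_def by blast
    then obtain w d where "w \<in> F" "d \<in> diagonals" "m = shift w 1 d" "shift w 2 d \<in> F"
      unfolding on_edge_def by blast
    then have "w \<in> W" using m unfolding W_def edge_def by blast
    then show ?thesis by blast
  qed
  moreover have "finite W" "W \<subseteq> F" using assms(3) by (auto simp: W_def)
  moreover have "(\<forall>v\<in>F. \<not> R v v)" "(\<forall>v\<in>F. \<forall>w\<in>F. \<forall>z\<in>F. R v w \<longrightarrow> R w z \<longrightarrow> R v z)"
    using assms(1) unfolding king_condition_def by blast+
  ultimately obtain w where w: "w \<in> W" "\<forall>v\<in>W. \<not> R v w"
    using minimal_element[of W R] by blast
  have tW: "t \<notin> W" using stuck_not_odd_deg(1)[OF stuck] v unfolding W_def by blast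
  let ?D = "{d \<in> diagonals. edge F E' w d}"
  have even: "even (card ?D)" using even w(1) unfolding W_def odd_deg_def by blast
  obtain d where d: "d \<in> ?D" using w(1) unfolding W_def by blast
  from even_card_other[OF even d] obtain e where e: "e \<in> ?D" "e \<noteq> d" by (rule bexE)
  note de = d e(1) e(2)[symmetric]
  have end_W: "shift w 2 d \<in> W" if "d \<in> ?D" for d
  proof -
    have "(- fst d, - snd d) \<in> diagonals" "edge F E' (shift w 2 d) (- fst d, - snd d)"
      using that w(1) unfolding edge_def shift_back W_def by auto
    then show ?thesis using that unfolding W_def edge_def by blast
  qed
  have "edge F E w d" "edge F E w e" using de(1,2) E'(2) unfolding edge_def by blast+
  moreover have "shift w 2 d \<noteq> t" "shift w 2 e \<noteq> t" "w \<noteq> t"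
    using end_W de(1,2) tW w(1) by blast+
  ultimately have "R (shift w 2 d) w \<or> R (shift w 2 e) w"
    using t(2)[unfolded forest_order_def, rule_format, of w d e] de w(1) unfolding W_def by simp
  then show False using w(2) end_W de(1,2) by blast
qed

text \<open>Greedy elimination. Here \<open>T W w\<close> means that \<open>w\<close> cannot be
  removed while \<open>W\<close> is present, and \<open>f\<close> is the time of removal. In the
  application \<open>T\<close> says that \<open>w\<close> is not a leaf.\<close>

lemma strip_leaves:
  fixes T :: "'a set \<Rightarrow> 'a \<Rightarrow> bool"
  assumes "finite V" "\<And>W. W \<subseteq> V \<Longrightarrow> W \<noteq> {} \<Longrightarrow> \<exists>w\<in>W. \<not> T W w"
  shows "\<exists>f :: 'a \<Rightarrow> nat. \<forall>v\<in>V. \<not> T {w \<in> V. f v \<le> f w} v"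
  using assms
proof (induction V rule: finite_psubset_induct)
  case (psubset V)
  show ?case
  proof (cases "V = {}")
    case False
    then obtain w where w: "w \<in> V" "\<not> T V w" using psubset.prems by blast
    then have "V - {w} \<subset> V" by blast
    then obtain f :: "'a \<Rightarrow> nat" where f: "\<forall>v\<in>V - {w}. \<not> T {x \<in> V - {w}. f v \<le> f x} v"
      using psubset.IH[of "V - {w}"] psubset.prems by (meson Diff_subset order_trans)
    \<comment> \<open>The vertex removed first gets time 0, and all other times move up by
      one.\<close>
    define g where "g x = (if x = w then 0 else Suc (f x))" for x
    have "\<not> T {x \<in> V. g v \<le> g x} v" if "v \<in> V" for v
    proof (cases "v = w")
      case True
      then have "{x \<in> V. g v \<le> g x} = V" by (auto simp: g_def)
      then show ?thesis using w True by simp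
    next
      case False
      then have "{x \<in> V. g v \<le> g x} = {x \<in> V - {w}. f v \<le> f x}" by (auto simp: g_def)
      then show ?thesis using f that False by simp
    qed
    then show ?thesis by blast
  qed simp
qed

text \<open>An edge is traversed from one end to the other, and by \<open>same_edge\<close> the
  vertex \<open>v\<close> is one of these ends. So the trail stands on \<open>v\<close> just before
  or just after using the edge.\<close>

lemma used_edge_visited:
  assumes "(trail_step diagonals F)\<^sup>*\<^sup>* (E, w) (A, u)" "F \<subseteq> congruent_squares s" "w \<in> F" "v \<in> F"
    and "d \<in> diagonals" "shift v 1 d \<in> E" "shift v 1 d \<notin> A"
  shows "\<exists>E'. (trail_step diagonals F)\<^sup>*\<^sup>* (E, w) (E', v) \<and> (trail_step diagonals F)\<^sup>*\<^sup>* (E', v) (A, u)"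
  using assms(1,7)
proof (induction rule: rtranclp_induct2)
  case refl
  then show ?case using assms(6) by simp
next
  case (step A1 u1 A2 u2)
  show ?case
  proof (cases "shift v 1 d \<in> A1")
    case True
    from step.hyps(2) obtain e where e: "e \<in> diagonals" "A2 = A1 - {shift u1 1 e}" "u2 = shift u1 2 e"
      by (auto simp: trail_step_def)
    have u1: "u1 \<in> F" using eulerian_steps[OF step.hyps(1) assms(2,3)] by blast
    have "shift v 1 d = shift u1 1 e" using True e(2) step.prems by blast
    then have "v = u1 \<or> v = u2"
      using same_edge[of v s u1 d e] assms(2,4,5) u1 e(1,3) by blast
    moreover have "(trail_step diagonals F)\<^sup>*\<^sup>* (E, w) (A2, u2)" using step.hyps by auto
    ultimately show ?thesis using step.hyps by blast
  next
    case False
    with step show ?thesis by (meson rtranclp.rtrancl_into_rtrancl)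
  qed
qed

lemma odd_deg_diff:
  assumes "C \<subseteq> E"
  shows "odd_deg F (E - C) w \<longleftrightarrow> odd_deg F E w \<noteq> odd_deg F C w"
proof -
  have "{d \<in> diagonals. edge F E w d} =
    {d \<in> diagonals. edge F (E - C) w d} \<union> {d \<in> diagonals. edge F C w d}"
    using assms by (auto simp: edge_def)
  moreover have "finite {d \<in> diagonals. edge F X w d}" for X
    by (rule finite_subset[of _ diagonals]) auto
  moreover have "{d \<in> diagonals. edge F (E - C) w d} \<inter> {d \<in> diagonals. edge F C w d} = {}"
    by (auto simp: edge_def)
  ultimately have "card {d \<in> diagonals. edge F E w d} =
    card {d \<in> diagonals. edge F (E - C) w d} + card {d \<in> diagonals. edge F C w d}"
    by (simp only: card_Un_disjoint)
  then show ?thesis unfolding odd_deg_def by (simp only: even_add) blast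
qed

lemma odd_deg_trail:
  assumes "(trail_step diagonals F)\<^sup>*\<^sup>* (E, v) (E', v')" "F \<subseteq> congruent_squares s" "v \<in> F" "w \<in> F"
  shows "odd_deg F E' w \<longleftrightarrow> odd_deg F E w \<noteq> ((w = v) \<noteq> (w = v'))"
  using assms(1)
proof (induction rule: rtranclp_induct2)
  case (step E1 v1 E2 v2)
  have v1: "v1 \<in> F" using eulerian_steps[OF step.hyps(1) assms(2,3)] by blast
  from step.hyps(2) obtain d where d: "d \<in> diagonals" "E2 = E1 - {shift v1 1 d}" "v2 = shift v1 2 d"
    "edge F E1 v1 d"
    by (auto simp: trail_step_def edge_def)
  have "odd_deg F E2 w \<longleftrightarrow> odd_deg F E1 w \<noteq> (w = v1 \<or> w = v2)"
    unfolding d(2,3) by (rule odd_deg_remove[OF assms(2) v1 assms(4) d(1,4)])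
  moreover have "v1 \<noteq> v2" using shift_2_ne[OF d(1)] d(3) by metis
  ultimately show ?case using step.IH by auto
qed simp

lemma captured_on_edge:
  assumes "(trail_step diagonals F)\<^sup>*\<^sup>* (E, v) (E', v')" "F \<subseteq> congruent_squares s" "v \<in> F"
  shows "\<forall>m\<in>E - E'. on_edge diagonals F m"
  using assms(1)
proof (induction rule: rtranclp_induct2)
  case (step E1 v1 E2 v2)
  have "v1 \<in> F" using eulerian_steps[OF step.hyps(1) assms(2,3)] by blast
  then show ?case using step by (auto simp: trail_step_def on_edge_def)
qed simp

definition two_neighbours :: "square set \<Rightarrow> square set \<Rightarrow> square \<Rightarrow> bool" where
  "two_neighbours E W v \<longleftrightarrow> (\<exists>d\<in>diagonals. \<exists>e\<in>diagonals. d \<noteq> e \<and> edge W E v d \<and> edge W E v e)"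

text \<open>The classical argument for minimum degree 2: a maximal trail inside \<open>W\<close>
  gets stuck at some \<open>v\<close> that has an edge besides the one of arrival. That edge must
  have been used already, so \<open>v\<close> was visited earlier, and the part of the trail since
  then is closed.\<close>

lemma closed_trail_exists:
  assumes W: "W \<subseteq> congruent_squares s" "W \<noteq> {}" "\<forall>w\<in>W. two_neighbours E W w" and "finite E"
  shows "\<exists>C\<subseteq>E. C \<noteq> {} \<and> (\<forall>m\<in>C. on_edge diagonals W m) \<and> (\<forall>w\<in>W. \<not> odd_deg W C w)"
proof -
  obtain w0 where w0: "w0 \<in> W" using W(2) by blast
  obtain A v where A: "(trail_step diagonals W)\<^sup>*\<^sup>* (E, w0) (A, v)" "\<nexists>y. trail_step diagonals W (A, v) y"
    using maximal_trail_exists[OF assms(4), of diagonals W w0] by blast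
  have v: "v \<in> W" using eulerian_steps[OF A(1) W(1) w0] by blast
  with W(3) have "two_neighbours E W v" by blast
  then obtain d1 d2 where d12: "d1 \<in> diagonals" "d2 \<in> diagonals" "d1 \<noteq> d2" "edge W E v d1" "edge W E v d2"
    unfolding two_neighbours_def by (elim bexE conjE) (rule that)
  have "(E, w0) \<noteq> (A, v)" using d12(1,4) stuck_not_odd_deg(1)[OF A(2)] by blast
  then obtain A2 u where u: "(trail_step diagonals W)\<^sup>*\<^sup>* (E, w0) (A2, u)" "trail_step diagonals W (A2, u) (A, v)"
    using A(1) by (metis rtranclp.cases surj_pair)
  have uW: "u \<in> W" using eulerian_steps[OF u(1) W(1) w0] by blast
  from u(2) obtain d where d: "d \<in> diagonals" "A = A2 - {shift u 1 d}" "v = shift u 2 d"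
    by (auto simp: trail_step_def)
  \<comment> \<open>The excluded direction leads back along the last edge, so at most one of
    \<open>d1\<close> and \<open>d2\<close> is ruled out.\<close>
  obtain e where e: "e \<in> diagonals" "edge W E v e" "e \<noteq> (- fst d, - snd d)"
    using d12 by metis
  have "shift v 1 e \<noteq> shift u 1 d"
  proof
    assume eq: "shift v 1 e = shift u 1 d"
    have "v \<in> congruent_squares s" "u \<in> congruent_squares s" using v uW W(1) by blast+
    from same_edge[OF this e(1) d(1) eq] show False
      using e(3) d(3) shift_2_ne[OF d(1), of u] by metis
  qed
  moreover have "shift v 1 e \<notin> A"
    using stuck_not_odd_deg(1)[OF A(2), of e] e(1,2) unfolding edge_def by blast
  ultimately have "shift v 1 e \<notin> A2" using d(2) by blast
  moreover have "shift v 1 e \<in> E" using e(2) unfolding edge_def by blast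
  ultimately obtain E' where E': "(trail_step diagonals W)\<^sup>*\<^sup>* (E, w0) (E', v)"
    "(trail_step diagonals W)\<^sup>*\<^sup>* (E', v) (A2, u)"
    using used_edge_visited[OF u(1) W(1) w0 v e(1)] by blast
  have sub: "A2 \<subseteq> E'" "A \<subset> A2" "E' \<subseteq> E"
    using eulerian_steps[OF E'(2) W(1) v] eulerian_step[OF W(1) uW _ u(2)]
      eulerian_steps[OF E'(1) W(1) w0] by auto
  have E'A: "(trail_step diagonals W)\<^sup>*\<^sup>* (E', v) (A, v)" using E'(2) u(2) by auto
  \<comment> \<open>These are the edges used between the two visits of \<open>v\<close>, among them
    the last edge of the trail.\<close>
  let ?C = "E' - A"
  have "odd_deg W A w \<longleftrightarrow> odd_deg W E' w" if "w \<in> W" for w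
    using odd_deg_trail[OF E'A W(1) v that] by simp
  then have "\<forall>w\<in>W. \<not> odd_deg W ?C w"
    using odd_deg_diff[of A E' W] sub by blast
  moreover have "?C \<noteq> {}" "?C \<subseteq> E" using sub by blast+
  ultimately show ?thesis using captured_on_edge[OF E'A W(1) v] by blast
qed

text \<open>Additional pieces do not disturb a trail; only its maximality may be lost.\<close>

lemma trail_lift:
  assumes "(trail_step D F)\<^sup>*\<^sup>* (E, v) (E', v')" "E \<inter> C = {}"
  shows "(trail_step D F)\<^sup>*\<^sup>* (E \<union> C, v) (E' \<union> C, v') \<and> E' \<subseteq> E"
  using assms(1)
proof (induction rule: rtranclp_induct2)
  case (step X x X' x')
  from step.hyps(2) obtain d where d: "d \<in> D" "shift x 1 d \<in> X" "shift x 2 d \<in> F"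
    "X' = X - {shift x 1 d}" "x' = shift x 2 d"
    unfolding trail_step_def prod.case by blast
  have "X' \<union> C = X \<union> C - {shift x 1 d}" using d(2,4) step.IH assms(2) by blast
  then have "trail_step D F (X \<union> C, x) (X' \<union> C, x')"
    using d unfolding trail_step_def prod.case by blast
  then show ?case using step.IH d(4) by auto
qed simp

text \<open>Take \<open>t\<close> as the end of a full trail. A subgraph off \<open>t\<close>
  without leaves contains a closed trail \<open>C\<close>. Omitting \<open>C\<close> preserves all
  parities, so a maximal trail in \<open>E - C\<close> also stops at \<open>t\<close>; as
  \<open>C\<close> does not touch \<open>t\<close>, it is stuck in \<open>E\<close> as well and
  misses \<open>C\<close>. Hence leaves can always be stripped, which yields the order.\<close>

lemma king_condition_complete:
  assumes "full diagonals F E s" "F \<subseteq> congruent_squares s" "finite F" "finite E" "s \<in> F"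
  shows "\<exists>R. king_condition F E s R"
proof -
  obtain t where t: "(trail_step diagonals F)\<^sup>*\<^sup>* (E, s) ({}, t)"
    using full_trail[OF assms(1,4)] by blast
  have tF: "t \<in> F" using eulerian_steps[OF t assms(2,5)] by blast
  have "eulerian F {} t t" by (auto simp: eulerian_def odd_deg_def edge_def)
  then have eul: "eulerian F E s t" using eulerian_steps[OF t assms(2,5)] by blast
  have leaf: "\<exists>w\<in>W. \<not> two_neighbours E W w" if W: "W \<subseteq> F - {t}" "W \<noteq> {}" for W
  proof (rule ccontr)
    assume "\<not> (\<exists>w\<in>W. \<not> two_neighbours E W w)"
    then obtain C where C: "C \<subseteq> E" "C \<noteq> {}" "\<forall>m\<in>C. on_edge diagonals W m" "\<forall>w\<in>W. \<not> odd_deg W C w"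
      using closed_trail_exists[of W s E] W assms(2,4) by blast
    \<comment> \<open>Although \<open>C\<close> was found in the graph on \<open>W\<close>, it gains
      no edges in the larger graph on \<open>F\<close>: a piece determines its two ends.\<close>
    have CW: "w \<in> W \<and> shift w 2 d \<in> W" if w: "w \<in> F" "d \<in> diagonals" "shift w 1 d \<in> C" for w d
    proof -
      from C(3) w(3) have "on_edge diagonals W (shift w 1 d)" by blast
      then obtain x e where x: "x \<in> W" "e \<in> diagonals" "shift w 1 d = shift x 1 e" "shift x 2 e \<in> W"
        unfolding on_edge_def by (elim bexE conjE) (rule that)
      have "w \<in> congruent_squares s" "x \<in> congruent_squares s" using w(1) x(1) W(1) assms(2) by blast+
      from same_edge[OF this w(2) x(2,3)] show ?thesis using x(1,4) by metis
    qed
    then have eqW: "edge F C w d \<longleftrightarrow> w \<in> W \<and> edge W C w d" if "w \<in> F" "d \<in> diagonals" for w d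
      using that W(1) unfolding edge_def by blast
    have even: "\<not> odd_deg F C w" if "w \<in> F" for w
    proof (cases "w \<in> W")
      case True
      then have "{d \<in> diagonals. edge F C w d} = {d \<in> diagonals. edge W C w d}"
        using eqW that by blast
      then show ?thesis using C(4) True unfolding odd_deg_def by simp
    next
      case False
      then have none: "{d \<in> diagonals. edge F C w d} = {}" using eqW that by blast
      show ?thesis unfolding odd_deg_def none by simp
    qed
    have eul': "eulerian F (E - C) s t"
      using eul even odd_deg_diff[OF C(1), of F] unfolding eulerian_def by blast
    obtain E1 v where v: "(trail_step diagonals F)\<^sup>*\<^sup>* (E - C, s) (E1, v)"
      "\<nexists>y. trail_step diagonals F (E1, v) y"
      using maximal_trail_exists[of "E - C" diagonals F s] assms(4) by blast
    then have "v \<in> F" "eulerian F E1 v t" using eulerian_steps[OF v(1) assms(2,5), of t] eul' by auto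
    then have vt: "v = t" using stuck_at_end[OF v(2)] by blast
    have "(trail_step diagonals F)\<^sup>*\<^sup>* (E, s) (E1 \<union> C, v)"
    proof -
      have "(E - C) \<inter> C = {}" "E - C \<union> C = E" using C(1) by blast+
      then show ?thesis using trail_lift[OF v(1), of C] by metis
    qed
    moreover have "\<nexists>y. trail_step diagonals F (E1 \<union> C, v) y"
    proof
      assume "\<exists>y. trail_step diagonals F (E1 \<union> C, v) y"
      then obtain d where d: "d \<in> diagonals" "edge F (E1 \<union> C) v d"
        unfolding trail_step_def edge_def by auto
      then have "edge F C v d"
        using stuck_not_odd_deg(1)[OF v(2), of d] unfolding edge_def by blast
      then show False using eqW[OF tF d(1)] W(1) vt by blast
    qed
    ultimately have "E1 \<union> C = {}" using assms(1) unfolding full_def by blast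
    then show False using C(2) by blast
  qed
  have "finite (F - {t})" using assms(3) by simp
  from strip_leaves[OF this leaf] obtain f :: "square \<Rightarrow> nat"
    where f: "\<forall>v\<in>F - {t}. \<not> two_neighbours E {w \<in> F - {t}. f v \<le> f w} v" by blast
  \<comment> \<open>A vertex comes before another if it is stripped earlier; two neighbours that are
    not earlier would contradict that \<open>v\<close> was a leaf when removed.\<close>
  have "forest_order F E t (\<lambda>w v. f w < f v)"
    unfolding forest_order_def
  proof (intro ballI impI, rule ccontr)
    fix v d e
    assume v: "v \<in> F" "v \<noteq> t" and "d \<in> diagonals" "e \<in> diagonals" "d \<noteq> e" "edge F E v d" "edge F E v e"
      "shift v 2 d \<noteq> t" "shift v 2 e \<noteq> t" "\<not> (f (shift v 2 d) < f v \<or> f (shift v 2 e) < f v)"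
    then have "two_neighbours E {w \<in> F - {t}. f v \<le> f w} v"
      unfolding two_neighbours_def edge_def by (intro bexI[of _ d] bexI[of _ e]) auto
    then show False using f v by blast
  qed
  moreover have "\<forall>m\<in>E. on_edge diagonals F m" using captured_on_edge[OF t assms(2,5)] by simp
  ultimately have "king_condition F E s (\<lambda>w v. f w < f v)"
    unfolding king_condition_def using eul tF by auto
  then show ?thesis by blast
qed


subsection \<open>Men\<close>

text \<open>A man's trail is directed and captures at most one piece of each row. So all trails
  are full if and only if one is, and then each captured piece but the first one continues at the
  landing square of another one.\<close>

definition man_condition :: "(int \<times> int) set \<Rightarrow> square set \<Rightarrow> square set \<Rightarrow> square \<Rightarrow> bool" where
  "man_condition D F E s \<longleftrightarrow> (\<forall>m\<in>E. \<forall>m'\<in>E. fst m = fst m' \<longrightarrow> m = m') \<and>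
     (\<forall>m\<in>E. \<exists>v\<in>F. \<exists>d\<in>D. m = shift v 1 d \<and> shift v 2 d \<in> F \<and>
       (v = s \<or> (\<exists>m'\<in>E. \<exists>v'\<in>F. \<exists>d'\<in>D. m' = shift v' 1 d' \<and> v = shift v' 2 d')))"

lemma fst_shift: "fst (shift v k d) = fst v + k * fst d"
  by (cases v; cases d) simp

text \<open>The condition survives every step: captures whose predecessor has just been taken now
  start at the new position. If pieces remain, one in the largest row cannot have a predecessor,
  since that would lie two rows higher, so it can be captured at once and the man is not
  stuck.\<close>

lemma man_condition_sound:
  assumes "man_condition D F E s" "F \<subseteq> congruent_squares s" "s \<in> F" "finite E"
    and D: "\<And>d. d \<in> D \<Longrightarrow> fst d = -1 \<and> d \<in> diagonals"
  shows "full D F E s"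
  unfolding full_def
proof (intro allI impI, rule ccontr)
  fix E' v
  assume tr: "(trail_step D F)\<^sup>*\<^sup>* (E, s) (E', v)"
    and stuck: "\<nexists>y. trail_step D F (E', v) y" and ne: "E' \<noteq> {}"
  have "man_condition D F E' v \<and> E' \<subseteq> E \<and> v \<in> F"
    using tr
  proof (induction rule: rtranclp_induct2)
    case (step X x X' x')
    then have X: "man_condition D F X x" "x \<in> F" by auto
    from step.hyps(2) obtain d where d: "d \<in> D" "shift x 1 d \<in> X" "shift x 2 d \<in> F"
      "X' = X - {shift x 1 d}" "x' = shift x 2 d"
      by (auto simp: trail_step_def)
    have "\<exists>v\<in>F. \<exists>e\<in>D. m = shift v 1 e \<and> shift v 2 e \<in> F \<and>
       (v = x' \<or> (\<exists>m'\<in>X'. \<exists>v'\<in>F. \<exists>d'\<in>D. m' = shift v' 1 d' \<and> v = shift v' 2 d'))"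
      if m: "m \<in> X'" for m
    proof -
      have "m \<in> X" using m d(4) by blast
      with X(1) obtain v e where v: "v \<in> F" "e \<in> D" "m = shift v 1 e" "shift v 2 e \<in> F"
        "v = x \<or> (\<exists>m'\<in>X. \<exists>v'\<in>F. \<exists>d'\<in>D. m' = shift v' 1 d' \<and> v = shift v' 2 d')"
        unfolding man_condition_def by metis
      \<comment> \<open>A second piece capturable from \<open>x\<close> would share its row with the
        piece just captured.\<close>
      have "v \<noteq> x"
      proof
        assume "v = x"
        then have "fst m = fst (shift x 1 d)" using v(2,3) d(1) D by (simp add: fst_shift)
        then show False using X(1) m d(2,4) unfolding man_condition_def by blast
      qed
      then obtain m' v' d' where v': "m' \<in> X" "v' \<in> F" "d' \<in> D" "m' = shift v' 1 d'" "v = shift v' 2 d'"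
        using v(5) by blast
      have "v = x'" if "m' \<notin> X'"
      proof -
        have eq: "shift v' 1 d' = shift x 1 d" using that v'(1,4) d(4) by blast
        \<comment> \<open>Both directions decrease the row, so the same piece cannot be jumped the
          opposite way.\<close>
        have "d' \<noteq> (- fst d, - snd d)" using D[OF v'(3)] D[OF d(1)] by auto
        moreover have "v' \<in> congruent_squares s" "x \<in> congruent_squares s"
          using v'(2) X(2) assms(2) by blast+
        ultimately have "v' = x \<and> d' = d"
          using same_edge[OF _ _ _ _ eq, of s] D[OF v'(3)] D[OF d(1)] by blast
        then show ?thesis using v'(5) d(5) by simp
      qed
      then show ?thesis using v(1-4) v' by blast
    qed
    moreover have "\<forall>m\<in>X'. \<forall>m'\<in>X'. fst m = fst m' \<longrightarrow> m = m'"
      using X(1) d(4) unfolding man_condition_def by blast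
    ultimately have "man_condition D F X' x'" unfolding man_condition_def by blast
    then show ?case using step.IH d by auto
  qed (use assms in auto)
  then have man: "man_condition D F E' v" and "finite E'" using assms(4) finite_subset by auto
  define r where "r = Max (fst ` E')"
  have "r \<in> fst ` E'" unfolding r_def using \<open>finite E'\<close> ne by (intro Max_in) auto
  then obtain m where m: "m \<in> E'" "fst m = r" by auto
  have le: "fst m' \<le> fst m" if "m' \<in> E'" for m'
    unfolding m(2) r_def using \<open>finite E'\<close> that by simp
  obtain w d where w: "w \<in> F" "d \<in> D" "m = shift w 1 d" "shift w 2 d \<in> F"
    "w = v \<or> (\<exists>m'\<in>E'. \<exists>v'\<in>F. \<exists>d'\<in>D. m' = shift v' 1 d' \<and> w = shift v' 2 d')"
    using man m(1) unfolding man_condition_def by blast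
  show False
  proof (cases "w = v")
    case True
    then have "trail_step D F (E', v) (E' - {m}, shift w 2 d)"
      using w m(1) unfolding trail_step_def by blast
    then show False using stuck by blast
  next
    case False
    then obtain m' v' d' where "m' \<in> E'" "d' \<in> D" "m' = shift v' 1 d'" "w = shift v' 2 d'"
      using w(5) by blast
    then show False using le[of m'] w(2,3) D by (simp add: fst_shift)
  qed
qed

text \<open>Induction backwards along one full trail. The added claim that all pieces lie below the
  start separates the row of the first captured piece from the rows of the later ones.\<close>

lemma man_condition_complete:
  assumes "full D F E s" "finite E" "s \<in> F"
    and D: "\<And>d. d \<in> D \<Longrightarrow> fst d = -1"
  shows "man_condition D F E s"
proof -
  obtain t where t: "(trail_step D F)\<^sup>*\<^sup>* (E, s) ({}, t)" using full_trail[OF assms(1,2)] by blast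
  have "s \<in> F \<longrightarrow> man_condition D F E s \<and> (\<forall>m\<in>E. fst m < fst s)"
    using t
  proof (induction rule: converse_rtranclp_induct2)
    case (step X x X' x')
    from step.hyps(1) obtain d where d: "d \<in> D" "shift x 1 d \<in> X" "x' \<in> F"
      "X' = X - {shift x 1 d}" "x' = shift x 2 d"
      by (auto simp: trail_step_def)
    then have X: "X = insert (shift x 1 d) X'" by blast
    have rows: "fst (shift x 1 d) = fst x - 1" "fst x' = fst x - 2" using d(1,5) D by (simp_all add: fst_shift)
    have IH: "man_condition D F X' x'" "\<forall>m\<in>X'. fst m < fst x'" using step.IH d(3) by auto
    show ?case
    proof
      assume x: "x \<in> F"
      have lt: "\<forall>m\<in>X'. fst m < fst (shift x 1 d)" using IH(2) rows by auto
      moreover have "\<forall>m\<in>X'. \<forall>m'\<in>X'. fst m = fst m' \<longrightarrow> m = m'"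
        using IH(1) unfolding man_condition_def by (rule conjunct1)
      ultimately have "\<forall>m\<in>X. \<forall>m'\<in>X. fst m = fst m' \<longrightarrow> m = m'"
        unfolding X by (metis insert_iff less_irrefl)
      moreover have "\<exists>v\<in>F. \<exists>e\<in>D. m = shift v 1 e \<and> shift v 2 e \<in> F \<and>
        (v = x \<or> (\<exists>m'\<in>X. \<exists>v'\<in>F. \<exists>d'\<in>D. m' = shift v' 1 d' \<and> v = shift v' 2 d'))"
        if "m \<in> X" for m
      proof (cases "m \<in> X'")
        case True
        then obtain v e where v: "v \<in> F" "e \<in> D" "m = shift v 1 e" "shift v 2 e \<in> F"
          "v = x' \<or> (\<exists>m'\<in>X'. \<exists>v'\<in>F. \<exists>d'\<in>D. m' = shift v' 1 d' \<and> v = shift v' 2 d')"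
          using IH(1) unfolding man_condition_def by blast
        have "\<exists>m'\<in>X. \<exists>v'\<in>F. \<exists>d'\<in>D. m' = shift v' 1 d' \<and> v = shift v' 2 d'"
          using v(5)
        proof
          assume "v = x'"
          then show ?thesis using x d(1,2,5) by blast
        qed (use X in blast)
        then show ?thesis using v(1-4) by blast
      next
        case False
        then show ?thesis using that X x d(1,3,5) by blast
      qed
      ultimately have "man_condition D F X x" unfolding man_condition_def by blast
      moreover have "\<forall>m\<in>X. fst m < fst x" using lt rows unfolding X by auto
      ultimately show "man_condition D F X x \<and> (\<forall>m\<in>X. fst m < fst x)" by blast
    qed
  qed (simp add: man_condition_def)
  then show ?thesis using assms(3) by blast
qed


section \<open>Forced wins\<close>

text \<open>The square \<open>s\<close> is included because the moving piece vacates it. Computed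
  once from the board before the turn, the set stays correct throughout: captured pieces stand on
  rows of the other parity, so captures open no new landing square.\<close>

definition landing :: "nat \<Rightarrow> board \<Rightarrow> square \<Rightarrow> square set" where
  "landing n b s = {v. on_board n v \<and> v \<in> congruent_squares s \<and> (b v = None \<or> v = s)}"

definition enemies :: "player \<Rightarrow> board \<Rightarrow> square set" where
  "enemies p b = {m. \<exists>k. b m = Some (opponent p, k)}"

text \<open>The board after the piece \<open>q\<close> has jumped from \<open>s\<close> to \<open>v\<close>, with the enemies \<open>E\<close> remaining.\<close>

definition played :: "board \<Rightarrow> square \<Rightarrow> piece \<Rightarrow> square set \<Rightarrow> square \<Rightarrow> board" where
  "played b s q E v = (\<lambda>w. if w = v then Some q
     else if w = s \<or> w \<in> enemies (fst q) b - E then None else b w)"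

definition squares :: "nat \<Rightarrow> square set" where
  "squares n = {v. on_board n v}"

lemma squares_eq: "squares n = {0..<int n} \<times> {0..<int n}"
  by (auto simp: squares_def)

lemma finite_squares: "finite (squares n)" and card_squares: "card (squares n) = n * n"
  by (simp_all add: squares_eq card_cartesian_product)

lemma directions_subset: "directions q \<subseteq> diagonals"
proof (cases q rule: directions.cases)
  case (1 p)
  then show ?thesis by (cases p) auto
qed auto

text \<open>The half of \<open>valid_board\<close> that makes a board finite and determined by its
  values on \<open>squares n\<close>; the colour of the squares is tested for the input board
  alone.\<close>

definition confined :: "nat \<Rightarrow> board \<Rightarrow> bool" where
  "confined n b \<longleftrightarrow> (\<forall>s. b s \<noteq> None \<longrightarrow> on_board n s)"

lemma confined_on_board: "confined n b \<Longrightarrow> b s = Some q \<Longrightarrow> on_board n s"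
  unfolding confined_def by (metis option.distinct(1))

lemma opponent_neq [simp]: "opponent p \<noteq> p" "p \<noteq> opponent p"
  by (cases p; simp)+

context
  fixes n :: nat and p :: player and k :: rank and b :: board and s :: square
  assumes bs: "b s = Some (p, k)" and s: "on_board n s"
begin

private abbreviation (input) "F \<equiv> landing n b s"
private abbreviation (input) "E\<^sub>0 \<equiv> enemies p b"
private abbreviation (input) "D \<equiv> directions (p, k)"

text \<open>The parity clause is the invariant that keeps \<open>landing\<close> valid while pieces
  disappear.\<close>

definition trail_state :: "square set \<Rightarrow> square \<Rightarrow> bool" where
  "trail_state E v \<longleftrightarrow> v \<in> F \<and> E \<subseteq> E\<^sub>0 \<and> (\<forall>m\<in>E\<^sub>0 - E. odd (fst m - fst s))"

lemma landing_congruent: "F \<subseteq> congruent_squares s"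
  by (auto simp: landing_def)

lemma trail_state_start: "trail_state E\<^sub>0 s"
  using s by (auto simp: trail_state_def landing_def congruent_refl)

lemma trail_state_step:
  assumes "trail_state E v" "trail_step D F (E, v) (E', v')"
  shows "trail_state E' v'"
proof -
  from assms(2) obtain d where d: "d \<in> D" "shift v 1 d \<in> E" "v' \<in> F" "E' = E - {shift v 1 d}"
    unfolding trail_step_def prod.case by blast
  have "v \<in> congruent_squares s" using assms(1) landing_congruent by (auto simp: trail_state_def)
  then have "odd (fst (shift v 1 d) - fst s)"
    using not_congruent_shift d(1) directions_subset by blast
  then show ?thesis using assms(1) d by (auto simp: trail_state_def)
qed

text \<open>A bisimulation: on reachable boards a jump and a trail step determine each other. The
  parity invariant distinguishes the squares jumped over from the squares landed on.\<close>

lemma jump_played: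
  assumes "trail_state E v"
  shows "jump n p (played b s (p, k) E v, v) (b', v') \<longleftrightarrow>
    (\<exists>E'. trail_step D F (E, v) (E', v') \<and> b' = played b s (p, k) E' v')"
proof -
  let ?B = "played b s (p, k) E v"
  have v: "v \<in> F" "v \<in> congruent_squares s" and E: "E \<subseteq> E\<^sub>0" "\<And>m. m \<in> E\<^sub>0 - E \<Longrightarrow> odd (fst m - fst s)"
    using assms landing_congruent by (auto simp: trail_state_def)
  have Bv: "?B v = Some (p, k)" by (simp add: played_def)
  have m: "shift v 1 d \<noteq> v" "shift v 1 d \<noteq> s" "(\<exists>k'. ?B (shift v 1 d) = Some (opponent p, k')) \<longleftrightarrow> shift v 1 d \<in> E"
    if "d \<in> D" for d
  proof -
    have d: "d \<in> diagonals" using that directions_subset by blast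
    have odd: "odd (fst (shift v 1 d) - fst s)" by (rule not_congruent_shift[OF v(2) d])
    have "even (fst v - fst s)" using v(2) by (simp add: congruent_squares_def)
    with odd show "shift v 1 d \<noteq> v" by metis
    moreover show "shift v 1 d \<noteq> s" using odd by auto
    ultimately show "(\<exists>k'. ?B (shift v 1 d) = Some (opponent p, k')) \<longleftrightarrow> shift v 1 d \<in> E"
      using E(1) by (auto simp: played_def enemies_def)
  qed
  have l: "shift v 2 d \<noteq> v" "on_board n (shift v 2 d) \<and> ?B (shift v 2 d) = None \<longleftrightarrow> shift v 2 d \<in> F"
    if "d \<in> D" for d
  proof -
    have d: "d \<in> diagonals" using that directions_subset by blast
    show ne: "shift v 2 d \<noteq> v" by (rule shift_2_ne[OF d])
    have c: "shift v 2 d \<in> congruent_squares s" by (rule congruent_shift[OF v(2) d])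
    then have "even (fst (shift v 2 d) - fst s)" by (simp add: congruent_squares_def)
    then have "shift v 2 d \<notin> E\<^sub>0 - E" using E(2) by blast
    then show "on_board n (shift v 2 d) \<and> ?B (shift v 2 d) = None \<longleftrightarrow> shift v 2 d \<in> F"
      using ne c by (auto simp: played_def landing_def)
  qed
  have upd: "?B(v := None, shift v 1 d := None, shift v 2 d \<mapsto> (p, k)) =
    played b s (p, k) (E - {shift v 1 d}) (shift v 2 d)"
    if "d \<in> D" "shift v 1 d \<in> E" "shift v 2 d \<in> F" for d
  proof
    fix w
    have "v = s \<or> b v = None" using v(1) by (auto simp: landing_def)
    then show "(?B(v := None, shift v 1 d := None, shift v 2 d \<mapsto> (p, k))) w =
      played b s (p, k) (E - {shift v 1 d}) (shift v 2 d) w"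
      using m(1,2)[OF that(1)] l(1)[OF that(1)] that(2) E(1) by (auto simp: played_def)
  qed
  have "jump n p (?B, v) (b', v') \<longleftrightarrow> (\<exists>d\<in>D. (\<exists>k'. ?B (shift v 1 d) = Some (opponent p, k')) \<and>
    v' = shift v 2 d \<and> (on_board n (shift v 2 d) \<and> ?B (shift v 2 d) = None) \<and>
    b' = ?B(v := None, shift v 1 d := None, shift v 2 d \<mapsto> (p, k)))"
    using Bv unfolding jump_def by auto
  also have "\<dots> \<longleftrightarrow> (\<exists>d\<in>D. shift v 1 d \<in> E \<and> v' = shift v 2 d \<and> shift v 2 d \<in> F \<and>
    b' = played b s (p, k) (E - {shift v 1 d}) (shift v 2 d))"
    using m(3) l(2) upd by (intro bex_cong refl) (metis (no_types, lifting))
  also have "\<dots> \<longleftrightarrow> (\<exists>E'. trail_step D F (E, v) (E', v') \<and> b' = played b s (p, k) E' v')"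
    unfolding trail_step_def prod.case by metis
  finally show ?thesis .
qed

lemma played_start: "played b s (p, k) E\<^sub>0 s = b"
  using bs by (auto simp: played_def)

lemma jumps_played:
  "(jump n p)\<^sup>*\<^sup>* (b, s) (b', v) \<longleftrightarrow>
    (\<exists>E. (trail_step D F)\<^sup>*\<^sup>* (E\<^sub>0, s) (E, v) \<and> trail_state E v \<and> b' = played b s (p, k) E v)"
proof
  assume "(jump n p)\<^sup>*\<^sup>* (b, s) (b', v)"
  then show "\<exists>E. (trail_step D F)\<^sup>*\<^sup>* (E\<^sub>0, s) (E, v) \<and> trail_state E v \<and> b' = played b s (p, k) E v"
  proof (induction rule: rtranclp_induct2)
    case refl
    then show ?case using trail_state_start played_start by auto
  next
    case (step b1 v1 b2 v2)
    then obtain E where E: "(trail_step D F)\<^sup>*\<^sup>* (E\<^sub>0, s) (E, v1)" "trail_state E v1"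
      "b1 = played b s (p, k) E v1"
      by blast
    from step.hyps(2) obtain E' where E': "trail_step D F (E, v1) (E', v2)" "b2 = played b s (p, k) E' v2"
      unfolding E(3) jump_played[OF E(2)] by blast
    have "(trail_step D F)\<^sup>*\<^sup>* (E\<^sub>0, s) (E', v2)" using E(1) E'(1) by (rule rtranclp.rtrancl_into_rtrancl)
    then show ?case using trail_state_step[OF E(2) E'(1)] E'(2) by blast
  qed
next
  assume "\<exists>E. (trail_step D F)\<^sup>*\<^sup>* (E\<^sub>0, s) (E, v) \<and> trail_state E v \<and> b' = played b s (p, k) E v"
  then obtain E where E: "(trail_step D F)\<^sup>*\<^sup>* (E\<^sub>0, s) (E, v)" "b' = played b s (p, k) E v" by blast
  from E(1) have "trail_state E v \<and> (jump n p)\<^sup>*\<^sup>* (b, s) (played b s (p, k) E v, v)"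
  proof (induction rule: rtranclp_induct2)
    case refl
    then show ?case using trail_state_start played_start by auto
  next
    case (step E1 v1 E2 v2)
    then have E1: "trail_state E1 v1" by blast
    then have "jump n p (played b s (p, k) E1 v1, v1) (played b s (p, k) E2 v2, v2)"
      using jump_played step.hyps(2) by blast
    moreover have "trail_state E2 v2" by (rule trail_state_step[OF E1 step.hyps(2)])
    ultimately show ?case using step.IH by (meson rtranclp.rtrancl_into_rtrancl)
  qed
  with E(2) show "(jump n p)\<^sup>*\<^sup>* (b, s) (b', v)" by simp
qed

lemma has_enemy_played:
  assumes "trail_state E v"
  shows "has_piece (opponent p) (played b s (p, k) E v) \<longleftrightarrow> E \<noteq> {}"
proof
  assume "has_piece (opponent p) (played b s (p, k) E v)"
  then obtain w k' where "played b s (p, k) E v w = Some (opponent p, k')" by (auto simp: has_piece_def)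
  then have "w \<in> E" by (auto simp: played_def enemies_def split: if_splits)
  then show "E \<noteq> {}" by blast
next
  assume "E \<noteq> {}"
  then obtain w where "w \<in> E" by blast
  moreover have "w \<in> E\<^sub>0" using assms \<open>w \<in> E\<close> by (auto simp: trail_state_def)
  ultimately obtain k' where w: "w \<in> E" "b w = Some (opponent p, k')"
    unfolding enemies_def by blast
  moreover have "w \<noteq> v" "w \<noteq> s" using w(2) bs assms by (auto simp: trail_state_def landing_def)
  ultimately have "played b s (p, k) E v w = Some (opponent p, k')" by (auto simp: played_def)
  then show "has_piece (opponent p) (played b s (p, k) E v)" unfolding has_piece_def by blast
qed

lemma full_iff:
  "full D F E\<^sub>0 s \<longleftrightarrow> (\<forall>b' v. (jump n p)\<^sup>*\<^sup>* (b, s) (b', v) \<longrightarrow>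
     (\<nexists>x. jump n p (b', v) x) \<longrightarrow> \<not> has_piece (opponent p) b')"
proof -
  have stuck: "(\<nexists>x. jump n p (played b s (p, k) E v, v) x) \<longleftrightarrow> (\<nexists>y. trail_step D F (E, v) y)"
    if "trail_state E v" for E v
    using jump_played[OF that] by auto
  have state: "trail_state E v" if "(trail_step D F)\<^sup>*\<^sup>* (E\<^sub>0, s) (E, v)" for E v
    using that by (induction rule: rtranclp_induct2) (auto intro: trail_state_start trail_state_step)
  have "(\<forall>b' v. (jump n p)\<^sup>*\<^sup>* (b, s) (b', v) \<longrightarrow>
     (\<nexists>x. jump n p (b', v) x) \<longrightarrow> \<not> has_piece (opponent p) b') \<longleftrightarrow>
    (\<forall>E v. (trail_step D F)\<^sup>*\<^sup>* (E\<^sub>0, s) (E, v) \<longrightarrow> trail_state E v \<longrightarrow>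
      (\<nexists>x. jump n p (played b s (p, k) E v, v) x) \<longrightarrow> \<not> has_piece (opponent p) (played b s (p, k) E v))"
    unfolding jumps_played by blast
  also have "\<dots> \<longleftrightarrow> full D F E\<^sub>0 s"
    unfolding full_def using stuck has_enemy_played state by (metis (no_types, lifting))
  finally show ?thesis by simp
qed

lemma maximal_jumps_exist:
  assumes "finite E\<^sub>0"
  shows "\<exists>b' v. (jump n p)\<^sup>*\<^sup>* (b, s) (b', v) \<and> (\<nexists>x. jump n p (b', v) x)"
proof -
  obtain E v where E: "(trail_step D F)\<^sup>*\<^sup>* (E\<^sub>0, s) (E, v)" "\<nexists>y. trail_step D F (E, v) y"
    using maximal_trail_exists[OF assms] by blast
  have "trail_state E v"
    using E(1) by (induction rule: rtranclp_induct2) (auto intro: trail_state_start trail_state_step)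
  then show ?thesis using E jump_played jumps_played by (metis surj_pair)
qed

end

lemma finite_enemies: "confined n b \<Longrightarrow> finite (enemies p b)"
  by (rule finite_subset[OF _ finite_squares[of n]])
    (force simp: enemies_def confined_def squares_def)

lemma finite_landing: "finite (landing n b s)"
  by (rule finite_subset[OF _ finite_squares[of n]]) (auto simp: landing_def squares_def)

lemma jump_moves_piece:
  assumes "jump n p x y"
  shows "\<exists>k. fst x (snd x) = Some (p, k) \<and> fst y (snd y) = Some (p, k)"
  using assms by (cases x; cases y) (auto simp: jump_def)

lemma jumps_move_piece:
  assumes "(jump n p)\<^sup>+\<^sup>+ (b, s) (b', s')"
  shows "\<exists>k. b' s' = Some (p, k)"
  using assms by (cases rule: tranclp.cases) (auto dest: jump_moves_piece)

lemma has_piece_crown: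
  "has_piece q (b(s := map_option (crown n s) (b s))) \<longleftrightarrow> has_piece q b"
proof -
  have "(\<exists>k. (b(s := map_option (crown n s) (b s))) w = Some (q, k)) \<longleftrightarrow> (\<exists>k. b w = Some (q, k))" for w
    by (cases "b s"; cases s) auto
  then show ?thesis unfolding has_piece_def by meson
qed

text \<open>The piece that moves survives its own turn. Applied to Black, this supplies the black
  piece that Red still has to capture.\<close>

lemma legal_move_has_piece:
  assumes "legal_move n p b b'"
  shows "has_piece p b'"
proof (cases "can_jump n p b")
  case True
  then obtain s b1 s1 where "(jump n p)\<^sup>+\<^sup>+ (b, s) (b1, s1)" "b' = b1(s1 := map_option (crown n s1) (b1 s1))"
    using assms by (auto simp: legal_move_def jump_turn_def)
  then show ?thesis using jumps_move_piece has_piece_crown by (metis has_piece_def)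
next
  case False
  then obtain k l where "b' l = Some (crown n l (p, k))"
    using assms by (auto simp: legal_move_def simple_move_def) fastforce
  then show ?thesis by (cases l) (auto simp: has_piece_def)
qed

text \<open>A simple move captures nothing, so with an enemy on the board a win requires a jump.
  Crowning does not change the owner of a piece, so the turns may be judged by their maximal chains,
  which \<open>full_iff\<close> translates into trails.\<close>

lemma forced_to_win_iff:
  assumes "confined n b" "has_piece (opponent p) b"
  shows "forced_to_win n p b \<longleftrightarrow> can_jump n p b \<and> (\<forall>s k. b s = Some (p, k) \<longrightarrow>
    (\<exists>x. jump n p (b, s) x) \<longrightarrow> full (directions (p, k)) (landing n b s) (enemies p b) s)"
proof (cases "can_jump n p b")
  case True
  have on: "on_board n s" if "b s = Some (p, k)" for s k
    using confined_on_board[OF assms(1) that] .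
  \<comment> \<open>A chain that ends stuck cannot be empty if its start has a jump.\<close>
  have tranclp: "(jump n p)\<^sup>+\<^sup>+ (b, s) (b1, s1) \<longleftrightarrow> (jump n p)\<^sup>*\<^sup>* (b, s) (b1, s1)"
    if "\<exists>x. jump n p (b, s) x" "\<nexists>x. jump n p (b1, s1) x" for s b1 s1
    using that by (metis Nitpick.rtranclp_unfold)
  have start: "\<exists>x. jump n p (b, s) x" if "(jump n p)\<^sup>+\<^sup>+ (b, s) (b1, s1)" for s b1 s1
    using that by (metis tranclpD)
  have forced: "(\<forall>b'. legal_move n p b b' \<longrightarrow> \<not> has_piece (opponent p) b') \<longleftrightarrow>
    (\<forall>s. (\<exists>x. jump n p (b, s) x) \<longrightarrow> (\<forall>b1 s1. (jump n p)\<^sup>*\<^sup>* (b, s) (b1, s1) \<longrightarrow>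
      (\<nexists>x. jump n p (b1, s1) x) \<longrightarrow> \<not> has_piece (opponent p) b1))"
  proof -
    have "(\<forall>b'. legal_move n p b b' \<longrightarrow> \<not> has_piece (opponent p) b') \<longleftrightarrow>
      (\<forall>s b1 s1. (jump n p)\<^sup>+\<^sup>+ (b, s) (b1, s1) \<longrightarrow> (\<nexists>x. jump n p (b1, s1) x) \<longrightarrow>
        \<not> has_piece (opponent p) b1)"
    proof (intro iffI allI impI)
      fix s b1 s1
      assume "\<forall>b'. legal_move n p b b' \<longrightarrow> \<not> has_piece (opponent p) b'"
        and "(jump n p)\<^sup>+\<^sup>+ (b, s) (b1, s1)" "\<nexists>x. jump n p (b1, s1) x"
      moreover from this have "jump_turn n p b (b1(s1 := map_option (crown n s1) (b1 s1)))"
        unfolding jump_turn_def by blast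
      ultimately show "\<not> has_piece (opponent p) b1"
        using True has_piece_crown unfolding legal_move_def by metis
    next
      fix b'
      assume jumps: "\<forall>s b1 s1. (jump n p)\<^sup>+\<^sup>+ (b, s) (b1, s1) \<longrightarrow> (\<nexists>x. jump n p (b1, s1) x) \<longrightarrow>
        \<not> has_piece (opponent p) b1" and "legal_move n p b b'"
      then have "jump_turn n p b b'" using True unfolding legal_move_def by simp
      then obtain s b1 s1 where "(jump n p)\<^sup>+\<^sup>+ (b, s) (b1, s1)" "\<nexists>x. jump n p (b1, s1) x"
        "b' = b1(s1 := map_option (crown n s1) (b1 s1))"
        unfolding jump_turn_def by blast
      then show "\<not> has_piece (opponent p) b'" using jumps has_piece_crown by metis
    qed
    then show ?thesis using tranclp start by (metis (no_types, lifting))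
  qed
  obtain s k where s: "b s = Some (p, k)" "\<exists>x. jump n p (b, s) x"
    using True jump_moves_piece unfolding can_jump_def by (metis fst_conv snd_conv)
  obtain b1 s1 where "(jump n p)\<^sup>*\<^sup>* (b, s) (b1, s1)" "\<nexists>x. jump n p (b1, s1) x"
    using maximal_jumps_exist[OF s(1) on[OF s(1)] finite_enemies[OF assms(1)]] by blast
  then have "jump_turn n p b (b1(s1 := map_option (crown n s1) (b1 s1)))"
    unfolding jump_turn_def using tranclp[OF s(2)] by blast
  then have "\<exists>b'. legal_move n p b b'" using True unfolding legal_move_def by auto
  moreover have "(\<forall>s. (\<exists>x. jump n p (b, s) x) \<longrightarrow> (\<forall>b1 s1. (jump n p)\<^sup>*\<^sup>* (b, s) (b1, s1) \<longrightarrow>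
      (\<nexists>x. jump n p (b1, s1) x) \<longrightarrow> \<not> has_piece (opponent p) b1)) \<longleftrightarrow>
    (\<forall>s k. b s = Some (p, k) \<longrightarrow>
      (\<exists>x. jump n p (b, s) x) \<longrightarrow> full (directions (p, k)) (landing n b s) (enemies p b) s)"
  proof -
    have "(\<exists>x. jump n p (b, s) x) \<longleftrightarrow> (\<exists>k. b s = Some (p, k)) \<and> (\<exists>x. jump n p (b, s) x)" for s
      using jump_moves_piece by fastforce
    then show ?thesis using full_iff on by (metis (no_types, lifting))
  qed
  ultimately show ?thesis using True forced unfolding forced_to_win_def by blast
next
  case False
  have "has_piece (opponent p) b'" if "simple_move n p b b'" for b'
  proof -
    obtain w k' where w: "b w = Some (opponent p, k')" using assms(2) by (auto simp: has_piece_def)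
    obtain s k d where "b s = Some (p, k)" "b (shift s 1 d) = None"
      "b' = b(s := None, shift s 1 d \<mapsto> crown n (shift s 1 d) (p, k))"
      using \<open>simple_move n p b b'\<close> unfolding simple_move_def by blast
    moreover from this have "w \<noteq> s" "w \<noteq> shift s 1 d" using w by auto
    ultimately have "b' w = Some (opponent p, k')" using w by simp
    then show ?thesis unfolding has_piece_def by blast
  qed
  then have "\<not> forced_to_win n p b" using False unfolding forced_to_win_def legal_move_def by auto
  then show ?thesis using False by blast
qed

text \<open>Applied only to squares from which Red can jump, so the second branch concerns men. Each
  starting square has an order of its own, whence the extra argument of \<open>R\<close>.\<close>

definition red_condition :: "nat \<Rightarrow> board \<Rightarrow> (square \<Rightarrow> square \<Rightarrow> square \<Rightarrow> bool) \<Rightarrow> square \<Rightarrow> bool" where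
  "red_condition n b R s \<longleftrightarrow> (if b s = Some (Red, King)
     then king_condition (landing n b s) (enemies Red b) s (R s)
     else man_condition (directions (Red, Man)) (landing n b s) (enemies Red b) s)"

text \<open>Here the quantifier over all plays of Red turns into an existential one over orders,
  which the certificate can supply; choice merges the orders of the individual kings into one
  function.\<close>

lemma forced_to_win_Red_iff:
  assumes "confined n b" "has_piece Black b"
  shows "forced_to_win n Red b \<longleftrightarrow>
    can_jump n Red b \<and> (\<exists>R. \<forall>s. (\<exists>x. jump n Red (b, s) x) \<longrightarrow> red_condition n b R s)"
proof -
  have full_King: "full (directions (Red, King)) (landing n b s) (enemies Red b) s \<longleftrightarrow>
    (\<exists>R. king_condition (landing n b s) (enemies Red b) s R)" if "b s = Some (Red, King)" for s
  proof -
    have s: "s \<in> landing n b s"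
      using confined_on_board[OF assms(1) that] by (simp add: landing_def congruent_refl)
    have sub: "landing n b s \<subseteq> congruent_squares s" by (auto simp: landing_def)
    have D: "directions (Red, King) = diagonals" by simp
    show ?thesis unfolding D
      using king_condition_sound[OF _ sub finite_landing s]
        king_condition_complete[OF _ sub finite_landing finite_enemies[OF assms(1)] s] by blast
  qed
  have full_Man: "full (directions (Red, Man)) (landing n b s) (enemies Red b) s \<longleftrightarrow>
    man_condition (directions (Red, Man)) (landing n b s) (enemies Red b) s" if "b s = Some (Red, Man)" for s
  proof -
    have s: "s \<in> landing n b s"
      using confined_on_board[OF assms(1) that] by (simp add: landing_def congruent_refl)
    have sub: "landing n b s \<subseteq> congruent_squares s" by (auto simp: landing_def)
    have D: "fst d = -1 \<and> d \<in> diagonals" if "d \<in> directions (Red, Man)" for d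
      using that by auto
    show ?thesis
      using man_condition_sound[OF _ sub s finite_enemies[OF assms(1)] D]
        man_condition_complete[OF _ finite_enemies[OF assms(1)] s, of "directions (Red, Man)"] D by blast
  qed
  have piece: "b s = Some (Red, King) \<or> b s = Some (Red, Man)" if ex: "\<exists>x. jump n Red (b, s) x" for s
  proof -
    obtain x where "jump n Red (b, s) x" using ex by blast
    from jump_moves_piece[OF this] obtain k where "b s = Some (Red, k)" by auto
    then show ?thesis by (cases k) auto
  qed
  have "(\<forall>s k. b s = Some (Red, k) \<longrightarrow> (\<exists>x. jump n Red (b, s) x) \<longrightarrow>
      full (directions (Red, k)) (landing n b s) (enemies Red b) s) \<longleftrightarrow>
    (\<forall>s. (\<exists>x. jump n Red (b, s) x) \<longrightarrow> (\<exists>R. red_condition n b (\<lambda>_. R) s))" (is "?l \<longleftrightarrow> ?r")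
  proof
    assume l: ?l
    show ?r
    proof (intro allI impI)
      fix s assume j: "\<exists>x. jump n Red (b, s) x"
      from piece[OF this] show "\<exists>R. red_condition n b (\<lambda>_. R) s"
      proof
        assume King: "b s = Some (Red, King)"
        then have "full (directions (Red, King)) (landing n b s) (enemies Red b) s" using l j by blast
        then show ?thesis using full_King[OF King] King by (simp only: red_condition_def if_True) simp
      next
        assume Man: "b s = Some (Red, Man)"
        then have "full (directions (Red, Man)) (landing n b s) (enemies Red b) s" using l j by blast
        then show ?thesis using full_Man[OF Man] Man unfolding red_condition_def by simp
      qed
    qed
  next
    assume r: ?r
    show ?l
    proof (intro allI impI)
      fix s k assume "b s = Some (Red, k)" "\<exists>x. jump n Red (b, s) x"
      moreover from this obtain R where "red_condition n b (\<lambda>_. R) s" using r by blast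
      ultimately show "full (directions (Red, k)) (landing n b s) (enemies Red b) s"
        using full_King[of s] full_Man[of s] unfolding red_condition_def
        by (cases k) (auto simp del: directions.simps)
    qed
  qed
  also have "\<dots> \<longleftrightarrow> (\<exists>R. \<forall>s. (\<exists>x. jump n Red (b, s) x) \<longrightarrow> red_condition n b R s)" (is "?l \<longleftrightarrow> ?r")
  proof
    assume ?l
    then obtain R where "\<forall>s. (\<exists>x. jump n Red (b, s) x) \<longrightarrow> red_condition n b (\<lambda>_. R s) s"
      using choice[of "\<lambda>s R. (\<exists>x. jump n Red (b, s) x) \<longrightarrow> red_condition n b (\<lambda>_. R) s"] by blast
    then have "\<forall>s. (\<exists>x. jump n Red (b, s) x) \<longrightarrow> red_condition n b R s"
      unfolding red_condition_def .
    then show ?r by blast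
  next
    assume ?r
    then obtain R where R: "\<forall>s. (\<exists>x. jump n Red (b, s) x) \<longrightarrow> red_condition n b R s" by blast
    show ?l
    proof (intro allI impI)
      fix s assume "\<exists>x. jump n Red (b, s) x"
      then have "red_condition n b (\<lambda>_. R s) s" using R unfolding red_condition_def by blast
      then show "\<exists>R. red_condition n b (\<lambda>_. R) s" by blast
    qed
  qed
  finally show ?thesis using forced_to_win_iff[of n b Red] assms by simp
qed


section \<open>Definable predicates\<close>

type_synonym 'a query = "bool list \<Rightarrow> (nat \<Rightarrow> bool) \<Rightarrow> (nat \<Rightarrow> nat) \<Rightarrow> 'a"

definition def_nat :: "nat query \<Rightarrow> bool" where
  "def_nat f \<longleftrightarrow> (\<exists>t. \<forall>x U e. f x U e = trm_val (length x) e t)"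

text \<open>A shallow view of formulas: HOL predicates are shown expressible by introduction rules
  following their definitions, and no formula is ever written out.\<close>

definition definable :: "bool query \<Rightarrow> bool" where
  "definable P \<longleftrightarrow> (\<exists>\<phi>. \<forall>x U e. P x U e = sat x U e \<phi>)"

definition def_sq :: "square query \<Rightarrow> bool" where
  "def_sq f \<longleftrightarrow> (\<exists>r c. def_nat r \<and> def_nat c \<and> (\<forall>x U e. f x U e = (int (r x U e), int (c x U e))))"

lemma def_nat_const: "def_nat (\<lambda>x U e. c)"
  unfolding def_nat_def by (rule exI[of _ "Num c"]) simp

lemma def_nat_var: "def_nat (\<lambda>x U e. e i)"
  unfolding def_nat_def by (rule exI[of _ "Var i"]) simp

lemma def_nat_length: "def_nat (\<lambda>x U e. length x)"
  unfolding def_nat_def by (rule exI[of _ InputLen]) simp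

lemma def_nat_plus: "def_nat f \<Longrightarrow> def_nat g \<Longrightarrow> def_nat (\<lambda>x U e. f x U e + g x U e)"
  unfolding def_nat_def by (metis trm_val.simps(4))

lemma def_nat_times: "def_nat f \<Longrightarrow> def_nat g \<Longrightarrow> def_nat (\<lambda>x U e. f x U e * g x U e)"
  unfolding def_nat_def by (metis trm_val.simps(5))

lemma def_nat_Suc: "def_nat f \<Longrightarrow> def_nat (\<lambda>x U e. Suc (f x U e))"
  using def_nat_plus[OF _ def_nat_const[of 1]] by simp

fun rename_trm :: "(nat \<Rightarrow> nat) \<Rightarrow> trm \<Rightarrow> trm" where
  "rename_trm g (Var i) = Var (g i)"
| "rename_trm g (Num c) = Num c"
| "rename_trm g InputLen = InputLen"
| "rename_trm g (Plus s t) = Plus (rename_trm g s) (rename_trm g t)"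
| "rename_trm g (Times s t) = Times (rename_trm g s) (rename_trm g t)"

lemma trm_val_rename: "trm_val l e (rename_trm g t) = trm_val l (\<lambda>i. e (g i)) t"
  by (induction t) auto

text \<open>Under a quantifier, quantities from outside have to be read from a shifted
  environment.\<close>

lemma def_nat_rename: "def_nat f \<Longrightarrow> def_nat (\<lambda>x U e. f x U (\<lambda>i. e (g i)))"
  unfolding def_nat_def by (metis trm_val_rename)

lemma def_sq_pair: "def_nat r \<Longrightarrow> def_nat c \<Longrightarrow> def_sq (\<lambda>x U e. (int (r x U e), int (c x U e)))"
  unfolding def_sq_def by blast

lemma def_sq_rename: "def_sq f \<Longrightarrow> def_sq (\<lambda>x U e. f x U (\<lambda>i. e (g i)))"
proof -
  assume "def_sq f"
  then obtain r c where f: "def_nat r" "def_nat c" "f = (\<lambda>x U e. (int (r x U e), int (c x U e)))"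
    unfolding def_sq_def by blast
  show ?thesis unfolding f(3) by (rule def_sq_pair[OF def_nat_rename[OF f(1)] def_nat_rename[OF f(2)]])
qed

lemma definable_cong: "definable P \<Longrightarrow> (\<And>x U e. P x U e = Q x U e) \<Longrightarrow> definable Q"
  by (simp add: definable_def)

lemma definable_less: "def_nat f \<Longrightarrow> def_nat g \<Longrightarrow> definable (\<lambda>x U e. f x U e < g x U e)"
  unfolding def_nat_def definable_def by (metis sat.simps(3))

lemma definable_not: "definable P \<Longrightarrow> definable (\<lambda>x U e. \<not> P x U e)"
  unfolding definable_def by (metis sat.simps(4))

lemma definable_and: "definable P \<Longrightarrow> definable Q \<Longrightarrow> definable (\<lambda>x U e. P x U e \<and> Q x U e)"
  unfolding definable_def by (metis sat.simps(5))

lemma definable_or: "definable P \<Longrightarrow> definable Q \<Longrightarrow> definable (\<lambda>x U e. P x U e \<or> Q x U e)"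
  using definable_not[OF definable_and[OF definable_not definable_not]] by simp

lemma definable_imp: "definable P \<Longrightarrow> definable Q \<Longrightarrow> definable (\<lambda>x U e. P x U e \<longrightarrow> Q x U e)"
  unfolding imp_conv_disj by (intro definable_or definable_not)

lemma definable_iff: "definable P \<Longrightarrow> definable Q \<Longrightarrow> definable (\<lambda>x U e. P x U e \<longleftrightarrow> Q x U e)"
  unfolding iff_conv_conj_imp by (intro definable_and definable_imp)

lemma definable_if:
  "definable B \<Longrightarrow> definable P \<Longrightarrow> definable Q \<Longrightarrow> definable (\<lambda>x U e. if B x U e then P x U e else Q x U e)"
  unfolding if_bool_eq_conj by (intro definable_and definable_imp definable_not)

lemma definable_le: "def_nat f \<Longrightarrow> def_nat g \<Longrightarrow> definable (\<lambda>x U e. f x U e \<le> g x U e)"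
  unfolding not_less[symmetric] by (intro definable_not definable_less)

lemma definable_eq_nat: "def_nat f \<Longrightarrow> def_nat g \<Longrightarrow> definable (\<lambda>x U e. f x U e = g x U e)"
  unfolding eq_iff by (intro definable_and definable_le)

lemma definable_const: "definable (\<lambda>x U e. b)"
  by (rule definable_cong[OF definable_less[OF def_nat_const[of 0] def_nat_const[of "of_bool b"]]]) simp

lemma definable_cert: "def_nat f \<Longrightarrow> definable (\<lambda>x U e. U (f x U e))"
  unfolding def_nat_def definable_def by (metis sat.simps(2))

definition input_bit :: "bool list \<Rightarrow> nat \<Rightarrow> bool" where
  "input_bit x i \<longleftrightarrow> i < length x \<and> x ! i"

lemma definable_input: "def_nat f \<Longrightarrow> definable (\<lambda>x U e. input_bit x (f x U e))"
  unfolding def_nat_def definable_def input_bit_def by (metis sat.simps(1))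

text \<open>The quantifier rules move the bound variable to index 0 of the environment.\<close>

lemma definable_ex:
  assumes "def_nat f" "definable (\<lambda>x U e. P x U (\<lambda>i. e (Suc i)) (e 0))"
  shows "definable (\<lambda>x U e. \<exists>v<f x U e. P x U e v)"
proof -
  obtain t \<phi> where t: "\<And>x U e. f x U e = trm_val (length x) e t"
    and \<phi>: "\<And>x U e. P x U (\<lambda>i. e (Suc i)) (e 0) = sat x U e \<phi>"
    using assms unfolding def_nat_def definable_def by blast
  have "(\<exists>v<f x U e. P x U e v) \<longleftrightarrow> sat x U e (Exists t \<phi>)" for x U e
    using \<phi>[of x U "case_nat _ e"] by (simp add: t)
  then show ?thesis unfolding definable_def by blast
qed

lemma definable_all:
  assumes "def_nat f" "definable (\<lambda>x U e. P x U (\<lambda>i. e (Suc i)) (e 0))"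
  shows "definable (\<lambda>x U e. \<forall>v<f x U e. P x U e v)"
  by (rule definable_cong[OF definable_not[OF definable_ex[OF assms(1) definable_not[OF assms(2)]]]]) auto

lemma definable_bex_finite:
  assumes "finite D" "\<And>d. d \<in> D \<Longrightarrow> definable (P d)"
  shows "definable (\<lambda>x U e. \<exists>d\<in>D. P d x U e)"
  using assms
proof (induction D rule: finite_induct)
  case empty
  then show ?case using definable_const[of False] by simp
next
  case (insert a D)
  then have "definable (\<lambda>x U e. P a x U e \<or> (\<exists>d\<in>D. P d x U e))" by (intro definable_or) auto
  then show ?case by simp
qed

lemma definable_ball_finite:
  assumes "finite D" "\<And>d. d \<in> D \<Longrightarrow> definable (P d)"
  shows "definable (\<lambda>x U e. \<forall>d\<in>D. P d x U e)"
  by (rule definable_cong[OF definable_not[OF definable_bex_finite[OF assms(1) definable_not[OF assms(2)]]]]) auto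

lemma definable_dvd: "def_nat f \<Longrightarrow> definable (\<lambda>x U e. m dvd f x U e)"
proof -
  assume f: "def_nat f"
  have "definable (\<lambda>x U e. \<exists>k<Suc (f x U e). f x U e = m * k)"
    by (intro definable_ex definable_eq_nat def_nat_Suc def_nat_times def_nat_const def_nat_var
      f[THEN def_nat_rename] f)
  moreover have "m dvd a \<longleftrightarrow> (\<exists>k<Suc a. a = m * k)" for a :: nat
    by (cases "m = 0") (auto simp: less_Suc_eq_le dvd_def)
  ultimately show ?thesis by simp
qed

lemma mem_squares: "v \<in> squares n \<longleftrightarrow> (\<exists>r<n. \<exists>c<n. v = (int r, int c))"
proof
  assume "v \<in> squares n"
  moreover obtain r c where v: "v = (r, c)" by (cases v)
  ultimately have "v = (int (nat r), int (nat c))" "nat r < n" "nat c < n"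
    by (auto simp: squares_def)
  then show "\<exists>r<n. \<exists>c<n. v = (int r, int c)" by blast
qed (auto simp: squares_def)

lemma definable_ex_sq:
  assumes "def_nat n" "definable (\<lambda>x U e. P x U (\<lambda>i. e (Suc (Suc i))) (int (e 1), int (e 0)))"
  shows "definable (\<lambda>x U e. \<exists>v\<in>squares (n x U e). P x U e v)"
proof -
  have "definable (\<lambda>x U e. \<exists>r<n x U e. \<exists>c<n x U e. P x U e (int r, int c))"
    by (rule definable_ex[OF assms(1)], rule definable_ex[OF def_nat_rename[OF assms(1)]])
      (use assms(2) in simp)
  moreover have "(\<exists>v\<in>squares m. Q v) \<longleftrightarrow> (\<exists>r<m. \<exists>c<m. Q (int r, int c))" for m Q
    unfolding Bex_def mem_squares by blast
  ultimately show ?thesis by simp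
qed

lemma definable_all_sq:
  assumes "def_nat n" "definable (\<lambda>x U e. P x U (\<lambda>i. e (Suc (Suc i))) (int (e 1), int (e 0)))"
  shows "definable (\<lambda>x U e. \<forall>v\<in>squares (n x U e). P x U e v)"
  by (rule definable_cong[OF definable_not[OF definable_ex_sq[OF assms(1) definable_not[OF assms(2)]]]]) auto

text \<open>Terms have no subtraction, so the positive and the negative part of \<open>k\<close> are
  added on different sides.\<close>

lemma definable_int_eq: "def_nat f \<Longrightarrow> def_nat g \<Longrightarrow> definable (\<lambda>x U e. int (f x U e) + k = int (g x U e))"
  by (rule definable_cong[OF definable_eq_nat[OF def_nat_plus[OF _ def_nat_const[of "nat k"]]
    def_nat_plus[OF _ def_nat_const[of "nat (- k)"]]], of f g]) auto

lemma definable_shift_eq: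
  assumes "def_sq f" "def_sq g"
  shows "definable (\<lambda>x U e. f x U e = shift (g x U e) m d)"
proof -
  obtain r c r' c' where f: "def_nat r" "def_nat c" "f = (\<lambda>x U e. (int (r x U e), int (c x U e)))"
    and g: "def_nat r'" "def_nat c'" "g = (\<lambda>x U e. (int (r' x U e), int (c' x U e)))"
    using assms unfolding def_sq_def by blast
  have "definable (\<lambda>x U e. int (r' x U e) + m * fst d = int (r x U e) \<and> int (c' x U e) + m * snd d = int (c x U e))"
    by (intro definable_and definable_int_eq f(1,2) g(1,2))
  then show ?thesis unfolding f(3) g(3) by (rule definable_cong) (cases d; auto)
qed

lemma definable_eq_sq:
  assumes "def_sq f" "def_sq g"
  shows "definable (\<lambda>x U e. f x U e = g x U e)"
proof -
  have "shift v 1 (0, 0) = v" for v by (cases v) simp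
  then show ?thesis using definable_shift_eq[OF assms, of 1 "(0, 0)"] by simp
qed

text \<open>A shifted square may have negative coordinates and thus not be a pair of terms. Since
  \<open>Q\<close> holds only on the board, a quantified square of the board can stand for
  it.\<close>

lemma definable_sub_sq:
  assumes "def_nat n" "\<And>x U e v. Q x U e v \<Longrightarrow> v \<in> squares (n x U e)" "def_sq f"
    and "definable (\<lambda>x U e. Q x U (\<lambda>i. e (Suc (Suc i))) (int (e 1), int (e 0)))"
  shows "definable (\<lambda>x U e. Q x U e (shift (f x U e) m d))"
proof -
  have "definable (\<lambda>x U e. \<exists>v\<in>squares (n x U e). v = shift (f x U e) m d \<and> Q x U e v)"
    by (intro definable_ex_sq definable_and definable_shift_eq def_sq_pair def_nat_var assms(1,4)
      assms(3)[THEN def_sq_rename])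
  then show ?thesis by (rule definable_cong) (use assms(2) in blast)
qed

lemma definable_all_sub:
  assumes "\<And>x U e v. Q x U e v \<Longrightarrow> v \<in> squares (n x U e)" "def_nat n"
    and "definable (\<lambda>x U e. Q x U (\<lambda>i. e (Suc (Suc i))) (int (e 1), int (e 0)))"
    and "definable (\<lambda>x U e. P x U (\<lambda>i. e (Suc (Suc i))) (int (e 1), int (e 0)))"
  shows "definable (\<lambda>x U e. \<forall>v. Q x U e v \<longrightarrow> P x U e v)"
proof -
  have "definable (\<lambda>x U e. \<forall>v\<in>squares (n x U e). Q x U e v \<longrightarrow> P x U e v)"
    by (intro definable_all_sq definable_imp assms(2-))
  then show ?thesis by (rule definable_cong) (use assms(1) in blast)
qed

lemma definable_ex_sub:
  assumes "\<And>x U e v. Q x U e v \<Longrightarrow> v \<in> squares (n x U e)" "def_nat n"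
    and "definable (\<lambda>x U e. Q x U (\<lambda>i. e (Suc (Suc i))) (int (e 1), int (e 0)))"
    and "definable (\<lambda>x U e. P x U (\<lambda>i. e (Suc (Suc i))) (int (e 1), int (e 0)))"
  shows "definable (\<lambda>x U e. \<exists>v. Q x U e v \<and> P x U e v)"
proof -
  have "definable (\<lambda>x U e. \<exists>v\<in>squares (n x U e). Q x U e v \<and> P x U e v)"
    by (intro definable_ex_sq definable_and assms(2-))
  then show ?thesis by (rule definable_cong) (use assms(1) in blast)
qed

lemmas definable_basic = definable_less definable_not definable_and definable_or definable_imp
  definable_iff definable_if definable_le definable_eq_nat definable_const definable_cert
  definable_input definable_ex definable_all definable_dvd definable_ex_sq definable_all_sq
  definable_shift_eq definable_eq_sq def_nat_const def_nat_var def_nat_length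
  def_nat_plus def_nat_times def_nat_Suc def_sq_pair


section \<open>Certificates\<close>

text \<open>A certificate consists of three tables, numbered 0, 1, 2; an entry is addressed by its indices
  as digits in base \<open>N\<close>.\<close>

fun pack :: "nat \<Rightarrow> nat list \<Rightarrow> nat" where
  "pack N [] = 0"
| "pack N (a # as) = a + N * pack N as"

lemma pack_digit:
  "\<forall>a\<in>set as. a < N \<Longrightarrow> i < length as \<Longrightarrow> pack N as div N ^ i mod N = as ! i"
proof (induction as arbitrary: i)
  case (Cons a as)
  then have "a < N" by simp
  then show ?case using Cons by (cases i) (auto simp: div_mult2_eq)
qed simp

definition table :: "(nat \<Rightarrow> bool) \<Rightarrow> nat \<Rightarrow> nat \<Rightarrow> nat list \<Rightarrow> bool" where
  "table U N a as = U (a + 3 * pack N as)"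

text \<open>Every table index has to be a digit: coordinates below \<open>n\<close>, board numbers
  up to \<open>n * n + 1\<close>, and selectors up to 2. For an encoded board the first two are
  controlled by \<open>length x\<close>, and the summand 3 makes room for the selectors.\<close>

definition base :: "bool list \<Rightarrow> nat" where
  "base x = length x + 3"

text \<open>Table 0 holds boards: board 0 is the one after Black's move, and board \<open>Suc t\<close> the one after
  \<open>t\<close> of Black's jumps. Table 1 holds the positions of Black's jumping piece, and
  table 2 an order on the squares for every red king.\<close>

definition cert_board :: "nat \<Rightarrow> nat \<Rightarrow> (nat \<Rightarrow> bool) \<Rightarrow> nat \<Rightarrow> board" where
  "cert_board n N U i = (\<lambda>(r, c). if on_board n (r, c) \<and> table U N 0 [i, nat r, nat c, 0]
     then Some (if table U N 0 [i, nat r, nat c, 1] then Red else Black,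
       if table U N 0 [i, nat r, nat c, 2] then King else Man)
     else None)"

definition cert_pos :: "nat \<Rightarrow> (nat \<Rightarrow> bool) \<Rightarrow> nat \<Rightarrow> square \<Rightarrow> bool" where
  "cert_pos N U t s = table U N 1 [t, nat (fst s), nat (snd s)]"

text \<open>Membership of \<open>v\<close> in the board is built in because
  \<open>forest_order\<close> compares shifted squares, to which \<open>definable_sub_sq\<close>
  must apply.\<close>

definition cert_order :: "nat \<Rightarrow> nat \<Rightarrow> (nat \<Rightarrow> bool) \<Rightarrow> square \<Rightarrow> square \<Rightarrow> square \<Rightarrow> bool" where
  "cert_order n N U s v w \<longleftrightarrow> v \<in> squares n \<and> table U N 2
     [nat (fst s), nat (snd s), nat (fst v), nat (snd v), nat (fst w), nat (snd w)]"

text \<open>Every position decodes uniquely into its remainder modulo 3 and its digits in base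
  \<open>N\<close>, so the prescribed entries never collide.\<close>

lemma certificate_exists:
  fixes Bd :: "nat \<Rightarrow> board"
  assumes N: "3 \<le> N" "n \<le> N" and Bd: "\<And>i s. s \<notin> squares n \<Longrightarrow> Bd i s = None"
  shows "\<exists>U. (\<forall>i<N. cert_board n N U i = Bd i) \<and>
    (\<forall>t<N. \<forall>s\<in>squares n. cert_pos N U t s = Pos t s) \<and>
    (\<forall>s\<in>squares n. \<forall>v\<in>squares n. \<forall>w\<in>squares n. cert_order n N U s v w = R s v w)"
proof -
  define dig where "dig p i = p div 3 div N ^ i mod N" for p i
  define sq where "sq p i = (int (dig p i), int (dig p (Suc i)))" for p i
  define U where "U p = (if p mod 3 = 0 then
      (case Bd (dig p 0) (sq p 1) of None \<Rightarrow> False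
       | Some (c, k) \<Rightarrow> if dig p 3 = 0 then True else if dig p 3 = 1 then c = Red else k = King)
    else if p mod 3 = 1 then Pos (dig p 0) (sq p 1)
    else R (sq p 0) (sq p 2) (sq p 4))" for p
  have dig: "dig (a + 3 * pack N as) i = as ! i"
    if "a < 3" "\<forall>j\<in>set as. j < N" "i < length as" for a as i
    using that pack_digit[of as N i] by (simp add: dig_def)
  have "cert_board n N U i = Bd i" if i: "i < N" for i
  proof
    fix s
    show "cert_board n N U i s = Bd i s"
    proof (cases "s \<in> squares n")
      case True
      then obtain r c where s: "s = (int r, int c)" "r < n" "c < n" unfolding mem_squares by blast
      have "table U N 0 [i, r, c, j] = (case Bd i s of None \<Rightarrow> False
        | Some (q, k) \<Rightarrow> if j = 0 then True else if j = 1 then q = Red else k = King)" if "j < 3" for j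
      proof -
        let ?p = "0 + 3 * pack N [i, r, c, j]"
        have lt: "\<forall>a\<in>set [i, r, c, j]. a < N" using i s N that by auto
        have "dig ?p 0 = i" "dig ?p 1 = r" "dig ?p (Suc 1) = c" "dig ?p 3 = j"
          using dig[OF _ lt, of 0] by (simp_all del: pack.simps)
        moreover have "?p mod 3 = 0" by simp
        ultimately show ?thesis
          unfolding table_def U_def sq_def s by (simp only: simp_thms if_True)
      qed
      note t = this[of 0] this[of 1] this[of 2]
      show ?thesis
      proof (cases "Bd i s")
        case None
        then show ?thesis using t s by (simp add: cert_board_def)
      next
        case (Some q)
        then show ?thesis using t s by (cases q; cases "fst q"; cases "snd q") (auto simp: cert_board_def)
      qed
    next
      case False
      then show ?thesis using Bd by (cases s) (auto simp: cert_board_def squares_def)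
    qed
  qed
  moreover have "cert_pos N U t s = Pos t s" if t: "t < N" "s \<in> squares n" for t s
  proof -
    obtain r c where s: "s = (int r, int c)" "r < n" "c < n" using t(2) unfolding mem_squares by blast
    have "(1 + 3 * p) mod 3 = 1" for p :: nat by presburger
    then show ?thesis
      using dig[of 1 "[t, r, c]"] t(1) s N
      by (simp add: cert_pos_def table_def U_def sq_def del: pack.simps)
  qed
  moreover have "cert_order n N U s v w = R s v w"
    if s: "s \<in> squares n" "v \<in> squares n" "w \<in> squares n" for s v w
  proof -
    obtain r1 c1 r2 c2 r3 c3 where eqs: "s = (int r1, int c1)" "r1 < n" "c1 < n"
      "v = (int r2, int c2)" "r2 < n" "c2 < n" "w = (int r3, int c3)" "r3 < n" "c3 < n"
      using s unfolding mem_squares by blast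
    have "(2 + 3 * p) mod 3 = 2" for p :: nat by presburger
    then show ?thesis
      using dig[of 2 "[r1, c1, r2, c2, r3, c3]"] s(2) eqs N
      by (simp add: cert_order_def table_def U_def sq_def nth_Cons' del: pack.simps)
  qed
  ultimately show ?thesis by blast
qed


section \<open>Moves as definable relations\<close>

text \<open>The atomic statements about boards compare a square with a constant \<open>v\<close>.
  Two boards are compared by letting \<open>v\<close> run through this finite set.\<close>

definition all_pieces :: "piece option set" where
  "all_pieces = insert None (Some ` ({Black, Red} \<times> {Man, King}))"

lemma all_pieces_UNIV: "all_pieces = UNIV"
proof -
  have "v \<in> all_pieces" for v
  proof (cases v)
    case (Some q)
    then show ?thesis by (cases q; cases "fst q"; cases "snd q") (auto simp: all_pieces_def)
  qed (simp add: all_pieces_def)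
  then show ?thesis by blast
qed

lemma finite_all_pieces: "finite all_pieces"
  by (simp add: all_pieces_def)

lemma rank_UNIV: "{Man, King} = UNIV"
  using rank.exhaust by auto

lemma finite_directions: "finite (directions q)"
  using directions_subset by (rule finite_subset) simp

text \<open>A form of \<open>jump\<close> without an existential over boards. Ranks range over an
  explicit finite set, so that the rules for finite disjunctions apply.\<close>

definition can_jump_from :: "nat \<Rightarrow> player \<Rightarrow> board \<Rightarrow> square \<Rightarrow> bool" where
  "can_jump_from n p b s \<longleftrightarrow> (\<exists>k\<in>{Man, King}. \<exists>d\<in>directions (p, k). \<exists>k'\<in>{Man, King}.
     b s = Some (p, k) \<and> b (shift s 1 d) = Some (opponent p, k') \<and>
     (\<exists>l\<in>squares n. l = shift s 2 d \<and> b l = None))"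

definition jump_rel :: "nat \<Rightarrow> player \<Rightarrow> board \<Rightarrow> square \<Rightarrow> board \<Rightarrow> square \<Rightarrow> bool" where
  "jump_rel n p b s b' s' \<longleftrightarrow> (\<exists>k\<in>{Man, King}. \<exists>d\<in>directions (p, k). \<exists>k'\<in>{Man, King}.
     b s = Some (p, k) \<and> b (shift s 1 d) = Some (opponent p, k') \<and> s' = shift s 2 d \<and> b s' = None \<and>
     (\<forall>w\<in>squares n. \<forall>v\<in>all_pieces. b' w = v \<longleftrightarrow> (if w = s' then v = Some (p, k)
       else if w = s \<or> w = shift s 1 d then v = None else b w = v)))"

text \<open>\<open>crown\<close> as a case distinction, so that the resulting piece is a constant in
  either branch.\<close>

definition crowned :: "nat \<Rightarrow> player \<Rightarrow> rank \<Rightarrow> square \<Rightarrow> piece option \<Rightarrow> bool" where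
  "crowned n p k l v \<longleftrightarrow> (if fst l = far_row n p then v = Some (p, King) else v = Some (p, k))"

definition simple_rel :: "nat \<Rightarrow> player \<Rightarrow> board \<Rightarrow> board \<Rightarrow> bool" where
  "simple_rel n p b b' \<longleftrightarrow> (\<exists>s\<in>squares n. \<exists>k\<in>{Man, King}. \<exists>d\<in>directions (p, k). \<exists>l\<in>squares n.
     b s = Some (p, k) \<and> l = shift s 1 d \<and> b l = None \<and>
     (\<forall>w\<in>squares n. \<forall>v\<in>all_pieces. b' w = v \<longleftrightarrow> (if w = l then crowned n p k l v
       else if w = s then v = None else b w = v)))"

definition crown_rel :: "nat \<Rightarrow> player \<Rightarrow> board \<Rightarrow> square \<Rightarrow> board \<Rightarrow> bool" where
  "crown_rel n p b s b' \<longleftrightarrow> (\<exists>k\<in>{Man, King}. b s = Some (p, k) \<and>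
     (\<forall>w\<in>squares n. \<forall>v\<in>all_pieces. b' w = v \<longleftrightarrow> (if w = s then crowned n p k s v else b w = v)))"

lemma board_eq_iff:
  assumes "confined n b" "confined n b'"
  shows "b' = b \<longleftrightarrow> (\<forall>w\<in>squares n. \<forall>v\<in>all_pieces. b' w = v \<longleftrightarrow> b w = v)"
proof -
  have "b' w = b w" if "w \<notin> squares n" for w
    using that assms by (metis confined_def mem_Collect_eq squares_def)
  then show ?thesis unfolding all_pieces_UNIV by (metis UNIV_I ext)
qed

lemma crowned_iff: "crowned n p k l v \<longleftrightarrow> v = Some (crown n l (p, k))"
  by (cases l) (auto simp: crowned_def)

lemma confined_upd:
  "confined n b \<Longrightarrow> on_board n l \<Longrightarrow> confined n (b(l := v))"
  "confined n b \<Longrightarrow> confined n (b(l := None))"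
  by (auto simp: confined_def)

lemma can_jump_from_iff: "can_jump_from n p b s \<longleftrightarrow> (\<exists>x. jump n p (b, s) x)"
proof -
  have l: "(\<exists>l\<in>squares n. l = t \<and> b l = None) \<longleftrightarrow> on_board n t \<and> b t = None" for t
    unfolding squares_def by (metis mem_Collect_eq)
  show ?thesis
  proof
    assume "can_jump_from n p b s"
    then obtain k d k' where "b s = Some (p, k)" "d \<in> directions (p, k)"
      "b (shift s 1 d) = Some (opponent p, k')" "on_board n (shift s 2 d)" "b (shift s 2 d) = None"
      unfolding can_jump_from_def l by blast
    then have "jump n p (b, s) (b(s := None, shift s 1 d := None, shift s 2 d \<mapsto> (p, k)), shift s 2 d)"
      unfolding jump_def prod.case by blast
    then show "\<exists>x. jump n p (b, s) x" by blast
  next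
    assume "\<exists>x. jump n p (b, s) x"
    then obtain b' s' where "jump n p (b, s) (b', s')" by (metis surj_pair)
    then obtain k d k' where *: "b s = Some (p, k)" "d \<in> directions (p, k)"
      "b (shift s 1 d) = Some (opponent p, k')" "on_board n (shift s 2 d)" "b (shift s 2 d) = None"
      unfolding jump_def prod.case by metis
    have "k \<in> {Man, King}" "k' \<in> {Man, King}" by (simp_all add: rank_UNIV)
    with * show "can_jump_from n p b s" unfolding can_jump_from_def l by blast
  qed
qed

lemma jump_rel_iff:
  assumes "confined n b" "confined n b'" "s' \<in> squares n"
  shows "jump_rel n p b s b' s' \<longleftrightarrow> jump n p (b, s) (b', s')"
proof -
  have on: "on_board n s'" using assms(3) by (simp add: squares_def)
  have upd: "(\<forall>w\<in>squares n. \<forall>v\<in>all_pieces. b' w = v \<longleftrightarrow> (if w = s' then v = Some (p, k)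
      else if w = s \<or> w = m then v = None else b w = v)) \<longleftrightarrow> b' = b(s := None, m := None, s' \<mapsto> (p, k))"
    for m k
  proof -
    have "confined n (b(s := None, m := None, s' \<mapsto> (p, k)))"
      using assms(1) on by (intro confined_upd)
    moreover have "(if w = s' then v = Some (p, k) else if w = s \<or> w = m then v = None else b w = v) \<longleftrightarrow>
      (b(s := None, m := None, s' \<mapsto> (p, k))) w = v" for w v
      by auto
    ultimately show ?thesis by (simp only: board_eq_iff[OF _ assms(2)])
  qed
  show ?thesis
    unfolding jump_rel_def jump_def rank_UNIV upd using on by auto
qed

lemma simple_rel_iff:
  assumes "confined n b" "confined n b'"
  shows "simple_rel n p b b' \<longleftrightarrow> simple_move n p b b'"
proof -
  have upd: "(\<forall>w\<in>squares n. \<forall>v\<in>all_pieces. b' w = v \<longleftrightarrow> (if w = l then crowned n p k l v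
       else if w = s then v = None else b w = v)) \<longleftrightarrow> b' = b(s := None, l \<mapsto> crown n l (p, k))"
    if "l \<in> squares n" for s l k
  proof -
    have "confined n (b(s := None, l \<mapsto> crown n l (p, k)))"
      using assms(1) that by (intro confined_upd) (simp_all add: squares_def)
    moreover have "(if w = l then crowned n p k l v else if w = s then v = None else b w = v) \<longleftrightarrow>
      (b(s := None, l \<mapsto> crown n l (p, k))) w = v" for w v
      by (auto simp: crowned_iff)
    ultimately show ?thesis by (simp only: board_eq_iff[OF _ assms(2)])
  qed
  have sq: "s \<in> squares n" if "b s = Some (p, k)" for s k
    using confined_on_board[OF assms(1) that] by (simp add: squares_def)
  show ?thesis
  proof
    assume "simple_rel n p b b'"
    then obtain s k d l where *: "s \<in> squares n" "d \<in> directions (p, k)" "l \<in> squares n"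
      "b s = Some (p, k)" "l = shift s 1 d" "b l = None" "b' = b(s := None, l \<mapsto> crown n l (p, k))"
      unfolding simple_rel_def rank_UNIV using upd by blast
    then have "on_board n (shift s 1 d)" by (simp add: squares_def)
    with * show "simple_move n p b b'" unfolding simple_move_def by blast
  next
    assume "simple_move n p b b'"
    then obtain s k d where *: "b s = Some (p, k)" "d \<in> directions (p, k)" "on_board n (shift s 1 d)"
      "b (shift s 1 d) = None" "b' = b(s := None, shift s 1 d \<mapsto> crown n (shift s 1 d) (p, k))"
      unfolding simple_move_def by blast
    then have l: "shift s 1 d \<in> squares n" by (simp add: squares_def)
    show "simple_rel n p b b'"
      unfolding simple_rel_def rank_UNIV using sq[OF *(1)] * l upd[OF l, of k s] by blast
  qed
qed

lemma crown_rel_iff: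
  assumes "confined n b" "confined n b'" "b s = Some (p, k)"
  shows "crown_rel n p b s b' \<longleftrightarrow> b' = b(s := map_option (crown n s) (b s))"
proof -
  have "confined n (b(s \<mapsto> crown n s (p, k)))"
    using assms(1) confined_on_board[OF assms(1,3)] by (intro confined_upd)
  moreover have "(if w = s then crowned n p k s v else b w = v) \<longleftrightarrow>
    (b(s \<mapsto> crown n s (p, k))) w = v" for w v
    by (auto simp: crowned_iff)
  ultimately have "(\<forall>w\<in>squares n. \<forall>v\<in>all_pieces. b' w = v \<longleftrightarrow> (if w = s then crowned n p k s v else b w = v)) \<longleftrightarrow>
    b' = b(s \<mapsto> crown n s (p, k))"
    by (simp only: board_eq_iff[OF _ assms(2)])
  then show ?thesis using assms(3) unfolding crown_rel_def rank_UNIV by auto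
qed

lemma jump_confined: "jump n p (b, s) (b', s') \<Longrightarrow> confined n b \<Longrightarrow> confined n b' \<and> on_board n s'"
  unfolding jump_def by (auto intro!: confined_upd)

lemma legal_move_confined:
  assumes "legal_move n p b b'" "confined n b"
  shows "confined n b'"
proof (cases "can_jump n p b")
  case True
  then obtain s b1 s1 where j: "(jump n p)\<^sup>+\<^sup>+ (b, s) (b1, s1)" "b' = b1(s1 := map_option (crown n s1) (b1 s1))"
    using assms by (auto simp: legal_move_def jump_turn_def)
  from j(1) have "confined n b1 \<and> on_board n s1"
    by (induction rule: tranclp_induct2) (use assms(2) jump_confined in blast)+
  then show ?thesis using j(2) confined_upd(1) by blast
next
  case False
  then show ?thesis
    using assms by (auto simp: legal_move_def simple_move_def intro!: confined_upd)
qed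

text \<open>Each jump removes an enemy. This bounds the length of a turn, and with it the number of
  boards in the certificate.\<close>

lemma jumps_card_enemies:
  assumes "(jump n p ^^ T) (b, s) (b', s')" "finite (enemies p b)"
  shows "card (enemies p b') + T \<le> card (enemies p b) \<and> finite (enemies p b')"
  using assms(1)
proof (induction T arbitrary: b' s')
  case (Suc T)
  then obtain b1 s1 where 1: "(jump n p ^^ T) (b, s) (b1, s1)" "jump n p (b1, s1) (b', s')"
    by auto
  from 1(2) have sub: "enemies p b' \<subset> enemies p b1"
  proof -
    obtain k d k' where j: "b1 (shift s1 1 d) = Some (opponent p, k')" "s' = shift s1 2 d" "b1 s' = None"
      "b' = b1(s1 := None, shift s1 1 d := None, s' \<mapsto> (p, k))"
      using 1(2) unfolding jump_def prod.case by metis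
    have "shift s1 1 d \<noteq> s'" using j(1,3) by auto
    then have "shift s1 1 d \<notin> enemies p b'" unfolding j(4) by (simp add: enemies_def)
    moreover have "shift s1 1 d \<in> enemies p b1" using j(1) by (simp add: enemies_def)
    moreover have "enemies p b' \<subseteq> enemies p b1"
    proof
      fix m assume "m \<in> enemies p b'"
      then show "m \<in> enemies p b1" unfolding j(4) by (auto simp: enemies_def split: if_splits)
    qed
    ultimately show ?thesis by blast
  qed
  from Suc.IH[OF 1(1)] have "finite (enemies p b1)" by blast
  from psubset_card_mono[OF this sub] finite_subset[OF _ this] sub Suc.IH[OF 1(1)]
  show ?case by auto
qed (use assms(2) in auto)

section \<open>The input word and the verification predicate\<close>

definition encodes :: "nat \<Rightarrow> bool list \<Rightarrow> board \<Rightarrow> bool" where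
  "encodes n x b \<longleftrightarrow> length x = n + 1 + 3 * (n * n) \<and> (\<forall>i<n. input_bit x i) \<and> \<not> input_bit x n \<and>
     (\<forall>r<n. \<forall>c<n. \<forall>v\<in>all_pieces. b (int r, int c) = v \<longrightarrow>
       (\<forall>j\<in>{0, 1, 2}. input_bit x (n + 1 + (3 * (r * n + c) + j)) \<longleftrightarrow> encode_cell v ! j))"

lemma length_encode_cell [simp]: "length (encode_cell v) = 3"
  by (cases v rule: encode_cell.cases) auto

lemma concat_nth:
  assumes "\<And>xs. xs \<in> set xss \<Longrightarrow> length xs = k" "i < length xss" "j < k"
  shows "concat xss ! (i * k + j) = xss ! i ! j"
  using assms
proof (induction xss arbitrary: i)
  case (Cons xs xss)
  show ?case
  proof (cases i)
    case (Suc i')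
    then show ?thesis using Cons by (simp add: nth_append add.assoc)
  qed (use Cons.prems in \<open>simp add: nth_append\<close>)
qed simp

lemma length_concat_const:
  "(\<And>xs. xs \<in> set xss \<Longrightarrow> length xs = k) \<Longrightarrow> length (concat xss) = length xss * k"
  by (induction xss) auto

lemma encode_length_nth:
  "length (encode n b) = n + 1 + 3 * (n * n)"
  "i < n \<Longrightarrow> encode n b ! i" "\<not> encode n b ! n"
  "r < n \<Longrightarrow> c < n \<Longrightarrow> j < 3 \<Longrightarrow>
    encode n b ! (n + 1 + (3 * (r * n + c) + j)) = encode_cell (b (int r, int c)) ! j"
proof -
  define rows where "rows = map (\<lambda>r. map (\<lambda>c. encode_cell (b (int r, int c))) [0..<n]) [0..<n]"
  have enc: "encode n b = replicate n True @ [False] @ concat (concat rows)"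
    unfolding encode_def rows_def ..
  have rows: "length xs = n" if "xs \<in> set rows" for xs using that by (auto simp: rows_def)
  have cells: "length xs = 3" if "xs \<in> set (concat rows)" for xs using that by (auto simp: rows_def)
  have len: "length (concat rows) = n * n" using length_concat_const[of rows n] rows by (simp add: rows_def)
  show "length (encode n b) = n + 1 + 3 * (n * n)"
    using length_concat_const[of "concat rows" 3] cells len by (simp add: enc)
  show "i < n \<Longrightarrow> encode n b ! i" "\<not> encode n b ! n" by (simp_all add: enc nth_append)
  assume r: "r < n" "c < n" "j < 3"
  have "r * n + n \<le> n * n" using mult_le_mono1[of "Suc r" n n] r(1) by simp
  then have "r * n + c < n * n" using r(2) by linarith
  then have "concat (concat rows) ! ((r * n + c) * 3 + j) = concat rows ! (r * n + c) ! j"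
    using r(3) len by (intro concat_nth cells) simp_all
  also have "concat rows ! (r * n + c) = rows ! r ! c"
    using r by (intro concat_nth rows) (simp_all add: rows_def)
  also have "\<dots> = encode_cell (b (int r, int c))" using r by (simp add: rows_def)
  finally show "encode n b ! (n + 1 + (3 * (r * n + c) + j)) = encode_cell (b (int r, int c)) ! j"
    by (simp add: enc nth_append mult.commute add.assoc)
qed

text \<open>Equality of words becomes a statement about single bits. As \<open>v\<close> and
  \<open>j\<close> range over constants, \<open>encode_cell v ! j\<close> is a fixed truth value in
  each instance.\<close>

lemma encodes_iff: "encodes n x b \<longleftrightarrow> x = encode n b"
proof
  assume x: "x = encode n b"
  show "encodes n x b"
    unfolding encodes_def input_bit_def x
  proof (intro conjI allI impI ballI)
    fix r c v j assume *: "r < n" "c < n" "b (int r, int c) = v" "j \<in> {0 :: nat, 1, 2}"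
    have "3 * (r * n + c) + j < 3 * (n * n)"
    proof -
      have "r * n + n \<le> n * n" using mult_le_mono1[of "Suc r" n n] *(1) by simp
      then show ?thesis using * by auto
    qed
    moreover have "encode n b ! (n + 1 + (3 * (r * n + c) + j)) = encode_cell v ! j"
      using encode_length_nth(4)[of r n c j b] * by auto
    ultimately show "(n + 1 + (3 * (r * n + c) + j) < length (encode n b) \<and>
      encode n b ! (n + 1 + (3 * (r * n + c) + j))) = encode_cell v ! j"
      using encode_length_nth(1)[of n b] by auto
  qed (use encode_length_nth in auto)
next
  assume x: "encodes n x b"
  show "x = encode n b"
  proof (rule nth_equalityI)
    show len: "length x = length (encode n b)" using x by (simp add: encodes_def encode_length_nth(1))
    fix i assume i: "i < length x"
    consider "i < n" | "i = n" | "n < i" by linarith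
    then show "x ! i = encode n b ! i"
    proof cases
      case 1
      then show ?thesis using x encode_length_nth(2) by (auto simp: encodes_def input_bit_def)
    next
      case 2
      then show ?thesis using x i encode_length_nth(3) by (auto simp: encodes_def input_bit_def)
    next
      case 3
      define q where "q = (i - (n + 1)) div 3"
      define j where "j = (i - (n + 1)) mod 3"
      define r where "r = q div n"
      define c where "c = q mod n"
      have i': "i = n + 1 + (3 * q + j)" unfolding q_def j_def using 3 by simp
      have "length x = n + 1 + 3 * (n * n)" using x by (simp add: encodes_def)
      then have q: "q < n * n" using i i' by linarith
      then have "0 < n" by (cases n) auto
      then have rc: "r < n" "c < n" "q = r * n + c"
        using q by (auto simp: r_def c_def less_mult_imp_div_less)
      have j: "j < 3" by (simp add: j_def)
      then have "j \<in> {0, 1, 2}" by auto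
      then have "input_bit x i \<longleftrightarrow> encode_cell (b (int r, int c)) ! j"
        using x rc unfolding encodes_def i' all_pieces_UNIV by blast
      then show ?thesis
        using i encode_length_nth(4)[OF rc(1,2) j, of b] unfolding i' rc(3) input_bit_def by simp
    qed
  qed
qed

text \<open>Positions form a predicate instead of a function: some square is marked at time 0, every
  marked square continues to a marked one, and every square marked at time \<open>T\<close> is a
  proper end. Following marked squares in any way thus yields a legal turn.\<close>

definition black_rel :: "nat \<Rightarrow> nat \<Rightarrow> (nat \<Rightarrow> bool) \<Rightarrow> bool" where
  "black_rel n N U \<longleftrightarrow> (if \<exists>s\<in>squares n. can_jump_from n Black (cert_board n N U 1) s
     then \<exists>T<Suc (n * n). 0 < T \<and> (\<exists>s\<in>squares n. cert_pos N U 0 s) \<and>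
       (\<forall>t<T. \<forall>s\<in>squares n. cert_pos N U t s \<longrightarrow> (\<exists>s'\<in>squares n. cert_pos N U (Suc t) s' \<and>
         jump_rel n Black (cert_board n N U (Suc t)) s (cert_board n N U (Suc (Suc t))) s')) \<and>
       (\<forall>s\<in>squares n. cert_pos N U T s \<longrightarrow> \<not> can_jump_from n Black (cert_board n N U (Suc T)) s \<and>
         crown_rel n Black (cert_board n N U (Suc T)) s (cert_board n N U 0))
     else simple_rel n Black (cert_board n N U 1) (cert_board n N U 0))"

definition red_rel :: "nat \<Rightarrow> nat \<Rightarrow> (nat \<Rightarrow> bool) \<Rightarrow> bool" where
  "red_rel n N U \<longleftrightarrow> (\<exists>s\<in>squares n. can_jump_from n Red (cert_board n N U 0) s) \<and>
     (\<forall>s\<in>squares n. can_jump_from n Red (cert_board n N U 0) s \<longrightarrow>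
       red_condition n (cert_board n N U 0) (cert_order n N U) s)"

text \<open>The input board is repeated in the certificate as board 1 and compared with the word, so
  that all boards are accessed through the same tables.\<close>

definition lose_rel :: "nat \<Rightarrow> bool list \<Rightarrow> (nat \<Rightarrow> bool) \<Rightarrow> bool" where
  "lose_rel n x U \<longleftrightarrow> encodes n x (cert_board n (base x) U 1) \<and>
     (\<forall>s\<in>squares n. cert_board n (base x) U 1 s = None \<or> dark s) \<and>
     black_rel n (base x) U \<and> red_rel n (base x) U"

lemma cert_board_confined: "confined n (cert_board n N U i)"
  by (auto simp: confined_def cert_board_def)

lemma jump_from_squares:
  assumes "confined n b" "jump n p (b, s) x"
  shows "s \<in> squares n"
proof -
  from jump_moves_piece[OF assms(2)] obtain k where "b s = Some (p, k)" by auto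
  from confined_on_board[OF assms(1) this] show ?thesis by (simp add: squares_def)
qed

lemma can_jump_iff:
  "confined n b \<Longrightarrow> can_jump n p b \<longleftrightarrow> (\<exists>s\<in>squares n. can_jump_from n p b s)"
  unfolding can_jump_def can_jump_from_iff using jump_from_squares by blast

lemma valid_board_iff:
  "valid_board n b \<longleftrightarrow> confined n b \<and> (\<forall>s\<in>squares n. b s = None \<or> dark s)"
  unfolding valid_board_def confined_def squares_def by (metis mem_Collect_eq)

lemma black_rel_legal_move:
  assumes "black_rel n N U"
  shows "legal_move n Black (cert_board n N U 1) (cert_board n N U 0)"
proof (cases "can_jump n Black (cert_board n N U 1)")
  case True
  let ?B = "cert_board n N U"
  from True assms obtain T s0 where T: "0 < T" "s0 \<in> squares n" "cert_pos N U 0 s0"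
    and step: "\<forall>t<T. \<forall>s\<in>squares n. cert_pos N U t s \<longrightarrow> (\<exists>s'\<in>squares n. cert_pos N U (Suc t) s' \<and>
         jump_rel n Black (?B (Suc t)) s (?B (Suc (Suc t))) s')"
    and last: "\<forall>s\<in>squares n. cert_pos N U T s \<longrightarrow> \<not> can_jump_from n Black (?B (Suc T)) s \<and>
         crown_rel n Black (?B (Suc T)) s (?B 0)"
    unfolding black_rel_def can_jump_iff[OF cert_board_confined] by (auto split: if_splits)
  have "\<exists>s\<in>squares n. cert_pos N U t s \<and> (jump n Black ^^ t) (?B 1, s0) (?B (Suc t), s)" if "t \<le> T" for t
    using that
  proof (induction t)
    case 0
    then show ?case using T by auto
  next
    case (Suc t)
    then obtain s where s: "s \<in> squares n" "cert_pos N U t s" "(jump n Black ^^ t) (?B 1, s0) (?B (Suc t), s)"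
      by auto
    with step Suc.prems obtain s' where s': "s' \<in> squares n" "cert_pos N U (Suc t) s'"
      "jump_rel n Black (?B (Suc t)) s (?B (Suc (Suc t))) s'"
      by (metis Suc_le_lessD)
    then have "jump n Black (?B (Suc t), s) (?B (Suc (Suc t)), s')"
      using jump_rel_iff cert_board_confined by blast
    then show ?case using s s' by auto
  qed
  then obtain s where s: "s \<in> squares n" "cert_pos N U T s" "(jump n Black ^^ T) (?B 1, s0) (?B (Suc T), s)"
    by blast
  then have "(jump n Black)\<^sup>+\<^sup>+ (?B 1, s0) (?B (Suc T), s)"
    using T(1) tranclp_power by metis
  moreover from jumps_move_piece[OF this] obtain k where "?B (Suc T) s = Some (Black, k)" by blast
  then have "?B 0 = (?B (Suc T))(s := map_option (crown n s) (?B (Suc T) s))"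
    using crown_rel_iff cert_board_confined last s(1,2) by metis
  moreover have "\<nexists>x. jump n Black (?B (Suc T), s) x" using last s(1,2) can_jump_from_iff by blast
  ultimately have "jump_turn n Black (?B 1) (?B 0)" unfolding jump_turn_def by blast
  then show ?thesis using True by (simp add: legal_move_def)
next
  case False
  then show ?thesis
    using assms can_jump_iff[OF cert_board_confined] simple_rel_iff[OF cert_board_confined cert_board_confined]
    unfolding black_rel_def legal_move_def by auto
qed

lemma king_condition_cong:
  assumes "\<And>v w. v \<in> F \<Longrightarrow> w \<in> F \<Longrightarrow> R v w = R' v w"
  shows "king_condition F E s R \<longleftrightarrow> king_condition F E s R'"
proof -
  have "forest_order F E t R \<longleftrightarrow> forest_order F E t R'" for t
    unfolding forest_order_def edge_def using assms by (intro ball_cong refl) blast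
  then show ?thesis unfolding king_condition_def using assms by (auto 0 0; metis)
qed

lemma landing_subset: "landing n b s \<subseteq> squares n"
  by (auto simp: landing_def squares_def)

lemma red_condition_cong:
  assumes "\<And>v w. v \<in> squares n \<Longrightarrow> w \<in> squares n \<Longrightarrow> R s v w = R' s v w"
  shows "red_condition n b R s \<longleftrightarrow> red_condition n b R' s"
proof -
  have "king_condition (landing n b s) (enemies Red b) s (R s) \<longleftrightarrow>
    king_condition (landing n b s) (enemies Red b) s (R' s)"
    by (rule king_condition_cong) (use assms landing_subset in blast)
  then show ?thesis unfolding red_condition_def by simp
qed

lemma red_rel_iff:
  assumes "has_piece Black (cert_board n N U 0)"
  shows "red_rel n N U \<Longrightarrow> forced_to_win n Red (cert_board n N U 0)"
proof -
  let ?b = "cert_board n N U 0"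
  assume red: "red_rel n N U"
  have "s \<in> squares n" if "\<exists>x. jump n Red (?b, s) x" for s
    using that jump_from_squares[OF cert_board_confined] by blast
  then have "\<forall>s. (\<exists>x. jump n Red (?b, s) x) \<longrightarrow> red_condition n ?b (cert_order n N U) s"
    using red unfolding red_rel_def can_jump_from_iff by blast
  then show "forced_to_win n Red ?b"
    using red forced_to_win_Red_iff[OF cert_board_confined assms] can_jump_iff[OF cert_board_confined]
    unfolding red_rel_def by blast
qed

lemma lose_rel_sound:
  assumes "lose_rel n x U"
  shows "x \<in> Lose_in_1_Checkers"
proof -
  let ?B = "cert_board n (base x) U"
  have "legal_move n Black (?B 1) (?B 0)"
    using assms black_rel_legal_move unfolding lose_rel_def by blast
  moreover from legal_move_has_piece[OF this] have "forced_to_win n Red (?B 0)"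
    using assms red_rel_iff unfolding lose_rel_def by blast
  ultimately have "lose_in_1 n (?B 1)" unfolding lose_in_1_def by blast
  moreover have "x = encode n (?B 1)" "valid_board n (?B 1)"
    using assms cert_board_confined[of n "base x" U 1]
    unfolding lose_rel_def encodes_iff valid_board_iff by (elim conjE, simp)+
  ultimately show ?thesis unfolding Lose_in_1_Checkers_def by blast
qed

text \<open>The history \<open>f\<close> is constant if Black makes no jump.\<close>

lemma legal_move_history:
  assumes "legal_move n p b b'" "confined n b"
  obtains T f where "T \<le> n * n" "\<And>t. confined n (fst (f t))" "fst (f 0) = b"
    "can_jump n p b \<Longrightarrow> 0 < T \<and> (\<forall>t<T. jump n p (f t) (f (Suc t))) \<and> (\<nexists>x. jump n p (f T) x) \<and>
      b' = (fst (f T))(snd (f T) := map_option (crown n (snd (f T))) (fst (f T) (snd (f T))))"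
proof (cases "can_jump n p b")
  case False
  then show ?thesis using that[of 0 "\<lambda>_. (b, undefined)"] assms(2) by simp
next
  case True
  then obtain s b1 s1 where 1: "(jump n p)\<^sup>+\<^sup>+ (b, s) (b1, s1)" "\<nexists>x. jump n p (b1, s1) x"
    "b' = b1(s1 := map_option (crown n s1) (b1 s1))"
    using assms(1) by (auto simp: legal_move_def jump_turn_def)
  then obtain T where T: "0 < T" "(jump n p ^^ T) (b, s) (b1, s1)" by (metis tranclp_power)
  then obtain f where f: "f 0 = (b, s)" "f T = (b1, s1)" "\<forall>t<T. jump n p (f t) (f (Suc t))"
    using relpowp_fun_conv by metis
  have confined: "confined n (fst (f t))" if "t \<le> T" for t
    using that
  proof (induction t)
    case (Suc t)
    then show ?case using f(3) jump_confined[of n p "fst (f t)" "snd (f t)" "fst (f (Suc t))" "snd (f (Suc t))"]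
      by simp
  qed (use f(1) assms(2) in simp)
  have fin: "finite (enemies p b)" by (rule finite_enemies[OF assms(2)])
  have "enemies p b \<subseteq> squares n"
    using confined_on_board[OF assms(2)] by (auto simp: enemies_def squares_def)
  then have "card (enemies p b) \<le> n * n"
    using card_mono[OF finite_squares] card_squares by metis
  then have "T \<le> n * n" using jumps_card_enemies[OF T(2) fin] by linarith
  \<comment> \<open>Freezing the history at time \<open>T\<close> makes every entry a confined
    board.\<close>
  then show ?thesis
    using that[of T "\<lambda>t. f (min t T)"] confined f T(1) 1(2,3) by (simp add: min_def)
qed

lemma lose_rel_complete:
  assumes "x \<in> Lose_in_1_Checkers"
  shows "\<exists>U n. n < Suc (length x) \<and> lose_rel n x U"
proof -
  obtain n b where b: "x = encode n b" "valid_board n b" "lose_in_1 n b"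
    using assms unfolding Lose_in_1_Checkers_def by blast
  then obtain b' where b': "legal_move n Black b b'" "forced_to_win n Red b'"
    unfolding lose_in_1_def by blast
  have wb: "confined n b" using b(2) valid_board_iff by blast
  have wb': "confined n b'" by (rule legal_move_confined[OF b'(1) wb])
  obtain T f where T: "T \<le> n * n" and f: "\<And>t. confined n (fst (f t))" "fst (f 0) = b"
    "can_jump n Black b \<Longrightarrow> 0 < T \<and> (\<forall>t<T. jump n Black (f t) (f (Suc t))) \<and> (\<nexists>x. jump n Black (f T) x) \<and>
      b' = (fst (f T))(snd (f T) := map_option (crown n (snd (f T))) (fst (f T) (snd (f T))))"
    using legal_move_history[OF b'(1) wb] by blast
  have "has_piece Black b'" by (rule legal_move_has_piece[OF b'(1)])
  then obtain R where R: "can_jump n Red b'" "\<forall>s. (\<exists>x. jump n Red (b', s) x) \<longrightarrow> red_condition n b' R s"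
    using forced_to_win_Red_iff[OF wb'] b'(2) by blast
  have len: "length x = n + 1 + 3 * (n * n)" using b(1) encode_length_nth(1) by simp
  define N where "N = base x"
  have N: "3 \<le> N" "n \<le> N" "Suc T < N" using len T by (auto simp: N_def base_def)
  define Bd where "Bd i = (if i = 0 then b' else fst (f (i - 1)))" for i
  have "\<exists>U. (\<forall>i<N. cert_board n N U i = Bd i) \<and>
    (\<forall>t<N. \<forall>s\<in>squares n. cert_pos N U t s = (s = snd (f t))) \<and>
    (\<forall>s\<in>squares n. \<forall>v\<in>squares n. \<forall>w\<in>squares n. cert_order n N U s v w = R s v w)"
  proof (rule certificate_exists[OF N(1,2)])
    fix i s assume "s \<notin> squares n"
    moreover have "confined n (Bd i)" using f(1) wb' by (simp add: Bd_def)
    ultimately show "Bd i s = None" unfolding confined_def squares_def by (metis mem_Collect_eq)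
  qed
  then obtain U where U: "\<And>i. i < N \<Longrightarrow> cert_board n N U i = Bd i"
    "\<And>t s. t < N \<Longrightarrow> s \<in> squares n \<Longrightarrow> cert_pos N U t s \<longleftrightarrow> s = snd (f t)"
    "\<And>s v w. s \<in> squares n \<Longrightarrow> v \<in> squares n \<Longrightarrow> w \<in> squares n \<Longrightarrow> cert_order n N U s v w = R s v w"
    by blast
  have B: "cert_board n N U 0 = b'" "cert_board n N U 1 = b" "\<And>t. t \<le> T \<Longrightarrow> cert_board n N U (Suc t) = fst (f t)"
    using U(1) N f(2) by (auto simp: Bd_def)
  have "black_rel n N U"
  proof (cases "can_jump n Black b")
    case True
    note f3 = f(3)[OF True]
    have jumps: "jump n Black (fst (f t), snd (f t)) (fst (f (Suc t)), snd (f (Suc t)))" if "t < T" for t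
      using f3 that by simp
    have sq: "snd (f t) \<in> squares n" if "t \<le> T" for t
    proof (cases "t < T")
      case True
      from jump_moves_piece[OF jumps[OF this]] obtain k where "fst (f t) (snd (f t)) = Some (Black, k)" by auto
      from confined_on_board[OF f(1) this] show ?thesis by (simp add: squares_def)
    next
      case False
      \<comment> \<open>No jump starts at the final square, so it is known to be on the board as the
        landing square of the last jump.\<close>
      then have "t = Suc (T - 1)" "T - 1 < T" using f3 that by auto
      then show ?thesis using jump_confined[OF jumps f(1), of "T - 1"] by (simp add: squares_def)
    qed
    have jr: "jump_rel n Black (cert_board n N U (Suc t)) (snd (f t)) (cert_board n N U (Suc (Suc t))) (snd (f (Suc t)))"
      if "t < T" for t
      using jump_rel_iff[OF f(1) f(1) sq[of "Suc t"]] jumps[OF that] B(3) that by simp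
    have stuck: "\<not> can_jump_from n Black (cert_board n N U (Suc T)) (snd (f T))"
      using f3 B(3)[of T] by (simp add: can_jump_from_iff)
    have cr: "crown_rel n Black (cert_board n N U (Suc T)) (snd (f T)) (cert_board n N U 0)"
    proof -
      have "T - 1 < T" "Suc (T - 1) = T" using f3 by auto
      with jump_moves_piece[OF jumps[of "T - 1"]] obtain k where "fst (f T) (snd (f T)) = Some (Black, k)" by auto
      from crown_rel_iff[OF f(1) wb' this] show ?thesis using f3 B(1) B(3)[of T] by simp
    qed
    have c: "\<exists>s\<in>squares n. can_jump_from n Black (cert_board n N U 1) s"
      using True can_jump_iff[OF wb] B(2) by simp
    have pos: "cert_pos N U t s \<longleftrightarrow> s = snd (f t)" if "t \<le> T" "s \<in> squares n" for t s
      using U(2) that N(3) by simp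
    show ?thesis
      unfolding black_rel_def if_P[OF c]
    proof (intro exI[of _ T] conjI allI ballI impI)
      show "\<exists>s\<in>squares n. cert_pos N U 0 s"
        using sq[of 0] pos[of 0] by blast
    next
      fix t s assume t: "t < T" and "s \<in> squares n" "cert_pos N U t s"
      then have "s = snd (f t)" using pos by simp
      then show "\<exists>s'\<in>squares n. cert_pos N U (Suc t) s' \<and>
        jump_rel n Black (cert_board n N U (Suc t)) s (cert_board n N U (Suc (Suc t))) s'"
        using jr[OF t] sq[of "Suc t"] pos[of "Suc t"] t by auto
    qed (use T f3 stuck cr pos in auto)
  next
    case False
    then show ?thesis
      using b'(1) can_jump_iff[OF wb] simple_rel_iff[OF wb wb'] B(1,2)
      unfolding black_rel_def legal_move_def by auto
  qed
  moreover have "red_rel n N U"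
  proof -
    have "red_condition n b' (cert_order n N U) s"
      if s: "s \<in> squares n" "can_jump_from n Red b' s" for s
    proof -
      have "red_condition n b' (cert_order n N U) s \<longleftrightarrow> red_condition n b' R s"
        by (rule red_condition_cong) (use U(3) s(1) in blast)
      then show ?thesis using R(2) s(2) unfolding can_jump_from_iff by blast
    qed
    then show ?thesis unfolding red_rel_def B(1) using R(1) can_jump_iff[OF wb'] by blast
  qed
  moreover have "encodes n x (cert_board n N U 1)" "\<forall>s\<in>squares n. cert_board n N U 1 s = None \<or> dark s"
    unfolding B(2) using b(1,2) encodes_iff valid_board_iff by blast+
  ultimately have "lose_rel n x U" unfolding lose_rel_def N_def by blast
  moreover have "n < Suc (length x)" using len by simp
  ultimately show ?thesis by blast
qed


section \<open>Definability of the game predicates\<close>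

lemma def_nat_base: "def_nat (\<lambda>x U e. base x)"
  unfolding base_def by (intro def_nat_plus def_nat_length def_nat_const)

lemma definable_table3:
  "def_nat f \<Longrightarrow> def_nat g \<Longrightarrow> def_nat h \<Longrightarrow>
    definable (\<lambda>x U e. table U (base x) a [f x U e, g x U e, h x U e])"
  unfolding table_def pack.simps
  by (intro definable_cert def_nat_plus def_nat_times def_nat_const def_nat_base)

lemma definable_table4:
  "def_nat f \<Longrightarrow> def_nat g \<Longrightarrow> def_nat h \<Longrightarrow> def_nat k \<Longrightarrow>
    definable (\<lambda>x U e. table U (base x) a [f x U e, g x U e, h x U e, k x U e])"
  unfolding table_def pack.simps
  by (intro definable_cert def_nat_plus def_nat_times def_nat_const def_nat_base)

lemma definable_table6:
  "def_nat f \<Longrightarrow> def_nat g \<Longrightarrow> def_nat h \<Longrightarrow> def_nat k \<Longrightarrow> def_nat l \<Longrightarrow> def_nat m \<Longrightarrow>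
    definable (\<lambda>x U e. table U (base x) a [f x U e, g x U e, h x U e, k x U e, l x U e, m x U e])"
  unfolding table_def pack.simps
  by (intro definable_cert def_nat_plus def_nat_times def_nat_const def_nat_base)

lemma def_sqE:
  assumes "def_sq f"
  obtains r c where "def_nat r" "def_nat c" "f = (\<lambda>x U e. (int (r x U e), int (c x U e)))"
  using assms unfolding def_sq_def by blast

abbreviation (input) cert_query :: "nat query \<Rightarrow> nat query \<Rightarrow> board query" where
  "cert_query n i x U e \<equiv> cert_board (n x U e) (base x) U (i x U e)"

lemma definable_board:
  assumes "def_nat n" "def_nat i" "def_sq f"
  shows "definable (\<lambda>x U e. cert_query n i x U e (f x U e) = v)"
proof -
  obtain r c where f: "def_nat r" "def_nat c" "f = (\<lambda>x U e. (int (r x U e), int (c x U e)))"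
    using assms(3) by (rule def_sqE)
  note rules = definable_and definable_not definable_iff definable_less definable_table4 definable_const
    def_nat_const assms(1,2) f(1,2)
  show ?thesis
  proof (cases v)
    case None
    have "definable (\<lambda>x U e. \<not> (r x U e < n x U e \<and> c x U e < n x U e \<and>
      table U (base x) 0 [i x U e, r x U e, c x U e, 0]))"
      by (intro rules)
    then show ?thesis by (rule definable_cong) (auto simp: f(3) None cert_board_def)
  next
    case (Some q)
    have "definable (\<lambda>x U e. r x U e < n x U e \<and> c x U e < n x U e \<and>
      table U (base x) 0 [i x U e, r x U e, c x U e, 0] \<and>
      (table U (base x) 0 [i x U e, r x U e, c x U e, 1] \<longleftrightarrow> fst q = Red) \<and>
      (table U (base x) 0 [i x U e, r x U e, c x U e, 2] \<longleftrightarrow> snd q = King))"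
      by (intro rules)
    then show ?thesis
      by (rule definable_cong) (cases q; cases "fst q"; cases "snd q"; auto simp: f(3) Some cert_board_def)
  qed
qed

lemma board_squares: "cert_board n N U i v = Some q \<Longrightarrow> v \<in> squares n"
  using confined_on_board[OF cert_board_confined] by (simp add: squares_def)

lemma definable_board_shift:
  assumes "def_nat n" "def_nat i" "def_sq f"
  shows "definable (\<lambda>x U e. cert_query n i x U e (shift (f x U e) m d) = Some q)"
  by (rule definable_sub_sq[where Q = "\<lambda>x U e v. cert_query n i x U e v = Some q",
        OF assms(1) _ assms(3)], erule board_squares)
    (intro definable_board def_sq_pair def_nat_var assms(1,2)[THEN def_nat_rename])

abbreviation (input) landing_query :: "nat query \<Rightarrow> nat query \<Rightarrow> square query \<Rightarrow> square set query" where
  "landing_query n i s x U e \<equiv> landing (n x U e) (cert_query n i x U e) (s x U e)"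

lemma definable_landing:
  assumes "def_nat n" "def_nat i" "def_sq s" "def_sq f"
  shows "definable (\<lambda>x U e. f x U e \<in> landing_query n i s x U e)"
proof -
  obtain r c where f: "def_nat r" "def_nat c" "f = (\<lambda>x U e. (int (r x U e), int (c x U e)))"
    using assms(4) by (rule def_sqE)
  obtain r' c' where s: "def_nat r'" "def_nat c'" "s = (\<lambda>x U e. (int (r' x U e), int (c' x U e)))"
    using assms(3) by (rule def_sqE)
  \<comment> \<open>Modulo 4 the factor 3 acts as -1, which avoids subtraction.\<close>
  have dvd: "4 dvd int a + int b - (int a' + int b') \<longleftrightarrow> 4 dvd a + b + 3 * (a' + b')" for a b a' b'
  proof -
    have "4 dvd int a + int b - (int a' + int b') \<longleftrightarrow> 4 dvd int (a + b + 3 * (a' + b'))" by presburger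
    also have "\<dots> \<longleftrightarrow> 4 dvd a + b + 3 * (a' + b')" by (metis int_dvd_int_iff of_nat_numeral)
    finally show ?thesis .
  qed
  have "definable (\<lambda>x U e. (r x U e < n x U e \<and> c x U e < n x U e) \<and>
    (2 dvd r x U e + r' x U e \<and> 4 dvd r x U e + c x U e + 3 * (r' x U e + c' x U e)) \<and>
    (cert_query n i x U e (f x U e) = None \<or> f x U e = s x U e))"
    by (intro definable_and definable_or definable_less definable_dvd definable_board definable_eq_sq
      def_nat_plus def_nat_times def_nat_const assms f(1,2) s(1,2))
  then show ?thesis
    by (rule definable_cong) (simp add: landing_def congruent_squares_def f(3) s(3) dvd)
qed

lemma definable_landing_shift:
  assumes "def_nat n" "def_nat i" "def_sq s" "def_sq f"
  shows "definable (\<lambda>x U e. shift (f x U e) m d \<in>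
    landing_query n i s x U e)"
  by (rule definable_sub_sq[where Q = "\<lambda>x U e v. v \<in>
        landing_query n i s x U e",
        OF assms(1) _ assms(4)], rule subsetD[OF landing_subset], assumption)
    (intro definable_landing def_sq_pair def_nat_var assms(1,2)[THEN def_nat_rename] assms(3)[THEN def_sq_rename])

lemma definable_enemies:
  assumes "def_nat n" "def_nat i" "def_sq f"
  shows "definable (\<lambda>x U e. f x U e \<in> enemies p (cert_query n i x U e))"
proof -
  have "definable (\<lambda>x U e. \<exists>k\<in>{Man, King}.
    cert_query n i x U e (f x U e) = Some (opponent p, k))"
    by (intro definable_bex_finite definable_board assms) simp
  then show ?thesis unfolding rank_UNIV by (simp add: enemies_def)
qed

lemma enemies_subset: "enemies p (cert_board n N U i) \<subseteq> squares n"
  using board_squares by (auto simp: enemies_def)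

lemma definable_enemies_shift:
  assumes "def_nat n" "def_nat i" "def_sq f"
  shows "definable (\<lambda>x U e. shift (f x U e) m d \<in> enemies p (cert_query n i x U e))"
  by (rule definable_sub_sq[where Q = "\<lambda>x U e v. v \<in> enemies p (cert_query n i x U e)",
        OF assms(1) _ assms(3)], rule subsetD[OF enemies_subset], assumption)
    (intro definable_enemies def_sq_pair def_nat_var assms(1,2)[THEN def_nat_rename])

lemma definable_pos:
  assumes "def_nat t" "def_sq f"
  shows "definable (\<lambda>x U e. cert_pos (base x) U (t x U e) (f x U e))"
proof -
  obtain r c where f: "def_nat r" "def_nat c" "f = (\<lambda>x U e. (int (r x U e), int (c x U e)))"
    using assms(2) by (rule def_sqE)
  show ?thesis unfolding cert_pos_def f(3) fst_conv snd_conv nat_int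
    by (intro definable_table3 assms(1) f(1,2))
qed

lemma definable_order:
  assumes "def_nat n" "def_sq s" "def_sq f" "def_sq g"
  shows "definable (\<lambda>x U e. cert_order (n x U e) (base x) U (s x U e) (f x U e) (g x U e))"
proof -
  obtain r1 c1 where s: "def_nat r1" "def_nat c1" "s = (\<lambda>x U e. (int (r1 x U e), int (c1 x U e)))"
    using assms(2) by (rule def_sqE)
  obtain r2 c2 where f: "def_nat r2" "def_nat c2" "f = (\<lambda>x U e. (int (r2 x U e), int (c2 x U e)))"
    using assms(3) by (rule def_sqE)
  obtain r3 c3 where g: "def_nat r3" "def_nat c3" "g = (\<lambda>x U e. (int (r3 x U e), int (c3 x U e)))"
    using assms(4) by (rule def_sqE)
  have "(int a, int b) \<in> squares m \<longleftrightarrow> a < m \<and> b < m" for a b m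
    by (simp add: squares_def)
  then show ?thesis unfolding cert_order_def f(3) g(3) s(3) fst_conv snd_conv nat_int
    by (simp only:) (intro definable_and definable_less definable_table6 assms(1) f(1,2) g(1,2) s(1,2))
qed

lemma definable_order_shift:
  assumes "def_nat n" "def_sq s" "def_sq f" "def_sq g"
  shows "definable (\<lambda>x U e. cert_order (n x U e) (base x) U (s x U e) (shift (f x U e) m d) (g x U e))"
  by (rule definable_sub_sq[where Q = "\<lambda>x U e v. cert_order (n x U e) (base x) U (s x U e) v (g x U e)",
        OF assms(1) _ assms(3)], simp add: cert_order_def)
    (intro definable_order def_sq_pair def_nat_var assms(1)[THEN def_nat_rename] assms(2,4)[THEN def_sq_rename])

lemma definable_all_landing:
  assumes "def_nat n" "def_nat i" "def_sq s"
    and "definable (\<lambda>x U e. P x U (\<lambda>i. e (Suc (Suc i))) (int (e 1), int (e 0)))"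
  shows "definable (\<lambda>x U e. \<forall>v\<in>landing_query n i s x U e. P x U e v)"
  unfolding Ball_def
  by (rule definable_all_sub[OF _ assms(1) _ assms(4)], rule subsetD[OF landing_subset], assumption)
    (intro definable_landing def_sq_pair def_nat_var assms(1,2)[THEN def_nat_rename] assms(3)[THEN def_sq_rename])

lemma definable_ex_landing:
  assumes "def_nat n" "def_nat i" "def_sq s"
    and "definable (\<lambda>x U e. P x U (\<lambda>i. e (Suc (Suc i))) (int (e 1), int (e 0)))"
  shows "definable (\<lambda>x U e. \<exists>v\<in>landing_query n i s x U e. P x U e v)"
  unfolding Bex_def
  by (rule definable_ex_sub[OF _ assms(1) _ assms(4)], rule subsetD[OF landing_subset], assumption)
    (intro definable_landing def_sq_pair def_nat_var assms(1,2)[THEN def_nat_rename] assms(3)[THEN def_sq_rename])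

lemma definable_all_enemies:
  assumes "def_nat n" "def_nat i"
    and "definable (\<lambda>x U e. P x U (\<lambda>i. e (Suc (Suc i))) (int (e 1), int (e 0)))"
  shows "definable (\<lambda>x U e. \<forall>v\<in>enemies p (cert_query n i x U e). P x U e v)"
  unfolding Ball_def
  by (rule definable_all_sub[OF _ assms(1) _ assms(3)], rule subsetD[OF enemies_subset], assumption)
    (intro definable_enemies def_sq_pair def_nat_var assms(1,2)[THEN def_nat_rename])

lemma definable_ex_enemies:
  assumes "def_nat n" "def_nat i"
    and "definable (\<lambda>x U e. P x U (\<lambda>i. e (Suc (Suc i))) (int (e 1), int (e 0)))"
  shows "definable (\<lambda>x U e. \<exists>v\<in>enemies p (cert_query n i x U e). P x U e v)"
  unfolding Bex_def
  by (rule definable_ex_sub[OF _ assms(1) _ assms(3)], rule subsetD[OF enemies_subset], assumption)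
    (intro definable_enemies def_sq_pair def_nat_var assms(1,2)[THEN def_nat_rename])

lemma definable_shift_eq': "def_sq f \<Longrightarrow> def_sq g \<Longrightarrow> definable (\<lambda>x U e. shift (g x U e) m d = f x U e)"
  by (rule definable_cong[OF definable_shift_eq[of f g m d]]) auto

lemma definable_eq_fst:
  assumes "def_sq f" "def_sq g"
  shows "definable (\<lambda>x U e. fst (f x U e) = fst (g x U e))"
proof -
  obtain r c where f: "def_nat r" "def_nat c" "f = (\<lambda>x U e. (int (r x U e), int (c x U e)))"
    using assms(1) by (rule def_sqE)
  obtain r' c' where g: "def_nat r'" "def_nat c'" "g = (\<lambda>x U e. (int (r' x U e), int (c' x U e)))"
    using assms(2) by (rule def_sqE)
  show ?thesis unfolding f(3) g(3) fst_conv of_nat_eq_iff by (intro definable_eq_nat f g)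
qed

lemma definable_far_row:
  assumes "def_nat n" "def_sq f"
  shows "definable (\<lambda>x U e. fst (f x U e) = far_row (n x U e) p)"
proof -
  obtain r c where f: "def_nat r" "def_nat c" "f = (\<lambda>x U e. (int (r x U e), int (c x U e)))"
    using assms(2) by (rule def_sqE)
  show ?thesis
  proof (cases p)
    case Black
    have "definable (\<lambda>x U e. Suc (r x U e) = n x U e)"
      by (intro definable_eq_nat def_nat_Suc f assms(1))
    then show ?thesis by (rule definable_cong) (auto simp: f(3) Black)
  next
    case Red
    have "definable (\<lambda>x U e. r x U e = 0)" by (intro definable_eq_nat def_nat_const f)
    then show ?thesis by (rule definable_cong) (auto simp: f(3) Red)
  qed
qed

lemmas definable_rules = definable_basic def_nat_base definable_board definable_board_shift
  definable_landing definable_landing_shift definable_enemies definable_enemies_shift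
  definable_pos definable_order definable_order_shift definable_all_landing definable_ex_landing
  definable_all_enemies definable_ex_enemies definable_shift_eq' definable_eq_fst definable_far_row
  definable_bex_finite definable_ball_finite finite_directions finite_all_pieces

lemma finite_diagonals: "finite diagonals" and finite_ranks: "finite {Man, King}"
  by simp_all

text \<open>Formulas cannot count, but the parity of four truth values is an iterated exclusive
  or.\<close>

lemma odd_deg_xor: "odd_deg F E v \<longleftrightarrow>
  (edge F E v (1, 1) \<noteq> edge F E v (1, -1)) \<noteq> (edge F E v (-1, 1) \<noteq> edge F E v (-1, -1))"
proof -
  let ?l = "filter (edge F E v) [(1, 1), (1, -1), (-1, 1), (-1, -1)]"
  have set: "{d \<in> diagonals. edge F E v d} = set ?l" by auto
  have card: "card {d \<in> diagonals. edge F E v d} = length ?l"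
    unfolding set by (rule distinct_card) simp
  show ?thesis unfolding odd_deg_def card
    by (cases "edge F E v (1, 1)"; cases "edge F E v (1, -1)"; cases "edge F E v (-1, 1)";
        cases "edge F E v (-1, -1)") simp_all
qed

lemma definable_can_jump_from:
  assumes "def_nat n" "def_nat i" "def_sq s"
  shows "definable (\<lambda>x U e. can_jump_from (n x U e) p (cert_query n i x U e) (s x U e))"
  unfolding can_jump_from_def
  by (intro definable_rules finite_ranks assms assms(1,2)[THEN def_nat_rename] assms(3)[THEN def_sq_rename])

lemma definable_crowned:
  assumes "def_nat n" "def_sq l"
  shows "definable (\<lambda>x U e. crowned (n x U e) p k (l x U e) v)"
  unfolding crowned_def by (intro definable_rules assms)

lemma definable_jump_rel:
  assumes "def_nat n" "def_nat i" "def_nat j" "def_sq s" "def_sq s'"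
  shows "definable (\<lambda>x U e. jump_rel (n x U e) p (cert_query n i x U e) (s x U e)
    (cert_query n j x U e) (s' x U e))"
  unfolding jump_rel_def
  by (intro definable_rules finite_ranks assms assms(1-3)[THEN def_nat_rename] assms(4,5)[THEN def_sq_rename])

lemma definable_simple_rel:
  assumes "def_nat n" "def_nat i" "def_nat j"
  shows "definable (\<lambda>x U e. simple_rel (n x U e) p (cert_query n i x U e)
    (cert_query n j x U e))"
  unfolding simple_rel_def
  by (intro definable_rules definable_crowned finite_ranks assms assms(1-3)[THEN def_nat_rename])

lemma definable_crown_rel:
  assumes "def_nat n" "def_nat i" "def_nat j" "def_sq s"
  shows "definable (\<lambda>x U e. crown_rel (n x U e) p (cert_query n i x U e) (s x U e)
    (cert_query n j x U e))"
  unfolding crown_rel_def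
  by (intro definable_rules definable_crowned finite_ranks assms assms(1-3)[THEN def_nat_rename]
    assms(4)[THEN def_sq_rename])

lemma definable_black_rel:
  assumes "def_nat n"
  shows "definable (\<lambda>x U e. black_rel (n x U e) (base x) U)"
  unfolding black_rel_def
  by (intro definable_rules definable_can_jump_from definable_jump_rel definable_simple_rel
    definable_crown_rel assms assms[THEN def_nat_rename])

lemma definable_edge:
  assumes "def_nat n" "def_nat i" "def_sq s" "def_sq v"
  shows "definable (\<lambda>x U e. edge (landing_query n i s x U e)
    (enemies p (cert_query n i x U e)) (v x U e) d)"
  unfolding edge_def
  by (rule definable_and[OF definable_enemies_shift[OF assms(1,2,4)] definable_landing_shift[OF assms]])

lemma definable_on_edge:
  assumes "def_nat n" "def_nat i" "def_sq s" "def_sq m"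
  shows "definable (\<lambda>x U e. on_edge diagonals (landing_query n i s x U e) (m x U e))"
  unfolding on_edge_def
  by (intro definable_ex_landing definable_bex_finite definable_and definable_shift_eq definable_landing_shift
    finite_diagonals def_sq_pair def_nat_var assms assms(1,2)[THEN def_nat_rename] assms(3-)[THEN def_sq_rename])

lemma definable_eulerian:
  assumes "def_nat n" "def_nat i" "def_sq s" "def_sq v" "def_sq t"
  shows "definable (\<lambda>x U e. eulerian (landing_query n i s x U e)
    (enemies p (cert_query n i x U e)) (v x U e) (t x U e))"
  unfolding eulerian_def odd_deg_xor
  by (intro definable_all_landing definable_iff definable_not definable_edge definable_eq_sq
    def_sq_pair def_nat_var assms assms(1,2)[THEN def_nat_rename] assms(3-)[THEN def_sq_rename])

lemma definable_forest_order:
  assumes "def_nat n" "def_nat i" "def_sq s" "def_sq t"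
  shows "definable (\<lambda>x U e. forest_order (landing_query n i s x U e)
    (enemies p (cert_query n i x U e)) (t x U e) (cert_order (n x U e) (base x) U (s x U e)))"
  unfolding forest_order_def
  by (intro definable_all_landing definable_ball_finite definable_imp definable_or definable_not definable_edge
    definable_eq_sq definable_shift_eq' definable_order_shift definable_const
    finite_diagonals def_sq_pair def_nat_var assms assms(1,2)[THEN def_nat_rename] assms(3-)[THEN def_sq_rename])

lemma definable_king_condition:
  assumes "def_nat n" "def_nat i" "def_sq s"
  shows "definable (\<lambda>x U e. king_condition (landing_query n i s x U e)
    (enemies p (cert_query n i x U e)) (s x U e) (cert_order (n x U e) (base x) U (s x U e)))"
  unfolding king_condition_def
  by (intro definable_and definable_all_enemies definable_ex_landing definable_all_landing definable_imp
    definable_not definable_on_edge definable_eulerian definable_forest_order definable_order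
    def_sq_pair def_nat_var assms assms(1,2)[THEN def_nat_rename] assms(3-)[THEN def_sq_rename])

lemma definable_man_condition:
  assumes "def_nat n" "def_nat i" "def_sq s"
  shows "definable (\<lambda>x U e. man_condition (directions q)
    (landing_query n i s x U e)
    (enemies p (cert_query n i x U e)) (s x U e))"
  unfolding man_condition_def
  by (intro definable_rules assms assms(1,2)[THEN def_nat_rename] assms(3)[THEN def_sq_rename])

lemma definable_red_rel:
  assumes "def_nat n"
  shows "definable (\<lambda>x U e. red_rel (n x U e) (base x) U)"
  unfolding red_rel_def red_condition_def
  by (intro definable_rules definable_can_jump_from definable_king_condition definable_man_condition
    assms assms[THEN def_nat_rename])

lemma definable_encodes:
  assumes "def_nat n" "def_nat i"
  shows "definable (\<lambda>x U e. encodes (n x U e) x (cert_query n i x U e))"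
  unfolding encodes_def
  by (intro definable_rules assms assms[THEN def_nat_rename]) simp_all

lemma definable_dark:
  assumes "def_sq f"
  shows "definable (\<lambda>x U e. dark (f x U e))"
proof -
  obtain r c where f: "def_nat r" "def_nat c" "f = (\<lambda>x U e. (int (r x U e), int (c x U e)))"
    using assms by (rule def_sqE)
  have "definable (\<lambda>x U e. 2 dvd r x U e + c x U e)" by (intro definable_dvd def_nat_plus f)
  then show ?thesis by (rule definable_cong) (simp add: f(3))
qed

theorem theorem3:
  shows "Lose_in_1_Checkers \<in> NP"
proof -
  \<comment> \<open>The size of the board is found by a bounded quantifier, and
    \<open>encodes\<close> ties it to the unary prefix of the word.\<close>
  have "definable (\<lambda>x U e. \<exists>n<Suc (length x). lose_rel n x U)"
    unfolding lose_rel_def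
    by (intro definable_rules definable_encodes definable_dark definable_black_rel definable_red_rel)
  then obtain \<phi> where \<phi>: "\<And>x U e. (\<exists>n<Suc (length x). lose_rel n x U) = sat x U e \<phi>"
    unfolding definable_def by blast
  show ?thesis
  proof (rule NP_I)
    show "x \<in> Lose_in_1_Checkers \<longleftrightarrow> (\<exists>U. sat x U (\<lambda>_. 0) \<phi>)" for x
      unfolding \<phi>[symmetric] using lose_rel_sound lose_rel_complete by blast
  qed
qed

end
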